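(* Let $n\ge2$ and let $v$ be an element of the triangle $T=\{(i,j)\in\mathbb Z^2:0\le i\le j\le n\}$. Let $\mathcal W_v$ be the finite family of linear functionals on $\mathtt{GT}_{\mathrm{diag}(\ast)\to\ast}\times\mathtt{GT}_{\mathrm{diag}(\ast)\to\ast}$ defined in the context (namely $\mathcal W_v=\{w_\Xi:\Xi\text{ a lozenge tiling of the excavation hexagon of } v\}$ for $v$ in the interior of $\{0,\dots,n\}^2$, and a singleton otherwise). Then whenever $g_1,g_2\in\mathtt{GT}_{\mathrm{diag}(\ast)\to\ast}$ and $(h,g)=\mathbf{oct}(g_1,g_2)$ is the image under the octahedron recurrence, one has $$h(v)=\max_{w\in\mathcal W_v}w(g_1,g_2).$$
   Context: Gelfand--Tsetlin cone: $\mathtt{GT}_{\mathrm{diag}(\ast)\to\ast}$ is the set of arrays $(\lambda_{j,k})_{1\le j\le k\le n}$ of reals with $\lambda_{j,k+1}\ge\lambda_{j,k}\ge\lambda_{j+1,k+1}$ for $1\le j\le k\le n-1$. A linear functional on a product of two such cones means the restriction of a linear functional on the ambient space $\mathbb R^{n(n+1)}$. The function $\tilde k$. Let $g_1=(\lambda_{j,k})$, $g_2=(\mu_{j,k})$ be Gelfand--Tsetlin patterns with top rows $\lambda_j=\lambda_{j,n}$, $\mu_j=\mu_{j,n}$. Pick any $\gamma\in\mathbb R^n$ with large gaps: $\gamma_i-\gamma_{i+1}>(\lambda_1-\lambda_n)+(\mu_1-\mu_n)$ for $1\le i<n$. Let $U=\{(i,j)\in\mathbb{Z}^2: i,j\le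 n\le i+j\}$ and $U'=\{(i,j)\in\mathbb{Z}^2:i,j\ge0,\ i+j\le n\}$, so $U\cup U'=\{0,\dots,n\}^2$. Define $\tilde k:\{0,\dots,n\}^2\to\mathbb R$ by $$\tilde k(i,j)=-\sum_{l=j+1}^n\gamma_l+\sum_{l=1}^j\lambda_{l,j}+\sum_{l=1}^{i+j-n}\mu_{l,j}\quad((i,j)\in U),\qquad \tilde k(i,j)=-\sum_{l=n-i+1}^n\gamma_l+\sum_{l=1}^j\lambda_{l,n-i}\quad((i,j)\in U').$$ The octahedron recurrence $\mathbf{oct}$. Let $\mathtt{tet}=\{[x,y,z,w]\in\mathbb Z^4:x,y,z,w\ge0,\ x+y+z+w=n\}$. There is a unique $o:\mathtt{tet}\to\mathbb R$ with $o([n-j,n-i,0,i+j-n])=\tilde k(i,j)$ for $(i,j)\in U$, $o([i,j,n-i-j,0])=\tilde k(i,j)$ for $(i,j)\in U'$, and, for all integers $x,y,z,w\ge0$ with $x+y+z+w=n-2$, $$o([x,y,z+1,w+1])=\max\big(o([x+1,y,z+1,w])+o([x,y+1,z,w+1]),\ o([x+1,y,z,w+1])+o([x,y+1,z+1,w])\big)-o([x+1,y+1,z,w]).$$ Then $\mathbf{oct}(g_1,g_2)=(h,g)$, where $h:T\to\mathbb R$ is the hive $h(i,j)=o([0,j-i,n-j,i])$, and $g=(\nu_{j,k})_{1\le j\le k\le n}$ is the Gelfand--Tsetlin pattern determined by $\nu_{1,q}+\dots+\nu_{p,q}=o([n-q,0,q-p,p])+\sum_{l=q+1}^n\gamma_l$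 for $0\le p\le q\le n$. The pair $(h,g)$ does not depend on the choice of $\gamma$. Lozenges and border triangles. A lozenge is a quadruple $ABCD$ with all vertices in $U$, or all vertices in $U'$, of one of the forms (integers $i,j$): (i) $((i,j),(i+1,j-1),(i+2,j-1),(i+1,j))$; (ii) $((i,j),(i,j+1),(i-1,j+2),(i-1,j+1))$; (iii) $((i,j),(i+1,j),(i+1,j+1),(i,j+1))$. Its weight is $\mathbf{wt}(ABCD)=\frac13(\tilde k(A)+\tilde k(C)-\tilde k(B)-\tilde k(D))$. A border edge is an edge from $A=(i,n-i)$ to $C=(i+1,n-i-1)$, $0\le i<n$; it is bordered by two border triangles $ABC$: the upward one with $B=(i+1,n-i)$ and the downward one with $B=(i,n-i-1)$. The weight of a border triangle is $\mathbf{wt}(ABC)=\frac13(\tilde k(B)-\tilde k(A))$. Excavation hexagon. For $v=(i,j)\in T$ with $0<i,j<n$, the excavation hexagon of $v$ is the (solid) hexagon $ABCDEF$ with $(A,B,C,D,E,F)=((0,n),(0,j),(i,j-i),(n+i-j,j-i),(n+i-j,j),(i,n))$; its equator is the segment $AD$. Its weight is $\frac13(\tilde k(B)+\tilde k(C)-\tilde k(D)+\tilde k(E)+\tilde k(F))$. A lozenge tiling $\Xi$ of it is a partition of the solid hexagon into solid lozenges and solid border triangles such that each border edge on the equator is adjacent to exactly one border triangle of the tiling. Let $$w_\Xi(g_1,g_2)=\sum_{\text{lozenges }\diamond\in\Xi}\mathbf{wt}(\diamond)+\sum_{\text{border triangles }\Delta\in\Xi}\mathbf{wt}(\Delta)+\mathbf{wt}(\text{hexagon}).$$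 Although $\tilde k$ depends on $\gamma$, for $v\in T$ the quantity $w_\Xi$ does not, and it is a linear functional of $(g_1,g_2)$. For $v\in T$ on the boundary of $\{0,\dots,n\}^2$, $\mathcal W_v$ consists of the single linear functional $(g_1,g_2)\mapsto\tilde k(v)$, i.e. $\sum_{l\le j}\lambda_l$ if $v=(0,j)$, and $\sum_{l=1}^n\lambda_l+\sum_{l\le i}\mu_l$ if $v=(i,n)$. *)

theory Defs
  imports "HOL-Analysis.Analysis"
begin

type_synonym point = "int \<times> int"
type_synonym pattern = "int \<times> int \<Rightarrow> real"

section \<open>Gelfand--Tsetlin patterns\<close>

text \<open>The entry \<open>\<lambda>\<^sub>j\<^sub>,\<^sub>k\<close> of an array is \<open>lam (j, k)\<close>. Arrays are extensional on their
  index set, so a pattern is exactly a point of a real coordinate space of dimension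
  \<open>n (n + 1) / 2\<close>.\<close>

definition pattern_idx :: "int \<Rightarrow> (int \<times> int) set" where
  "pattern_idx n = {(j, k). 1 \<le> j \<and> j \<le> k \<and> k \<le> n}"

definition GT_patterns :: "int \<Rightarrow> pattern set" where
  "GT_patterns n = {lam \<in> extensional (pattern_idx n).
     \<forall>j k. 1 \<le> j \<and> j \<le> k \<and> k \<le> n - 1 \<longrightarrow>
       lam (j, k + 1) \<ge> lam (j, k) \<and> lam (j, k) \<ge> lam (j + 1, k + 1)}"

text \<open>Restriction to the product of two cones of a linear functional on the ambient
  coordinate space of dimension \<open>n (n + 1)\<close>; \<open>a\<close> and \<open>b\<close> are its coefficients.\<close>

definition linear_functional_on_GT :: "int \<Rightarrow> (pattern \<times> pattern \<Rightarrow> real) \<Rightarrow> bool" where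
  "linear_functional_on_GT n w \<longleftrightarrow>
     (\<exists>a b. \<forall>g1\<in>GT_patterns n. \<forall>g2\<in>GT_patterns n.
        w (g1, g2) = (\<Sum>p\<in>pattern_idx n. a p * g1 p) + (\<Sum>p\<in>pattern_idx n. b p * g2 p))"

section \<open>The function \<open>ktilde\<close>\<close>

definition large_gaps :: "int \<Rightarrow> pattern \<Rightarrow> pattern \<Rightarrow> (int \<Rightarrow> real) set" where
  "large_gaps n lam mu = {\<gamma>. \<forall>i. 1 \<le> i \<and> i < n \<longrightarrow>
     \<gamma> i - \<gamma> (i + 1) > (lam (1, n) - lam (n, n)) + (mu (1, n) - mu (n, n))}"

definition regionU :: "int \<Rightarrow> point set" where
  "regionU n = {(i, j). i \<le> n \<and> j \<le> n \<and> n \<le> i + j}"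

definition regionU' :: "int \<Rightarrow> point set" where
  "regionU' n = {(i, j). 0 \<le> i \<and> 0 \<le> j \<and> i + j \<le> n}"

definition ktilde :: "int \<Rightarrow> (int \<Rightarrow> real) \<Rightarrow> pattern \<Rightarrow> pattern \<Rightarrow> point \<Rightarrow> real" where
  "ktilde n \<gamma> lam mu = (\<lambda>(i, j).
     if (i, j) \<in> regionU n
     then - (\<Sum>l=j+1..n. \<gamma> l) + (\<Sum>l=1..j. lam (l, j)) + (\<Sum>l=1..i+j-n. mu (l, j))
     else - (\<Sum>l=n-i+1..n. \<gamma> l) + (\<Sum>l=1..j. lam (l, n - i)))"

text \<open>The two formulas agree on the overlap of the regions, so each is valid on its whole region.\<close>

lemma ktilde_regionU':
  assumes "(i, j) \<in> regionU' n"
  shows "ktilde n \<gamma> lam mu (i, j) =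
    - (\<Sum>l=n-i+1..n. \<gamma> l) + (\<Sum>l=1..j. lam (l, n - i))"
proof (cases "(i, j) \<in> regionU n")
  case True
  with assms have "n = i + j"
    by (auto simp: regionU_def regionU'_def)
  with True show ?thesis
    by (simp add: ktilde_def)
qed (simp add: ktilde_def)

text \<open>The common value of a quantity over all admissible \<open>\<gamma>\<close>, as a function of the two patterns.\<close>

definition gap_independent ::
  "int \<Rightarrow> ((int \<Rightarrow> real) \<Rightarrow> pattern \<Rightarrow> pattern \<Rightarrow> real) \<Rightarrow> pattern \<times> pattern \<Rightarrow> real" where
  "gap_independent n F = (\<lambda>(g1, g2). THE r. \<forall>\<gamma>\<in>large_gaps n g1 g2. F \<gamma> g1 g2 = r)"

section \<open>The octahedron recurrence\<close>

definition tet :: "int \<Rightarrow> (int \<times> int \<times> int \<times> int) set" where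
  "tet n = {(x, y, z, w). x \<ge> 0 \<and> y \<ge> 0 \<and> z \<ge> 0 \<and> w \<ge> 0 \<and> x + y + z + w = n}"

definition satisfies_octahedron ::
  "int \<Rightarrow> (point \<Rightarrow> real) \<Rightarrow> (int \<times> int \<times> int \<times> int \<Rightarrow> real) \<Rightarrow> bool" where
  "satisfies_octahedron n k f \<longleftrightarrow>
     (\<forall>(i, j)\<in>regionU n. f (n - j, n - i, 0, i + j - n) = k (i, j)) \<and>
     (\<forall>(i, j)\<in>regionU' n. f (i, j, n - i - j, 0) = k (i, j)) \<and>
     (\<forall>x y z w. x \<ge> 0 \<and> y \<ge> 0 \<and> z \<ge> 0 \<and> w \<ge> 0 \<and> x + y + z + w = n - 2 \<longrightarrow>
        f (x, y, z+1, w+1) =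
          max (f (x+1, y, z+1, w) + f (x, y+1, z, w+1))
              (f (x+1, y, z, w+1) + f (x, y+1, z+1, w))
          - f (x+1, y+1, z, w))"

definition octahedron ::
  "int \<Rightarrow> (int \<Rightarrow> real) \<Rightarrow> pattern \<Rightarrow> pattern \<Rightarrow> int \<times> int \<times> int \<times> int \<Rightarrow> real" where
  "octahedron n \<gamma> g1 g2 =
     (THE f. f \<in> extensional (tet n) \<and> satisfies_octahedron n (ktilde n \<gamma> g1 g2) f)"

definition triangleT :: "int \<Rightarrow> point set" where
  "triangleT n = {(i, j). 0 \<le> i \<and> i \<le> j \<and> j \<le> n}"

definition oct :: "int \<Rightarrow> (int \<Rightarrow> real) \<Rightarrow> pattern \<Rightarrow> pattern \<Rightarrow> (point \<Rightarrow> real) \<times> pattern" where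
  "oct n \<gamma> g1 g2 =
     (\<lambda>(i, j)\<in>triangleT n. octahedron n \<gamma> g1 g2 (0, j - i, n - j, i),
      THE nu. nu \<in> GT_patterns n \<and>
        (\<forall>p q. 0 \<le> p \<and> p \<le> q \<and> q \<le> n \<longrightarrow>
          (\<Sum>l=1..p. nu (l, q)) =
            octahedron n \<gamma> g1 g2 (n - q, 0, q - p, p) + (\<Sum>l=q+1..n. \<gamma> l)))"

section \<open>Lozenges and border triangles\<close>

datatype tile = Lozenge point point point point | Border_Triangle point point point

definition lozenges :: "int \<Rightarrow> tile set" where
  "lozenges n = {Lozenge A B C D | A B C D.
     ({A, B, C, D} \<subseteq> regionU n \<or> {A, B, C, D} \<subseteq> regionU' n) \<and>
     (\<exists>i j.
        (A, B, C, D) = ((i, j), (i+1, j-1), (i+2, j-1), (i+1, j)) \<or>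
        (A, B, C, D) = ((i, j), (i, j+1), (i-1, j+2), (i-1, j+1)) \<or>
        (A, B, C, D) = ((i, j), (i+1, j), (i+1, j+1), (i, j+1)))}"

text \<open>The border edge with parameter \<open>i\<close> runs from \<open>(i, n-i)\<close> to \<open>(i+1, n-i-1)\<close>.\<close>

definition border_triangles_at :: "int \<Rightarrow> int \<Rightarrow> tile set" where
  "border_triangles_at n i =
     {Border_Triangle (i, n - i) (i + 1, n - i) (i + 1, n - i - 1),
      Border_Triangle (i, n - i) (i, n - i - 1) (i + 1, n - i - 1)}"

definition border_triangles :: "int \<Rightarrow> tile set" where
  "border_triangles n = (\<Union>i\<in>{0..<n}. border_triangles_at n i)"

fun tile_weight :: "(point \<Rightarrow> real) \<Rightarrow> tile \<Rightarrow> real" where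
  "tile_weight k (Lozenge A B C D) = (k A + k C - k B - k D) / 3"
| "tile_weight k (Border_Triangle A B C) = (k B - k A) / 3"

fun tile_vertices :: "tile \<Rightarrow> point set" where
  "tile_vertices (Lozenge A B C D) = {A, B, C, D}"
| "tile_vertices (Border_Triangle A B C) = {A, B, C}"

section \<open>Solid polygons and tilings of the excavation hexagon\<close>

definition real_point :: "point \<Rightarrow> real \<times> real" where
  "real_point = (\<lambda>(i, j). (real_of_int i, real_of_int j))"

definition solid :: "point set \<Rightarrow> (real \<times> real) set" where
  "solid V = convex hull (real_point ` V)"

definition hexagon :: "int \<Rightarrow> point \<Rightarrow> point \<times> point \<times> point \<times> point \<times> point \<times> point" where
  "hexagon n = (\<lambda>(i, j).
     ((0, n), (0, j), (i, j - i), (n + i - j, j - i), (n + i - j, j), (i, n)))"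

definition solid_hexagon :: "int \<Rightarrow> point \<Rightarrow> (real \<times> real) set" where
  "solid_hexagon n v = (case hexagon n v of (A, B, C, D, E, F) \<Rightarrow> solid {A, B, C, D, E, F})"

definition equator :: "int \<Rightarrow> point \<Rightarrow> (real \<times> real) set" where
  "equator n v = (case hexagon n v of (A, B, C, D, E, F) \<Rightarrow>
     closed_segment (real_point A) (real_point D))"

definition hexagon_weight :: "(point \<Rightarrow> real) \<Rightarrow> int \<Rightarrow> point \<Rightarrow> real" where
  "hexagon_weight k n v = (case hexagon n v of (A, B, C, D, E, F) \<Rightarrow>
     (k B + k C - k D + k E + k F) / 3)"

text \<open>A partition of a solid region into solid tiles means, as usual, that the tiles cover the
  region exactly and that distinct tiles have disjoint interiors.\<close>

definition lozenge_tilings :: "int \<Rightarrow> point \<Rightarrow> tile set set" where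
  "lozenge_tilings n v = {\<Xi>.
     \<Xi> \<subseteq> lozenges n \<union> border_triangles n \<and>
     (\<Union>t\<in>\<Xi>. solid (tile_vertices t)) = solid_hexagon n v \<and>
     pairwise (\<lambda>s t. interior (solid (tile_vertices s)) \<inter> interior (solid (tile_vertices t)) = {}) \<Xi> \<and>
     (\<forall>i\<in>{0..<n}.
        closed_segment (real_point (i, n - i)) (real_point (i + 1, n - i - 1)) \<subseteq> equator n v \<longrightarrow>
        (\<exists>!t. t \<in> \<Xi> \<and> t \<in> border_triangles_at n i))}"

definition tiling_weight ::
  "int \<Rightarrow> point \<Rightarrow> tile set \<Rightarrow> (int \<Rightarrow> real) \<Rightarrow> pattern \<Rightarrow> pattern \<Rightarrow> real" where
  "tiling_weight n v \<Xi> \<gamma> g1 g2 =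
     (\<Sum>t\<in>\<Xi>. tile_weight (ktilde n \<gamma> g1 g2) t) + hexagon_weight (ktilde n \<gamma> g1 g2) n v"

definition functionals :: "int \<Rightarrow> point \<Rightarrow> (pattern \<times> pattern \<Rightarrow> real) set" where
  "functionals n v =
     (if 0 < fst v \<and> fst v < n \<and> 0 < snd v \<and> snd v < n
      then (\<lambda>\<Xi>. gap_independent n (tiling_weight n v \<Xi>)) ` lozenge_tilings n v
      else {gap_independent n (\<lambda>\<gamma> g1 g2. ktilde n \<gamma> g1 g2 v)})"

end

theory Submission
  imports Defs
begin

text \<open>Write \<open>k\<close> for the initial data on the square, \<open>W = i\<close>, \<open>Z = n - j\<close> and \<open>N = W + Z\<close> for a vertex
\<open>(i, j)\<close> in the interior. The argument is purely tropical and rests on three observations.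

\<^item> Cut the excavation hexagon along the antidiagonals \<open>i + j = const\<close>. On each such line, select the
  unit edges that are the short diagonal of a lozenge of form (iii); on the equator, select for either
  side the edges whose border triangle lies on that side, so that the two selections are complementary.
  The triangles between two neighbouring lines form a path, in which each triangle is adjacent only to its
  predecessor and its successor. Without the triangles that the selections match across the two lines or to the
  border, the path has at most one perfect matching, and it has one exactly if the two selections interlace. So a tiling is a pair of triangular interlacing arrays of
  bits, one on each side of the equator (\<open>strip_matching_interlace\<close>, \<open>interlace_strip_matching\<close>,
  \<open>lozenge_tilings_eq\<close>).

\<^item> Give each unit triangle the weight \<open>(B + B' - 2 A) / 3\<close>, where \<open>B\<close> and \<open>B'\<close> are the values at the ends of its
  antidiagonal edge and \<open>A\<close> is the value at its apex. The lozenges of the forms (i) and (ii) weigh as much as their two triangles;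
  a lozenge of form (iii) weighs more by the full \<open>A + C - B - D\<close>. The sum over all triangles
  telescopes, and together with the weight of the hexagon it leaves the sum of \<open>k\<close> along the equator
  (\<open>perfect_weight\<close>). In this form the part of \<open>ktilde\<close> that involves \<open>\<gamma>\<close> cancels, because it
  depends only on the position along a line (\<open>total_weight_ktilde\<close>), and the weight is a sum over strips that
  depends only on the selections.

\<^item> Hence the maximum over tilings is a max-plus product of strip operators, and the
  octahedron recurrence is an exchange relation between them. Let \<open>a\<close> be a line with neighbours \<open>b\<close>
  above and \<open>c\<close> below, and let \<open>e\<close> be the line that the recurrence computes from them. For
  fixed selections on \<open>b\<close> and \<open>c\<close>, read from left to right, the selection on \<open>a\<close> is forced except for
  independent binary choices between \<open>b j + c (j + 1)\<close> and \<open>c j + b (j + 1)\<close>, and the same holds for the selection on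
  \<open>e\<close>; the maximum in the recurrence is the value of such a choice. This gives
  \<open>valley_to_ridge\<close> and \<open>ridge_to_valley\<close>. Exchanging one strip after another
  (\<open>push_strip_le\<close>, \<open>push_strip_ge\<close>) shrinks the equator to the single point at which the recurrence
  produces the value of the hive, and this value is the maximum (\<open>chain_pair_max\<close>).\<close>

section \<open>Interlacing selections and the exchange relation\<close>

definition count_below :: "(nat \<Rightarrow> bool) \<Rightarrow> nat \<Rightarrow> int" where
  "count_below \<sigma> m = (\<Sum>i<m. of_bool (\<sigma> i))"

lemma count_below_0 [simp]: "count_below \<sigma> 0 = 0"
  by (simp add: count_below_def)

lemma count_below_Suc [simp]: "count_below \<sigma> (Suc m) = count_below \<sigma> m + of_bool (\<sigma> m)"
  by (simp add: count_below_def)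

lemma count_below_Not [simp]: "count_below (\<lambda>i. \<not> \<sigma> i) m = int m - count_below \<sigma> m"
  by (induction m) (auto simp: of_bool_def)

text \<open>Selections on a line with \<open>n\<close> edges and on a neighbouring line with \<open>n - 1\<close> edges interlace if, in the order
\<open>\<sigma> 0, \<sigma>' 0, \<sigma> 1, \<sigma>' 1, \<dots>\<close>, selected edges of the two lines alternate, beginning and ending with one of \<open>\<sigma>\<close>.
Prefix counts express this in linear arithmetic.\<close>

definition interlace :: "nat \<Rightarrow> (nat \<Rightarrow> bool) \<Rightarrow> (nat \<Rightarrow> bool) \<Rightarrow> bool" where
  "interlace n \<sigma> \<sigma>' \<longleftrightarrow>
     (\<forall>m<n. count_below \<sigma>' m \<le> count_below \<sigma> m \<and> count_below \<sigma> (Suc m) \<le> count_below \<sigma>' m + 1) \<and>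
     count_below \<sigma> n = count_below \<sigma>' (n - 1) + 1"

text \<open>A selected edge of the longer line \<open>l\<close> contributes the value at the apex above it minus the values at its
ends; a selected edge of the shorter line \<open>l'\<close> contributes the value at the apex in \<open>l\<close>. For an edge
that lies between two strips the two contributions add up to \<open>A + C - B - D\<close> of the lozenge across it.\<close>

definition strip_weight ::
  "nat \<Rightarrow> (nat \<Rightarrow> real) \<Rightarrow> (nat \<Rightarrow> real) \<Rightarrow> (nat \<Rightarrow> bool) \<Rightarrow> (nat \<Rightarrow> bool) \<Rightarrow> real" where
  "strip_weight n l l' \<sigma> \<sigma>' =
     (\<Sum>x<n. of_bool (\<sigma> x) * (l' x - l x - l (Suc x))) + (\<Sum>x<n - 1. of_bool (\<sigma>' x) * l (Suc x))"

text \<open>One layer of the recurrence: the line \<open>a\<close> has \<open>m + 2\<close> edges, \<open>b\<close> and \<open>c\<close> have \<open>m + 1\<close>, and \<open>e\<close> has \<open>m\<close>. The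
selections \<open>t\<close> on \<open>b\<close> and \<open>s\<close> on \<open>c\<close> are held fixed; the selection on \<open>a\<close> or on \<open>e\<close> is optimised.\<close>

locale octahedral_lines =
  fixes m :: nat and a b c e :: "nat \<Rightarrow> real" and t s :: "nat \<Rightarrow> bool"
  assumes octahedral: "\<And>j. j \<le> m \<Longrightarrow> e j = max (c (Suc j) + b j) (b (Suc j) + c j) - a (Suc j)"
begin

text \<open>The state of the scan from left to right. Both for the line \<open>a\<close> and for the line \<open>e\<close> it is the sum of the two
prefix differences that interlacing confines to \<open>{0, 1}\<close>, so it is the same for both lines and is determined by \<open>t\<close> and \<open>s\<close>.\<close>

definition deficit :: "nat \<Rightarrow> int" where
  "deficit j = int j - count_below t j - count_below s j"

text \<open>The two branches of the maximum in the recurrence.\<close>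

definition gain :: "nat \<Rightarrow> bool \<Rightarrow> real" where
  "gain j d = (if d then b j + c (Suc j) else c j + b (Suc j))"

definition best :: "nat \<Rightarrow> bool" where
  "best j \<longleftrightarrow> b (Suc j) + c j \<le> c (Suc j) + b j"

text \<open>The contribution of position \<open>j\<close> to the weight. If neither \<open>t j\<close> nor \<open>s j\<close> holds, then the line \<open>a\<close> has
a free choice, which enters through \<open>g\<close>; if both hold, then the line \<open>e\<close> has one, which enters through \<open>h\<close>. In all other
positions both lines are forced and contribute equally.\<close>

definition tally :: "(nat \<Rightarrow> real) \<Rightarrow> (nat \<Rightarrow> real) \<Rightarrow> nat \<Rightarrow> real" where
  "tally g h j =
     (if t j then a (Suc j) + (if s j then h j else if deficit j = 0 then b j else b (Suc j))
      else if s j then a (Suc j) + (if deficit j = 0 then c j else c (Suc j)) else g j)"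

definition admissible :: bool where
  "admissible \<longleftrightarrow> (\<forall>j\<le>Suc m. deficit j = 0 \<or> deficit j = 1) \<and> deficit (Suc m) = 1"

text \<open>The constant by which the two optimisation problems differ: an alternating sum over all points of the four lines.\<close>

definition offset :: real where
  "offset = (\<Sum>i\<le>Suc m. b i) + (\<Sum>i\<le>Suc m. c i) - (\<Sum>i\<le>Suc (Suc m). a i) - (\<Sum>i\<le>m. e i)"

text \<open>The selection on \<open>a\<close> is seen as it is from \<open>b\<close> and through its complement from \<open>c\<close>, since each edge of \<open>a\<close> owns
exactly one border triangle. After the exchange the same is true of \<open>e\<close>, with the roles of the sides reversed, and
\<open>b\<close> and \<open>c\<close> are then seen through their complements.\<close>

definition valley :: "(nat \<Rightarrow> bool) \<Rightarrow> bool" where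
  "valley u \<longleftrightarrow> interlace (Suc (Suc m)) u t \<and> interlace (Suc (Suc m)) (\<lambda>i. \<not> u i) s"

definition ridge :: "(nat \<Rightarrow> bool) \<Rightarrow> bool" where
  "ridge r \<longleftrightarrow> interlace (Suc m) (\<lambda>i. \<not> t i) (\<lambda>i. \<not> r i) \<and> interlace (Suc m) (\<lambda>i. \<not> s i) r"

lemma gain_le: "j \<le> m \<Longrightarrow> gain j d \<le> e j + a (Suc j)"
  using octahedral[of j] by (auto simp: gain_def)

lemma gain_best: "j \<le> m \<Longrightarrow> gain j (best j) = e j + a (Suc j)"
  using octahedral[of j] by (auto simp: gain_def best_def)

lemma deficit_0 [simp]: "deficit 0 = 0"
  by (simp add: deficit_def)

lemma deficit_Suc: "deficit (Suc j) = deficit j + 1 - of_bool (t j) - of_bool (s j)"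
  by (simp add: deficit_def)

lemma valley_iff:
  "valley u \<longleftrightarrow> (\<forall>j\<le>Suc m. 0 \<le> count_below u j - count_below t j \<and>
       count_below u j - count_below t j + of_bool (u j) \<le> 1 \<and>
       0 \<le> deficit j - (count_below u j - count_below t j) \<and>
       deficit j - (count_below u j - count_below t j) \<le> of_bool (u j)) \<and>
     count_below u (Suc m) - count_below t (Suc m) + of_bool (u (Suc m)) = 1 \<and>
     deficit (Suc m) = 1"
proof -
  have u: "interlace (Suc (Suc m)) u t \<longleftrightarrow>
      (\<forall>j\<le>Suc m. 0 \<le> count_below u j - count_below t j \<and>
         count_below u j - count_below t j + of_bool (u j) \<le> 1) \<and>
      count_below u (Suc m) - count_below t (Suc m) + of_bool (u (Suc m)) = 1"
    unfolding interlace_def less_Suc_eq_le by (simp add: algebra_simps)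
  have u': "interlace (Suc (Suc m)) (\<lambda>i. \<not> u i) s \<longleftrightarrow>
      (\<forall>j\<le>Suc m. 0 \<le> deficit j - (count_below u j - count_below t j) \<and>
         deficit j - (count_below u j - count_below t j) \<le> of_bool (u j)) \<and>
      deficit (Suc m) - (count_below u (Suc m) - count_below t (Suc m)) = of_bool (u (Suc m))"
  proof -
    have 1: "(count_below s j \<le> int j - count_below u j \<and>
        int (Suc j) - count_below u (Suc j) \<le> count_below s j + 1) \<longleftrightarrow>
      (0 \<le> deficit j - (count_below u j - count_below t j) \<and>
         deficit j - (count_below u j - count_below t j) \<le> of_bool (u j))" for j
      by (cases "u j") (auto simp: deficit_def)
    have 2: "int (Suc M) - count_below u (Suc M) = count_below s M + 1
      \<longleftrightarrow> deficit M - (count_below u M - count_below t M) = of_bool (u M)" for M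
      by (cases "u M") (auto simp: deficit_def)
    show ?thesis
      unfolding interlace_def less_Suc_eq_le diff_Suc_1 count_below_Not 1 2 by (rule refl)
  qed
  have last: "x + y = 1 \<and> d - x = y \<longleftrightarrow> x + y = 1 \<and> d = 1" for x y d :: int
    by auto
  show ?thesis
    unfolding valley_def u u' using last by (meson order_refl)
qed

lemma ridge_iff:
  "ridge r \<longleftrightarrow> (\<forall>j\<le>m. 0 \<le> count_below r j - count_below t j \<and>
       count_below r j - count_below t j \<le> of_bool (t j) \<and>
       0 \<le> deficit j - (count_below r j - count_below t j) \<and>
       deficit j - (count_below r j - count_below t j) \<le> of_bool (s j)) \<and>
     count_below r m - count_below t m = of_bool (t m) \<and>
     deficit m - (count_below r m - count_below t m) = of_bool (s m)"
proof -
  have 1: "(int j - count_below r j \<le> int j - count_below t j \<and>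
        int (Suc j) - count_below t (Suc j) \<le> int j - count_below r j + 1) \<longleftrightarrow>
      (0 \<le> count_below r j - count_below t j \<and> count_below r j - count_below t j \<le> of_bool (t j))"
    "int (Suc j) - count_below t (Suc j) = int j - count_below r j + 1 \<longleftrightarrow>
      count_below r j - count_below t j = of_bool (t j)" for j
    by (cases "t j"; auto)+
  have t: "interlace (Suc m) (\<lambda>i. \<not> t i) (\<lambda>i. \<not> r i) \<longleftrightarrow>
      (\<forall>j\<le>m. 0 \<le> count_below r j - count_below t j \<and>
         count_below r j - count_below t j \<le> of_bool (t j)) \<and>
      count_below r m - count_below t m = of_bool (t m)"
    unfolding interlace_def less_Suc_eq_le diff_Suc_1 count_below_Not 1 by (rule refl)
  have 2: "(count_below r j \<le> int j - count_below s j \<and>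
        int (Suc j) - count_below s (Suc j) \<le> count_below r j + 1) \<longleftrightarrow>
      (0 \<le> deficit j - (count_below r j - count_below t j) \<and>
         deficit j - (count_below r j - count_below t j) \<le> of_bool (s j))"
    "int (Suc j) - count_below s (Suc j) = count_below r j + 1 \<longleftrightarrow>
      deficit j - (count_below r j - count_below t j) = of_bool (s j)" for j
    by (cases "s j"; auto simp: deficit_def)+
  have s: "interlace (Suc m) (\<lambda>i. \<not> s i) r \<longleftrightarrow>
      (\<forall>j\<le>m. 0 \<le> deficit j - (count_below r j - count_below t j) \<and>
         deficit j - (count_below r j - count_below t j) \<le> of_bool (s j)) \<and>
      deficit m - (count_below r m - count_below t m) = of_bool (s m)"
    unfolding interlace_def less_Suc_eq_le diff_Suc_1 count_below_Not 2 by (rule refl)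
  show ?thesis
    unfolding ridge_def t s by blast
qed

lemma valley_admissible:
  assumes "valley u"
  shows "admissible"
proof -
  have "deficit j = 0 \<or> deficit j = 1" if "j \<le> Suc m" for j
    using assms that unfolding valley_iff by (cases "u j") force+
  then show ?thesis
    using assms by (auto simp: admissible_def valley_iff)
qed

lemma ridge_admissible:
  assumes "ridge r"
  shows "admissible"
proof -
  have Suc: "deficit (Suc j) = 0 \<or> deficit (Suc j) = 1" if "j < m" for j
  proof -
    let ?q = "\<lambda>j. count_below r j - count_below t j"
    have "0 \<le> ?q (Suc j)" "0 \<le> deficit (Suc j) - ?q (Suc j)"
      "?q j \<le> of_bool (t j)" "deficit j - ?q j \<le> of_bool (s j)"
      using assms that unfolding ridge_iff by (simp_all add: Suc_le_eq del: count_below_Suc)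
    then have "0 \<le> deficit (Suc j)" "deficit j \<le> of_bool (t j) + of_bool (s j)"
      by linarith+
    then show ?thesis by (auto simp: deficit_Suc of_bool_def split: if_splits)
  qed
  have last: "deficit (Suc m) = 1"
    using assms unfolding ridge_iff deficit_Suc by linarith
  have "deficit j = 0 \<or> deficit j = 1" if "j \<le> Suc m" for j
    using that Suc last by (cases j) (auto simp: le_Suc_eq less_eq_Suc_le)
  then show ?thesis
    using last by (simp add: admissible_def)
qed


abbreviation pick :: "(nat \<Rightarrow> bool) \<Rightarrow> nat \<Rightarrow> real" where
  "pick u i \<equiv> if u i then b i else c i"

text \<open>Once the deficit has become 1, the selection at the current position is determined but not yet counted by the sum over
earlier positions; the last summand of the left-hand side supplies it.\<close>

lemma valley_prefix:
  assumes "valley u" "j \<le> Suc m"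
  shows "(\<Sum>i<j. pick u i + (of_bool (t i) + of_bool (s i)) * a (Suc i)) + (if deficit j = 1 then pick u j else 0)
    = (\<Sum>i<j. tally (\<lambda>i. gain i (u i)) (\<lambda>i. a (Suc i)) i)"
  using assms(2)
proof (induction j)
  case 0
  then show ?case by simp
next
  case (Suc j)
  let ?q = "\<lambda>j. count_below u j - count_below t j"
  have q: "0 \<le> ?q i" "?q i + of_bool (u i) \<le> 1" "0 \<le> deficit i - ?q i" "deficit i - ?q i \<le> of_bool (u i)"
    if "i \<le> Suc m" for i
    using assms(1) that unfolding valley_iff by blast+
  have d: "deficit i = 0 \<or> deficit i = 1" if "i \<le> Suc m" for i
    using valley_admissible[OF assms(1)] that by (simp add: admissible_def)
  have q': "?q (Suc j) = ?q j + of_bool (u j) - of_bool (t j)"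
    by simp
  show ?case
    using Suc d[of j] d[of "Suc j"] q[of j] q[of "Suc j"] q' deficit_Suc[of j]
    by (cases "t j"; cases "s j"; cases "u j"; cases "u (Suc j)")
       (auto simp: tally_def gain_def simp del: count_below_Suc)
qed

text \<open>The counterpart for the line \<open>e\<close>, where the pending position is the previous one. Shifting the selection by
one place with \<open>r'\<close> lets the edge \<open>j - 1\<close> of \<open>e\<close> pick a value at the point \<open>j\<close> of \<open>b\<close> or \<open>c\<close>.\<close>

lemma ridge_prefix:
  defines "r' \<equiv> \<lambda>r :: nat \<Rightarrow> bool. \<lambda>i. r (i - 1)"
  assumes "ridge r" "j \<le> Suc m"
  shows "(\<Sum>i<j. of_bool (\<not> t i) * (e i - b i - b (Suc i)) + of_bool (\<not> s i) * (e i - c i - c (Suc i))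
        + (a (Suc i) - e i + b i + b (Suc i) + c i + c (Suc i)) - pick (r' r) (Suc i))
      + (if deficit j = 1 then pick (r' r) j else 0)
    = (\<Sum>i<j. tally (\<lambda>i. e i + a (Suc i)) (\<lambda>i. gain i (r i) - e i) i)"
  using assms(3)
proof (induction j)
  case 0
  then show ?case by simp
next
  case (Suc j)
  let ?q = "\<lambda>j. count_below r j - count_below t j"
  have q: "0 \<le> ?q i" "?q i \<le> of_bool (t i)" "0 \<le> deficit i - ?q i" "deficit i - ?q i \<le> of_bool (s i)"
    if "i \<le> m" for i
    using assms(2) that unfolding ridge_iff by blast+
  have d: "deficit i = 0 \<or> deficit i = 1" if "i \<le> Suc m" for i
    using ridge_admissible[OF assms(2)] that by (simp add: admissible_def)
  have last: "deficit (Suc m) = 1"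
    using ridge_admissible[OF assms(2)] by (simp add: admissible_def)
  have q': "?q (Suc i) = ?q i + of_bool (r i) - of_bool (t i)" for i
    by simp
  have pending: "?q j = of_bool (r (j - 1))" if "deficit j = 1"
  proof (cases j)
    case 0
    with that show ?thesis by simp
  next
    case (Suc i)
    then show ?thesis
      using that q[of i] q[of j] q'[of i] deficit_Suc[of i] d[of i] \<open>Suc j \<le> Suc m\<close>
      by (cases "t i"; cases "s i") (auto simp del: count_below_Suc)
  qed
  have deficits: "deficit j = of_bool (t j \<and> s j) \<or> t j \<noteq> s j"
    "deficit (Suc j) = (if t j = s j then of_bool (\<not> t j) else deficit j)"
    using d[of j] d[of "Suc j"] deficit_Suc[of j] \<open>Suc j \<le> Suc m\<close>
    by (cases "t j"; cases "s j"; auto)+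
  \<comment> \<open>In a position where exactly one of \<open>t\<close>, \<open>s\<close> is selected, the selection on the ridge copies \<open>t\<close>: with deficit 1
    one place to the left, with deficit 0 in the same place.\<close>
  have late: "r (j - 1) = t j" if "deficit j = 1" "t j \<noteq> s j"
    using pending[OF that(1)] q[of j] that \<open>Suc j \<le> Suc m\<close>
    by (cases "t j"; cases "s j"; cases "r (j - 1)") auto
  have early: "r j = t j" if "deficit j = 0" "t j \<noteq> s j"
  proof -
    have "j < m"
      using deficits(2) that last Suc.prems by (cases "j = m") auto
    then show ?thesis
      using q[of j] q[of "Suc j"] q'[of j] deficits(2) that
      by (cases "t j"; cases "s j"; cases "r j") (auto simp del: count_below_Suc)
  qed
  have flip: "r j = (\<not> r (j - 1))" if "deficit j = 1" "t j" "s j"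
  proof -
    have "j < m"
      using deficits(2) that last Suc.prems by (cases "j = m") auto
    then show ?thesis
      using q[of "Suc j"] q'[of j] deficits(2) that pending
      by (cases "r j"; cases "r (j - 1)") (auto simp del: count_below_Suc)
  qed
  define S where "S = (\<Sum>i<j. of_bool (\<not> t i) * (e i - b i - b (Suc i)) + of_bool (\<not> s i) * (e i - c i - c (Suc i))
        + (a (Suc i) - e i + b i + b (Suc i) + c i + c (Suc i)) - pick (r' r) (Suc i))"
  have IH: "S + (if deficit j = 1 then pick (r' r) j else 0)
      = (\<Sum>i<j. tally (\<lambda>i. e i + a (Suc i)) (\<lambda>i. gain i (r i) - e i) i)"
    using Suc unfolding S_def by simp
  show ?case
    unfolding sum.lessThan_Suc S_def[symmetric] IH[symmetric]
    using deficits late early flip d[of j] Suc.prems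
    by (cases "t j"; cases "s j"; cases "r (j - 1)"; cases "r j") (auto simp: tally_def gain_def r'_def)
qed


lemma valley_total:
  assumes "valley u"
  shows "strip_weight (Suc (Suc m)) a b u t + strip_weight (Suc (Suc m)) a c (\<lambda>i. \<not> u i) s =
    (\<Sum>i\<le>m. tally (\<lambda>i. gain i (u i)) (\<lambda>i. a (Suc i)) i) - (\<Sum>i\<le>Suc m. a i + a (Suc i))"
proof -
  have "deficit (Suc m) = 1"
    using valley_admissible[OF assms] by (simp add: admissible_def)
  then have "(\<Sum>i\<le>m. tally (\<lambda>i. gain i (u i)) (\<lambda>i. a (Suc i)) i) =
    (\<Sum>i<Suc m. pick u i + (of_bool (t i) + of_bool (s i)) * a (Suc i)) + pick u (Suc m)"
    using valley_prefix[OF assms, of "Suc m"] by (simp add: lessThan_Suc_atMost)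
  also have "\<dots> = (\<Sum>i<Suc (Suc m). pick u i) + (\<Sum>i<Suc m. (of_bool (t i) + of_bool (s i)) * a (Suc i))"
    by (simp add: sum.distrib)
  also have "(\<Sum>i<Suc (Suc m). pick u i) = (\<Sum>i<Suc (Suc m). of_bool (u i) * (b i - a i - a (Suc i)))
     + (\<Sum>i<Suc (Suc m). of_bool (\<not> u i) * (c i - a i - a (Suc i))) + (\<Sum>i<Suc (Suc m). a i + a (Suc i))"
    unfolding sum.distrib[symmetric] by (intro sum.cong) auto
  also have "(\<Sum>i<Suc m. (of_bool (t i) + of_bool (s i)) * a (Suc i)) =
     (\<Sum>i<Suc m. of_bool (t i) * a (Suc i)) + (\<Sum>i<Suc m. of_bool (s i) * a (Suc i))"
    by (simp only: distrib_right sum.distrib)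
  finally show ?thesis
    by (simp only: strip_weight_def diff_Suc_1 lessThan_Suc_atMost[symmetric])
qed

lemma ridge_total:
  assumes "ridge r"
  shows "strip_weight (Suc m) b e (\<lambda>i. \<not> t i) (\<lambda>i. \<not> r i) + strip_weight (Suc m) c e (\<lambda>i. \<not> s i) r + offset =
    (\<Sum>i\<le>m. tally (\<lambda>i. e i + a (Suc i)) (\<lambda>i. gain i (r i) - e i) i) - (\<Sum>i\<le>Suc m. a i + a (Suc i))"
proof -
  have "deficit (Suc m) = 1"
    using ridge_admissible[OF assms] by (simp add: admissible_def)
  then have "(\<Sum>i\<le>m. tally (\<lambda>i. e i + a (Suc i)) (\<lambda>i. gain i (r i) - e i) i) =
    (\<Sum>i<Suc m. of_bool (\<not> t i) * (e i - b i - b (Suc i)) + of_bool (\<not> s i) * (e i - c i - c (Suc i))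
        + (a (Suc i) - e i + b i + b (Suc i) + c i + c (Suc i)) - (if r i then b (Suc i) else c (Suc i)))
        + (if r m then b (Suc m) else c (Suc m))"
    using ridge_prefix[OF assms, of "Suc m"] by (simp add: lessThan_Suc_atMost)
  also have "\<dots> = (\<Sum>i<Suc m. of_bool (\<not> t i) * (e i - b i - b (Suc i)))
        + (\<Sum>i<Suc m. of_bool (\<not> s i) * (e i - c i - c (Suc i)))
        + (\<Sum>i<Suc m. a (Suc i) - e i + b i + b (Suc i) + c i + c (Suc i))
        - (\<Sum>i<m. if r i then b (Suc i) else c (Suc i))"
    by (simp only: sum.distrib sum_subtractf sum.lessThan_Suc)
  also have "(\<Sum>i<m. if r i then b (Suc i) else c (Suc i)) = (\<Sum>i<m. b (Suc i) + c (Suc i)) -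
     ((\<Sum>i<m. of_bool (\<not> r i) * b (Suc i)) + (\<Sum>i<m. of_bool (r i) * c (Suc i)))"
    unfolding sum.distrib[symmetric] sum_subtractf[symmetric] by (intro sum.cong) auto
  finally have 1: "(\<Sum>i\<le>m. tally (\<lambda>i. e i + a (Suc i)) (\<lambda>i. gain i (r i) - e i) i) =
     strip_weight (Suc m) b e (\<lambda>i. \<not> t i) (\<lambda>i. \<not> r i) + strip_weight (Suc m) c e (\<lambda>i. \<not> s i) r
     + ((\<Sum>i<Suc m. a (Suc i) - e i + b i + b (Suc i) + c i + c (Suc i)) - (\<Sum>i<m. b (Suc i) + c (Suc i)))"
    by (simp only: strip_weight_def diff_Suc_1)
  have 2: "(\<Sum>i<Suc k. a (Suc i) - e i + b i + b (Suc i) + c i + c (Suc i)) - (\<Sum>i<k. b (Suc i) + c (Suc i))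
      = (\<Sum>i\<le>Suc k. b i) + (\<Sum>i\<le>Suc k. c i) - (\<Sum>i\<le>Suc (Suc k). a i) - (\<Sum>i\<le>k. e i) + (\<Sum>i\<le>Suc k. a i + a (Suc i))" for k
    by (induction k) auto
  show ?thesis
    unfolding 1 2 offset_def by simp
qed

lemma tally_mono:
  assumes "\<And>j. j \<le> m \<Longrightarrow> g j \<le> g' j" "\<And>j. j \<le> m \<Longrightarrow> h j \<le> h' j"
  shows "(\<Sum>i\<le>m. tally g h i) \<le> (\<Sum>i\<le>m. tally g' h' i)"
  by (intro sum_mono) (auto simp: tally_def assms)

text \<open>The best branches in the free places fit together: a free choice at \<open>j\<close> fixes the
opposite bit at \<open>j + 1\<close>; in all other places with deficit 1 the bit copies \<open>t\<close> at the previous position.\<close>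

lemma valley_exists:
  assumes "admissible"
  obtains u where "valley u" "\<And>j. \<not> t j \<Longrightarrow> \<not> s j \<Longrightarrow> j \<le> m \<Longrightarrow> u j = best j"
proof
  define u where "u j = (if deficit j = 0 then (if \<not> t j \<and> \<not> s j then best j else t j)
     else (if \<not> t (j - 1) \<and> \<not> s (j - 1) then \<not> best (j - 1) else t (j - 1)))" for j
  have d: "deficit i = 0 \<or> deficit i = 1" if "i \<le> Suc m" for i
    using assms that by (simp add: admissible_def)
  have q: "count_below u j - count_below t j = (if deficit j = 0 then 0 else of_bool (\<not> u j))" if "j \<le> Suc m" for j
    using that
  proof (induction j)
    case 0
    then show ?case by simp
  next
    case (Suc j)
    have step: "count_below u (Suc j) - count_below t (Suc j) =
       (if deficit j = 0 then of_bool (u j) else 1) - of_bool (t j)"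
      using Suc by auto
    show ?case
      unfolding step using Suc.prems d[of j] d[of "Suc j"] deficit_Suc[of j] u_def[of j] u_def[of "Suc j"]
      by (cases "t j"; cases "s j"; cases "deficit j = 0"; auto)
  qed
  show "valley u"
    unfolding valley_iff
  proof (intro conjI allI impI)
    show "deficit (Suc m) = 1"
      using assms by (simp add: admissible_def)
    then show "count_below u (Suc m) - count_below t (Suc m) + of_bool (u (Suc m)) = 1"
      unfolding q[OF order_refl] by simp
  next
    fix j assume j: "j \<le> Suc m"
    show "0 \<le> count_below u j - count_below t j" "count_below u j - count_below t j + of_bool (u j) \<le> 1"
      "0 \<le> deficit j - (count_below u j - count_below t j)"
      "deficit j - (count_below u j - count_below t j) \<le> of_bool (u j)"
      unfolding q[OF j] using d[OF j] by auto
  qed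
  show "u j = best j" if "\<not> t j" "\<not> s j" "j \<le> m" for j
    using that d[of j] d[of "Suc j"] deficit_Suc[of j] by (auto simp: u_def)
qed

text \<open>On the line \<open>e\<close> a free choice at \<open>j\<close> fixes the opposite bit at \<open>j - 1\<close>, so the bit at \<open>j\<close> depends on the deficit after position \<open>j\<close>.\<close>

lemma ridge_exists:
  assumes "admissible"
  obtains r where "ridge r" "\<And>j. t j \<Longrightarrow> s j \<Longrightarrow> j \<le> m \<Longrightarrow> r j = best j"
proof
  define r where "r j = (if deficit (Suc j) = 0 then (if t j \<and> s j then best j else t j)
     else (if t (Suc j) \<and> s (Suc j) then \<not> best (Suc j) else t (Suc j)))" for j
  have d: "deficit i = 0 \<or> deficit i = 1" if "i \<le> Suc m" for i
    using assms that by (simp add: admissible_def)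
  have last: "deficit (Suc m) = 1"
    using assms by (simp add: admissible_def)
  have q: "count_below r j - count_below t j = (if deficit j = 0 then 0 else of_bool (r (j - 1)))" if "j \<le> m" for j
    using that
  proof (induction j)
    case 0
    then show ?case by simp
  next
    case (Suc j)
    have step: "count_below r (Suc j) - count_below t (Suc j) =
       (if deficit j = 0 then 0 else of_bool (r (j - 1))) + of_bool (r j) - of_bool (t j)"
      using Suc by auto
    show ?case
      unfolding step using Suc.prems d[of j] d[of "Suc j"] deficit_Suc[of j] r_def[of j] r_def[of "j - 1"]
      by (cases "t j"; cases "s j"; cases "deficit j = 0"; cases j; auto)
  qed
  have bounds: "(if deficit j = 0 then 0 else of_bool (r (j - 1))) \<le> (of_bool (t j) :: int)"
    "deficit j - (if deficit j = 0 then 0 else of_bool (r (j - 1))) \<le> of_bool (s j)"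
    "0 \<le> deficit j - (if deficit j = 0 then 0 else of_bool (r (j - 1)))" if "j \<le> m" for j
    using that d[of j] d[of "Suc j"] deficit_Suc[of j]
    by (cases "t j"; cases "s j"; cases j; auto simp: r_def)+
  show "ridge r"
    unfolding ridge_iff
  proof (intro conjI allI impI)
    show "count_below r m - count_below t m = of_bool (t m)"
      "deficit m - (count_below r m - count_below t m) = of_bool (s m)"
      using q[of m] bounds[of m] last deficit_Suc[of m] by auto
  qed (use q bounds in auto)
  show "r j = best j" if "t j" "s j" "j \<le> m" for j
    using that d[of j] d[of "Suc j"] deficit_Suc[of j] by (auto simp: r_def)
qed

text \<open>A valley never exceeds the tally with the maximum in every free place, and a ridge that chooses the larger branch
everywhere attains it. The converse holds with the roles exchanged, so the two optimisation
problems have the same value up to \<open>offset\<close>.\<close>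

lemma valley_to_ridge:
  assumes "valley u"
  obtains r where "ridge r"
    "strip_weight (Suc (Suc m)) a b u t + strip_weight (Suc (Suc m)) a c (\<lambda>i. \<not> u i) s \<le>
     strip_weight (Suc m) b e (\<lambda>i. \<not> t i) (\<lambda>i. \<not> r i) + strip_weight (Suc m) c e (\<lambda>i. \<not> s i) r + offset"
proof -
  obtain r where r: "ridge r" "\<And>j. t j \<Longrightarrow> s j \<Longrightarrow> j \<le> m \<Longrightarrow> r j = best j"
    using ridge_exists[OF valley_admissible[OF assms]] by blast
  have "(\<Sum>i\<le>m. tally (\<lambda>i. gain i (u i)) (\<lambda>i. a (Suc i)) i) \<le> (\<Sum>i\<le>m. tally (\<lambda>i. e i + a (Suc i)) (\<lambda>i. a (Suc i)) i)"
    by (intro tally_mono gain_le) auto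
  also have "\<dots> = (\<Sum>i\<le>m. tally (\<lambda>i. e i + a (Suc i)) (\<lambda>i. gain i (r i) - e i) i)"
    by (intro sum.cong) (auto simp: tally_def r(2) gain_best)
  finally show ?thesis
    using that[OF r(1)] unfolding valley_total[OF assms] ridge_total[OF r(1)] by simp
qed

lemma ridge_to_valley:
  assumes "ridge r"
  obtains u where "valley u"
    "strip_weight (Suc m) b e (\<lambda>i. \<not> t i) (\<lambda>i. \<not> r i) + strip_weight (Suc m) c e (\<lambda>i. \<not> s i) r + offset \<le>
     strip_weight (Suc (Suc m)) a b u t + strip_weight (Suc (Suc m)) a c (\<lambda>i. \<not> u i) s"
proof -
  obtain u where u: "valley u" "\<And>j. \<not> t j \<Longrightarrow> \<not> s j \<Longrightarrow> j \<le> m \<Longrightarrow> u j = best j"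
    using valley_exists[OF ridge_admissible[OF assms]] by blast
  have "(\<Sum>i\<le>m. tally (\<lambda>i. e i + a (Suc i)) (\<lambda>i. gain i (r i) - e i) i) \<le>
      (\<Sum>i\<le>m. tally (\<lambda>i. e i + a (Suc i)) (\<lambda>i. a (Suc i)) i)"
    using gain_le by (intro tally_mono) (auto simp: diff_le_eq add.commute)
  also have "\<dots> = (\<Sum>i\<le>m. tally (\<lambda>i. gain i (u i)) (\<lambda>i. a (Suc i)) i)"
    by (intro sum.cong) (auto simp: tally_def u(2) gain_best)
  finally show ?thesis
    using that[OF u(1)] unfolding valley_total[OF u(1)] ridge_total[OF assms] by simp
qed

end

section \<open>Chains of strips and their maximal weight\<close>

text \<open>A triangular array of selections that starts with \<open>\<sigma>\<close> on the line \<open>l 0\<close> of \<open>n\<close> edges, goes through \<open>h\<close> strips, and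
ends with the empty selection on \<open>l h\<close>, together with its weight. The far side of the hexagon is such an
empty line because no lozenge crosses it.\<close>

inductive chain :: "nat \<Rightarrow> nat \<Rightarrow> (nat \<Rightarrow> nat \<Rightarrow> real) \<Rightarrow> (nat \<Rightarrow> bool) \<Rightarrow> real \<Rightarrow> bool" where
  chain_0: "(\<And>x. x < n \<Longrightarrow> \<not> \<sigma> x) \<Longrightarrow> chain 0 n l \<sigma> 0"
| chain_Suc: "interlace n \<sigma> \<sigma>' \<Longrightarrow> chain h (n - 1) (\<lambda>w. l (Suc w)) \<sigma>' v \<Longrightarrow>
    chain (Suc h) n l \<sigma> (strip_weight n (l 0) (l 1) \<sigma> \<sigma>' + v)"

inductive_cases chain_0E: "chain 0 n l \<sigma> v"
inductive_cases chain_SucE: "chain (Suc h) n l \<sigma> v"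

lemma count_below_cong: "(\<And>x. x < m \<Longrightarrow> \<sigma> x = \<tau> x) \<Longrightarrow> count_below \<sigma> m = count_below \<tau> m"
  by (simp add: count_below_def)

lemma count_below_le: "count_below \<sigma> m \<le> int m"
  by (induction m) (auto simp: of_bool_def)

lemma count_below_full: "(\<forall>x<m. \<sigma> x) \<longleftrightarrow> count_below \<sigma> m = int m"
proof (induction m)
  case (Suc m)
  then show ?case using count_below_le[of \<sigma> m] by (auto simp: less_Suc_eq)
qed simp

lemma interlace_full:
  assumes "\<And>x. x < Suc n \<Longrightarrow> \<sigma> x"
  shows "interlace (Suc n) \<sigma> \<sigma>' \<longleftrightarrow> (\<forall>x<n. \<sigma>' x)"
proof -
  have c: "count_below \<sigma> m = int m" if "m \<le> Suc n" for m
    using count_below_full[of m \<sigma>] assms that by auto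
  show ?thesis
  proof
    assume "interlace (Suc n) \<sigma> \<sigma>'"
    then have "count_below \<sigma>' n = int n"
      using c[of "Suc n"] by (simp add: interlace_def del: count_below_Suc)
    then show "\<forall>x<n. \<sigma>' x" by (simp add: count_below_full)
  next
    assume *: "\<forall>x<n. \<sigma>' x"
    have c': "count_below \<sigma>' m = int m" if "m \<le> n" for m
      using count_below_full[of m \<sigma>'] * that by auto
    show "interlace (Suc n) \<sigma> \<sigma>'"
      by (auto simp: interlace_def c c' less_Suc_eq_le simp del: count_below_Suc)
  qed
qed

lemma strip_weight_full:
  assumes "\<And>x. x < Suc n \<Longrightarrow> \<sigma> x" "\<And>x. x < n \<Longrightarrow> \<sigma>' x"
  shows "strip_weight (Suc n) l l' \<sigma> \<sigma>' = (\<Sum>x\<le>n. l' x) - (\<Sum>x\<le>Suc n. l x)"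
proof -
  have "strip_weight (Suc n) l l' \<sigma> \<sigma>' = (\<Sum>x<Suc n. l' x - l x - l (Suc x)) + (\<Sum>x<n. l (Suc x))"
    unfolding strip_weight_def using assms by (intro arg_cong2[of _ _ _ _ "(+)"] sum.cong) auto
  also have "\<dots> = (\<Sum>x\<le>n. l' x) - (\<Sum>x\<le>Suc n. l x)"
    by (induction n) auto
  finally show ?thesis .
qed

text \<open>Below a full selection interlacing forces every line to be full, so the array is unique and its weight telescopes.
This is the base case in which the equator has collapsed onto one side.\<close>

lemma chain_full:
  assumes "\<And>x. x < n \<Longrightarrow> \<sigma> x"
  shows "chain n n l \<sigma> v \<longleftrightarrow> v = l n 0 - (\<Sum>x\<le>n. l 0 x)"
  using assms
proof (induction n arbitrary: l \<sigma> v)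
  case 0
  show ?case by (auto elim: chain_0E intro: chain_0)
next
  case (Suc n)
  show ?case
  proof
    assume "chain (Suc n) (Suc n) l \<sigma> v"
    then obtain \<sigma>' v' where *: "interlace (Suc n) \<sigma> \<sigma>'" "chain n n (\<lambda>w. l (Suc w)) \<sigma>' v'"
      "v = strip_weight (Suc n) (l 0) (l 1) \<sigma> \<sigma>' + v'"
      by (auto elim: chain_SucE)
    then have "\<forall>x<n. \<sigma>' x"
      using interlace_full[of n \<sigma>] Suc.prems by simp
    then show "v = l (Suc n) 0 - (\<Sum>x\<le>Suc n. l 0 x)"
      using Suc.IH[of \<sigma>' "\<lambda>w. l (Suc w)" v'] Suc.prems * strip_weight_full[of n \<sigma> \<sigma>'] by simp
  next
    assume v: "v = l (Suc n) 0 - (\<Sum>x\<le>Suc n. l 0 x)"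
    have i: "interlace (Suc n) \<sigma> (\<lambda>_. True)"
      using interlace_full[of n \<sigma>] Suc.prems by simp
    have "chain n (Suc n - 1) (\<lambda>w. l (Suc w)) (\<lambda>_. True) (l (Suc n) 0 - (\<Sum>x\<le>n. l 1 x))"
      using Suc.IH[of "\<lambda>_. True" "\<lambda>w. l (Suc w)"] by simp
    from chain_Suc[OF i this] show "chain (Suc n) (Suc n) l \<sigma> v"
      using strip_weight_full[of n \<sigma> "\<lambda>_. True"] Suc.prems by (simp add: v algebra_simps)
  qed
qed

text \<open>The families \<open>l\<close> and \<open>l'\<close> of lines are consecutive layers of a solution of the octahedron recurrence.\<close>

definition octahedral_step :: "(nat \<Rightarrow> nat \<Rightarrow> real) \<Rightarrow> (nat \<Rightarrow> nat \<Rightarrow> real) \<Rightarrow> bool" where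
  "octahedral_step l l' \<longleftrightarrow> (\<forall>z x. l' (Suc z) x =
     max (l (Suc z) (Suc x) + l' z x) (l' z (Suc x) + l (Suc z) x) - l z (Suc x))"

lemma octahedral_step_Suc: "octahedral_step l l' \<Longrightarrow> octahedral_step (\<lambda>w. l (Suc w)) (\<lambda>w. l' (Suc w))"
  by (simp add: octahedral_step_def)

text \<open>A strip on top of a chain of \<open>h\<close> strips is exchanged with these one by one. Afterwards the chain lives in the next layer, and the
strip has moved to the far end, where its selections are full and its weight is a constant. The constants of the
exchanges telescope to the difference of the sums over the two initial lines.\<close>

lemma push_strip_le:
  assumes "octahedral_step l l'"
    and "h < n" "interlace n u t" "chain h n l (\<lambda>x. \<not> u x) v"
  obtains v' where "chain h (n - 1) l' (\<lambda>x. \<not> t x) v'"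
    "strip_weight n (l 0) (l' 0) u t + v \<le> v' + ((\<Sum>x<n. l' 0 x) - (\<Sum>x\<le>n. l 0 x))"
  using assms
proof (induction h arbitrary: n l l' u t v thesis)
  case 0
  then obtain n' where n: "n = Suc n'" by (cases n) auto
  have u: "\<And>x. x < n \<Longrightarrow> u x" and v: "v = 0"
    using "0.prems"(5) by (auto elim: chain_0E)
  then have t: "\<And>x. x < n' \<Longrightarrow> t x"
    using "0.prems"(4) interlace_full[of n' u] by (auto simp: n)
  show ?case
    using "0.prems"(1)[of 0] u t v strip_weight_full[of n' u t] 
    by (force simp: n lessThan_Suc_atMost intro: chain_0)
next
  case (Suc h)
  then obtain m where n: "n = Suc (Suc m)"
    by (metis Suc_lessE less_Suc_eq_0_disj less_trans_Suc not_less_eq)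
  from Suc.prems(5) obtain s v1 where s: "interlace n (\<lambda>x. \<not> u x) s" "chain h (n - 1) (\<lambda>w. l (Suc w)) s v1"
      "v = strip_weight n (l 0) (l 1) (\<lambda>x. \<not> u x) s + v1"
    by (auto elim: chain_SucE)
  interpret octahedral_lines m "l 0" "l' 0" "l 1" "l' 1" t s
    by unfold_locales (use Suc.prems(2) in \<open>simp add: octahedral_step_def\<close>)
  have "valley u"
    using s(1) Suc.prems(4) by (simp add: valley_def n)
  from valley_to_ridge[OF this] obtain r where r: "ridge r"
    "strip_weight n (l 0) (l' 0) u t + strip_weight n (l 0) (l 1) (\<lambda>i. \<not> u i) s \<le>
     strip_weight (Suc m) (l' 0) (l' 1) (\<lambda>i. \<not> t i) (\<lambda>i. \<not> r i) + strip_weight (Suc m) (l 1) (l' 1) (\<lambda>i. \<not> s i) r + offset"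
    unfolding n by blast
  have "interlace (n - 1) (\<lambda>i. \<not> s i) r"
    using r(1) by (simp add: ridge_def n)
  moreover have "chain h (n - 1) (\<lambda>w. l (Suc w)) (\<lambda>i. \<not> \<not> s i) v1"
    using s(2) by simp
  ultimately obtain v' where v': "chain h (n - 1 - 1) (\<lambda>w. l' (Suc w)) (\<lambda>x. \<not> r x) v'"
    "strip_weight (n - 1) (l 1) (l' 1) (\<lambda>i. \<not> s i) r + v1 \<le> v' + ((\<Sum>x<n-1. l' 1 x) - (\<Sum>x\<le>n-1. l 1 x))"
    using Suc.IH[where l' = "\<lambda>w. l' (Suc w)" and l = "\<lambda>w. l (Suc w)" and n = "n - 1" and v = v1
        and u = "\<lambda>i. \<not> s i" and t = r] octahedral_step_Suc[OF Suc.prems(2)] less_diff_conv[of h n 1] Suc.prems(3) by auto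
  have "chain (Suc h) (n - 1) l' (\<lambda>x. \<not> t x) (strip_weight (n - 1) (l' 0) (l' 1) (\<lambda>i. \<not> t i) (\<lambda>i. \<not> r i) + v')"
    using r(1) v'(1) by (intro chain_Suc) (auto simp: ridge_def n)
  then show ?case
    by (rule Suc.prems(1)) (use r(2)[unfolded offset_def] v'(2) s(3) in \<open>simp add: n lessThan_Suc_atMost\<close>)
qed

lemma push_strip_ge:
  assumes "octahedral_step l l'"
    and "h < n" "chain h (n - 1) l' (\<lambda>x. \<not> t x) v'"
  obtains u v where "interlace n u t" "chain h n l (\<lambda>x. \<not> u x) v"
    "v' + ((\<Sum>x<n. l' 0 x) - (\<Sum>x\<le>n. l 0 x)) \<le> strip_weight n (l 0) (l' 0) u t + v"
  using assms
proof (induction h arbitrary: n l l' t v' thesis)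
  case 0
  then obtain n' where n: "n = Suc n'" by (cases n) auto
  have t: "\<And>x. x < n' \<Longrightarrow> t x" and v: "v' = 0"
    using "0.prems"(4) by (auto elim: chain_0E simp: n)
  have i: "interlace n (\<lambda>_. True) t"
    using t interlace_full[of n' "\<lambda>_. True" t] by (auto simp: n)
  show ?case
    using "0.prems"(1)[OF i, of 0] t v strip_weight_full[of n' "\<lambda>_. True" t] 
    by (force simp: n lessThan_Suc_atMost intro: chain_0)
next
  case (Suc h)
  then obtain m where n: "n = Suc (Suc m)"
    by (metis Suc_lessE less_Suc_eq_0_disj less_trans_Suc not_less_eq)
  from Suc.prems(4) obtain r' v1 where r': "interlace (n - 1) (\<lambda>x. \<not> t x) r'" "chain h (n - 1 - 1) (\<lambda>w. l' (Suc w)) r' v1"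
      "v' = strip_weight (n - 1) (l' 0) (l' 1) (\<lambda>x. \<not> t x) r' + v1"
    by (auto elim: chain_SucE)
  define r where "r x = (\<not> r' x)" for x
  have r'_eq: "r' = (\<lambda>x. \<not> r x)"
    by (simp add: r_def)
  obtain u0 v0 where u0: "interlace (n - 1) u0 r" "chain h (n - 1) (\<lambda>w. l (Suc w)) (\<lambda>x. \<not> u0 x) v0"
    "v1 + ((\<Sum>x<n-1. l' 1 x) - (\<Sum>x\<le>n-1. l 1 x)) \<le> strip_weight (n - 1) (l 1) (l' 1) u0 r + v0"
    using Suc.IH[where l' = "\<lambda>w. l' (Suc w)" and l = "\<lambda>w. l (Suc w)" and n = "n - 1" and v' = v1 and t = r] octahedral_step_Suc[OF Suc.prems(2)] less_diff_conv[of h n 1] Suc.prems(3) r'(2)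
    unfolding r'_eq by auto
  define s where "s x = (\<not> u0 x)" for x
  have u0_eq: "u0 = (\<lambda>x. \<not> s x)"
    by (simp add: s_def)
  interpret octahedral_lines m "l 0" "l' 0" "l 1" "l' 1" t s
    by unfold_locales (use Suc.prems(2) in \<open>simp add: octahedral_step_def\<close>)
  have "ridge r"
    using r'(1) u0(1) unfolding r'_eq u0_eq by (simp add: ridge_def n)
  from ridge_to_valley[OF this] obtain u where u: "valley u"
    "strip_weight (Suc m) (l' 0) (l' 1) (\<lambda>i. \<not> t i) (\<lambda>i. \<not> r i) + strip_weight (Suc m) (l 1) (l' 1) (\<lambda>i. \<not> s i) r + offset \<le>
     strip_weight n (l 0) (l' 0) u t + strip_weight n (l 0) (l 1) (\<lambda>i. \<not> u i) s"
    unfolding n by blast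
  have "chain (Suc h) n l (\<lambda>x. \<not> u x) (strip_weight n (l 0) (l 1) (\<lambda>x. \<not> u x) s + v0)"
    using u(1) u0(2) unfolding u0_eq by (intro chain_Suc) (auto simp: valley_def n)
  moreover have "interlace n u t"
    using u(1) by (simp add: valley_def n)
  ultimately show ?case
    using u(2)[unfolded offset_def] u0(3) r'(3) unfolding r'_eq u0_eq
    by (intro Suc.prems(1)[of u]) (auto simp: n lessThan_Suc_atMost)
qed

text \<open>Pushing the first strip of the upper chain through the lower chain yields the same situation with a shorter
equator in the next layer. Induction on \<open>W\<close> ends with an upper chain without strips, whose selection is
empty, so that the lower one is full.\<close>

lemma chain_pair_max:
  assumes oct: "\<And>w. octahedral_step (\<lambda>z. L z w) (\<lambda>z. L z (Suc w))"
  shows chain_pair_le: "chain W (W + Z) (L 0) \<sigma> v \<Longrightarrow> chain Z (W + Z) (\<lambda>z. L z 0) (\<lambda>x. \<not> \<sigma> x) v' \<Longrightarrow>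
      v + v' \<le> L Z W 0 - (\<Sum>x\<le>W + Z. L 0 0 x)" (is "PROP ?le")
    and chain_pair_attained: "\<exists>\<sigma> v v'. chain W (W + Z) (L 0) \<sigma> v \<and>
      chain Z (W + Z) (\<lambda>z. L z 0) (\<lambda>x. \<not> \<sigma> x) v' \<and> v + v' = L Z W 0 - (\<Sum>x\<le>W + Z. L 0 0 x)" (is ?at)
proof -
  have le: "chain W (W + Z) (L 0) \<sigma> v \<Longrightarrow> chain Z (W + Z) (\<lambda>z. L z 0) (\<lambda>x. \<not> \<sigma> x) v' \<Longrightarrow>
      v + v' \<le> L Z W 0 - (\<Sum>x\<le>W + Z. L 0 0 x)" for \<sigma> v v'
    using oct
  proof (induction W arbitrary: L \<sigma> v v')
    case 0
    then have "\<And>x. x < Z \<Longrightarrow> \<not> \<sigma> x" "v = 0"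
      by (auto elim: chain_0E)
    then show ?case
      using "0.prems"(2) chain_full[of Z "\<lambda>x. \<not> \<sigma> x"] by auto
  next
    case (Suc W)
    then obtain t v1 where t: "interlace (Suc (W + Z)) \<sigma> t" "chain W (W + Z) (L 0 \<circ> Suc) t v1"
      "v = strip_weight (Suc (W + Z)) (L 0 0) (L 0 1) \<sigma> t + v1"
      by (auto elim!: chain_SucE simp: comp_def)
    obtain v2 where v2: "chain Z (W + Z) (\<lambda>z. L z (Suc 0)) (\<lambda>x. \<not> t x) v2"
      "strip_weight (Suc (W + Z)) (L 0 0) (L 0 1) \<sigma> t + v' \<le>
        v2 + ((\<Sum>x<Suc (W + Z). L 0 1 x) - (\<Sum>x\<le>Suc (W + Z). L 0 0 x))"
      using push_strip_le[of "\<lambda>z. L z 0" "\<lambda>z. L z 1" Z "Suc (W + Z)" \<sigma> t v'] t(1) Suc.prems(2) Suc.prems(3)[of 0] by auto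
    have "v1 + v2 \<le> L Z (Suc W) 0 - (\<Sum>x\<le>W + Z. L 0 1 x)"
      using Suc.IH[of "\<lambda>z w. L z (Suc w)" t v1 v2] t(2) v2(1) Suc.prems(3) by (simp add: comp_def)
    then show ?case
      using v2(2) t(3) by (simp add: lessThan_Suc_atMost)
  qed
  then show "PROP ?le" .
  have ge: "\<exists>\<sigma> v v'. chain W (W + Z) (L 0) \<sigma> v \<and>
      chain Z (W + Z) (\<lambda>z. L z 0) (\<lambda>x. \<not> \<sigma> x) v' \<and> L Z W 0 - (\<Sum>x\<le>W + Z. L 0 0 x) \<le> v + v'"
    using oct
  proof (induction W arbitrary: L)
    case 0
    have "chain 0 Z (L 0) (\<lambda>_. False) 0" "chain Z Z (\<lambda>z. L z 0) (\<lambda>x. \<not> False) (L Z 0 0 - (\<Sum>x\<le>Z. L 0 0 x))"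
      using chain_full[of Z] by (auto intro: chain_0)
    then show ?case by force
  next
    case (Suc W)
    obtain t v1 v2 where t: "chain W (W + Z) (\<lambda>w. L 0 (Suc w)) t v1"
      "chain Z (W + Z) (\<lambda>z. L z (Suc 0)) (\<lambda>x. \<not> t x) v2" "L Z (Suc W) 0 - (\<Sum>x\<le>W + Z. L 0 1 x) \<le> v1 + v2"
      using Suc.IH[of "\<lambda>z w. L z (Suc w)"] Suc.prems by auto
    obtain u v where u: "interlace (Suc (W + Z)) u t" "chain Z (Suc (W + Z)) (\<lambda>z. L z 0) (\<lambda>x. \<not> u x) v"
      "v2 + ((\<Sum>x<Suc (W + Z). L 0 1 x) - (\<Sum>x\<le>Suc (W + Z). L 0 0 x))
        \<le> strip_weight (Suc (W + Z)) (L 0 0) (L 0 1) u t + v"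
      using push_strip_ge[of "\<lambda>z. L z 0" "\<lambda>z. L z 1" Z "Suc (W + Z)" t v2] t(2) Suc.prems[of 0] by auto
    have "chain (Suc W) (Suc (W + Z)) (L 0) u (strip_weight (Suc (W + Z)) (L 0 0) (L 0 1) u t + v1)"
      using u(1) t(1) by (intro chain_Suc) auto
    then show ?case
      using u(2,3) t(3) by (intro exI[of _ u] exI conjI) (auto simp: lessThan_Suc_atMost)
  qed
  show ?at
    using le ge by (meson order_antisym)
qed


text \<open>Only the bits inside a line matter; the complementary selections on the equator agree only there.\<close>

lemma strip_weight_cong:
  assumes "\<And>x. x < n \<Longrightarrow> \<sigma> x = \<tau> x" "\<And>x. x < n - 1 \<Longrightarrow> \<sigma>' x = \<tau>' x"
  shows "strip_weight n l l' \<sigma> \<sigma>' = strip_weight n l l' \<tau> \<tau>'"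
  unfolding strip_weight_def using assms by (intro arg_cong2[of _ _ _ _ "(+)"] sum.cong) auto

lemma interlace_cong:
  assumes "\<And>x. x < n \<Longrightarrow> \<sigma> x = \<tau> x"
  shows "interlace n \<sigma> \<sigma>' = interlace n \<tau> \<sigma>'"
proof -
  have "count_below \<sigma> m = count_below \<tau> m" if "m \<le> n" for m
    using assms that by (intro count_below_cong) auto
  then show ?thesis
    by (simp add: interlace_def Suc_le_eq del: count_below_Suc cong: conj_cong)
qed

lemma chain_cong:
  assumes "\<And>x. x < n \<Longrightarrow> \<sigma> x = \<tau> x"
  shows "chain h n l \<sigma> v = chain h n l \<tau> v"
proof -
  have "chain h n l \<tau> v" if "chain h n l \<sigma> v" "\<And>x. x < n \<Longrightarrow> \<sigma> x = \<tau> x" for \<sigma> \<tau>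
    using that(1)
  proof cases
    case chain_0
    then show ?thesis using that(2) by (auto intro: chain.chain_0)
  next
    case (chain_Suc \<sigma>' h v)
    then show ?thesis
      using that(2) interlace_cong[of n \<sigma> \<tau>] strip_weight_cong[of n \<sigma> \<tau> \<sigma>' \<sigma>' "l 0" "l 1"]
        chain.chain_Suc[of n \<tau> \<sigma>' h l v] by auto
  qed
  from this[of \<sigma> \<tau>] this[of \<tau> \<sigma>] assms show ?thesis by auto
qed

text \<open>The passage from the recursive description, which suits the induction above, to the array of all selections at once.\<close>

lemma chain_iff:
  "chain h n l \<sigma> v \<longleftrightarrow> (\<exists>\<tau>. \<tau> 0 = \<sigma> \<and> (\<forall>w<h. interlace (n - w) (\<tau> w) (\<tau> (Suc w))) \<and>
     (\<forall>x<n - h. \<not> \<tau> h x) \<and>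
     v = (\<Sum>w<h. strip_weight (n - w) (l w) (l (Suc w)) (\<tau> w) (\<tau> (Suc w))))"
proof (induction h arbitrary: n l \<sigma> v)
  case 0
  show ?case by (auto elim!: chain_0E intro!: chain_0 exI[of _ "\<lambda>_. \<sigma>"])
next
  case (Suc h)
  show ?case
  proof
    assume "chain (Suc h) n l \<sigma> v"
    then obtain \<sigma>' v' where s: "interlace n \<sigma> \<sigma>'" "chain h (n - 1) (\<lambda>w. l (Suc w)) \<sigma>' v'"
      "v = strip_weight n (l 0) (l 1) \<sigma> \<sigma>' + v'"
      by (auto elim: chain_SucE)
    then obtain \<tau> where \<tau>: "\<tau> 0 = \<sigma>'" "\<forall>w<h. interlace (n - 1 - w) (\<tau> w) (\<tau> (Suc w))"
      "\<forall>x<n - 1 - h. \<not> \<tau> h x"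
      "v' = (\<Sum>w<h. strip_weight (n - 1 - w) (l (Suc w)) (l (Suc (Suc w))) (\<tau> w) (\<tau> (Suc w)))"
      unfolding Suc.IH by auto
    show "\<exists>\<tau>. \<tau> 0 = \<sigma> \<and> (\<forall>w<Suc h. interlace (n - w) (\<tau> w) (\<tau> (Suc w))) \<and>
     (\<forall>x<n - Suc h. \<not> \<tau> (Suc h) x) \<and>
     v = (\<Sum>w<Suc h. strip_weight (n - w) (l w) (l (Suc w)) (\<tau> w) (\<tau> (Suc w)))"
      using s \<tau> by (intro exI[of _ "case_nat \<sigma> \<tau>"])
        (auto simp: less_Suc_eq_0_disj sum.lessThan_Suc_shift simp del: sum.lessThan_Suc)
  next
    assume "\<exists>\<tau>. \<tau> 0 = \<sigma> \<and> (\<forall>w<Suc h. interlace (n - w) (\<tau> w) (\<tau> (Suc w))) \<and>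
     (\<forall>x<n - Suc h. \<not> \<tau> (Suc h) x) \<and>
     v = (\<Sum>w<Suc h. strip_weight (n - w) (l w) (l (Suc w)) (\<tau> w) (\<tau> (Suc w)))"
    then obtain \<tau> where \<tau>: "\<tau> 0 = \<sigma>" "\<forall>w<Suc h. interlace (n - w) (\<tau> w) (\<tau> (Suc w))"
      "\<forall>x<n - Suc h. \<not> \<tau> (Suc h) x"
      "v = (\<Sum>w<Suc h. strip_weight (n - w) (l w) (l (Suc w)) (\<tau> w) (\<tau> (Suc w)))"
      by blast
    have "chain h (n - 1) (\<lambda>w. l (Suc w)) (\<tau> 1)
        (\<Sum>w<h. strip_weight (n - Suc w) (l (Suc w)) (l (Suc (Suc w))) (\<tau> (Suc w)) (\<tau> (Suc (Suc w))))"
      unfolding Suc.IH using \<tau> by (intro exI[of _ "\<lambda>w. \<tau> (Suc w)"]) auto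
    moreover have "interlace n \<sigma> (\<tau> 1)"
      using \<tau>(1,2) by auto
    ultimately have "chain (Suc h) n l \<sigma> (strip_weight n (l 0) (l 1) \<sigma> (\<tau> 1) +
        (\<Sum>w<h. strip_weight (n - Suc w) (l (Suc w)) (l (Suc (Suc w))) (\<tau> (Suc w)) (\<tau> (Suc (Suc w)))))"
      by (intro chain_Suc)
    then show "chain (Suc h) n l \<sigma> v"
      unfolding \<tau>(4) sum.lessThan_Suc_shift using \<tau>(1) by simp
  qed
qed

text \<open>Regrouping by lines instead of strips: an inner line collects one half of each lozenge across it from either
adjacent strip.\<close>

lemma strip_weights_by_line:
  assumes "0 < h" "h \<le> n" "\<And>x. x < n - h \<Longrightarrow> \<not> \<tau> h x"
  shows "(\<Sum>w<h. strip_weight (n - w) (l w) (l (Suc w)) (\<tau> w) (\<tau> (Suc w))) =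
    (\<Sum>x<n. of_bool (\<tau> 0 x) * (l 1 x - l 0 x - l 0 (Suc x))) +
    (\<Sum>w\<in>{1..<h}. \<Sum>x<n - w. of_bool (\<tau> w x) * (l (Suc w) x + l (w - 1) (Suc x) - l w x - l w (Suc x)))"
proof -
  obtain h' where h: "h = Suc h'"
    using assms(1) by (cases h) auto
  define U where "U w = (\<Sum>x<n - w. of_bool (\<tau> w x) * (l (Suc w) x - l w x - l w (Suc x)))" for w
  define V where "V w = (\<Sum>x<n - w. of_bool (\<tau> w x) * l (w - 1) (Suc x))" for w
  have "(\<Sum>w<h. strip_weight (n - w) (l w) (l (Suc w)) (\<tau> w) (\<tau> (Suc w))) = (\<Sum>w<h. U w) + (\<Sum>w<h. V (Suc w))"
    by (simp add: strip_weight_def U_def V_def sum.distrib)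
  also have "(\<Sum>w<h. V (Suc w)) = (\<Sum>w<h'. V (Suc w))"
    using assms(3) by (auto simp: h V_def intro!: sum.neutral)
  also have "\<dots> = (\<Sum>w\<in>{1..<h}. V w)"
    using sum.shift_bounds_Suc_ivl[of V 0 h'] by (simp add: h lessThan_atLeast0 del: sum.op_ivl_Suc)
  also have "(\<Sum>w<h. U w) = U 0 + (\<Sum>w\<in>{1..<h}. U w)"
    using assms(1) by (simp add: lessThan_atLeast0 sum.atLeast_Suc_lessThan)
  finally have "(\<Sum>w<h. strip_weight (n - w) (l w) (l (Suc w)) (\<tau> w) (\<tau> (Suc w))) =
      U 0 + (\<Sum>w\<in>{1..<h}. U w + V w)"
    by (simp add: sum.distrib)
  also have "(\<Sum>w\<in>{1..<h}. U w + V w) = (\<Sum>w\<in>{1..<h}. \<Sum>x<n - w.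
      of_bool (\<tau> w x) * (l (Suc w) x + l (w - 1) (Suc x) - l w x - l w (Suc x)))"
    unfolding U_def V_def sum.distrib[symmetric] by (intro sum.cong) (auto simp: algebra_simps)
  finally show ?thesis by (simp add: U_def)
qed

section \<open>The solution of the octahedron recurrence\<close>

text \<open>The value at the point \<open>[x, y, z, w]\<close> of the tetrahedron, with \<open>y = n - x - z - w\<close> left implicit. For fixed \<open>z\<close> and
\<open>w\<close> these values form one line, and \<open>z\<close>, \<open>w\<close> number the layers; on the faces \<open>w = 0\<close> and \<open>z = 0\<close> the lines
are the antidiagonals below and above the equator.\<close>

fun oct_value :: "int \<Rightarrow> (point \<Rightarrow> real) \<Rightarrow> nat \<Rightarrow> nat \<Rightarrow> nat \<Rightarrow> real" where
  "oct_value n k z 0 x = k (int x, n - int z - int x)"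
| "oct_value n k 0 (Suc w) x = k (int x + int (Suc w), n - int x)"
| "oct_value n k (Suc z) (Suc w) x =
     max (oct_value n k (Suc z) w (Suc x) + oct_value n k z (Suc w) x)
         (oct_value n k z (Suc w) (Suc x) + oct_value n k (Suc z) w x)
     - oct_value n k z w (Suc x)"

lemma oct_value_0: "oct_value n k 0 w x = k (int x + int w, n - int x)"
  by (cases w) auto

lemma satisfies_octahedron_unique:
  assumes f: "satisfies_octahedron n k f" and "int x + int y + int z + int w = n"
  shows "f (int x, int y, int z, int w) = oct_value n k z w x"
  using assms(2)
proof (induction "z + w" arbitrary: x y z w rule: less_induct)
  case less
  consider "w = 0" | "z = 0" | z' w' where "z = Suc z'" "w = Suc w'"
    by (cases z; cases w) auto
  then show ?case
  proof cases
    case 1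
    have "(int x, int y) \<in> regionU' n"
      using less.prems by (auto simp: regionU'_def)
    then have "f (int x, int y, n - int x - int y, 0) = k (int x, int y)"
      using f unfolding satisfies_octahedron_def by blast
    moreover have "int z = n - int x - int y" "int y = n - int z - int x"
      using less.prems 1 by auto
    ultimately show ?thesis
      using 1 by (metis oct_value.simps(1) of_nat_0)
  next
    case 2
    have "(n - int y, n - int x) \<in> regionU n"
      using less.prems by (auto simp: regionU_def)
    then have "f (n - (n - int x), n - (n - int y), 0, (n - int y) + (n - int x) - n) = k (n - int y, n - int x)"
      using f unfolding satisfies_octahedron_def by blast
    moreover have "(n - int y) + (n - int x) - n = int w" "n - int y = int x + int w" "n - (n - int x) = int x"
      "n - (n - int y) = int y"
      using less.prems 2 by auto
    ultimately show ?thesis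
      using 2 by (simp only: oct_value_0 of_nat_0)
  next
    case 3
    have "f (int x, int y, int z' + 1, int w' + 1) =
          max (f (int x + 1, int y, int z' + 1, int w') + f (int x, int y + 1, int z', int w' + 1))
              (f (int x + 1, int y, int z', int w' + 1) + f (int x, int y + 1, int z' + 1, int w'))
          - f (int x + 1, int y + 1, int z', int w')"
      using f less.prems 3 unfolding satisfies_octahedron_def by auto
    moreover have "f (int (Suc x), int y, int (Suc z'), int w') = oct_value n k (Suc z') w' (Suc x)"
      "f (int x, int (Suc y), int z', int (Suc w')) = oct_value n k z' (Suc w') x"
      "f (int (Suc x), int y, int z', int (Suc w')) = oct_value n k z' (Suc w') (Suc x)"
      "f (int x, int (Suc y), int (Suc z'), int w') = oct_value n k (Suc z') w' x"
      "f (int (Suc x), int (Suc y), int z', int w') = oct_value n k z' w' (Suc x)"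
      by (rule less.hyps; use less.prems 3 in simp)+
    ultimately show ?thesis
      using 3 by (simp add: add.commute)
  qed
qed

definition oct_solution :: "int \<Rightarrow> (point \<Rightarrow> real) \<Rightarrow> int \<times> int \<times> int \<times> int \<Rightarrow> real" where
  "oct_solution n k = (\<lambda>(x, y, z, w)\<in>tet n. oct_value n k (nat z) (nat w) (nat x))"

lemma satisfies_oct_solution: "satisfies_octahedron n k (oct_solution n k)"
  unfolding satisfies_octahedron_def
proof (intro conjI)
  have "oct_solution n k (n - j, n - i, 0, i + j - n) = k (i, j)" if "(i, j) \<in> regionU n" for i j
  proof -
    from that have "(n - j, n - i, 0, i + j - n) \<in> tet n" "0 \<le> n - j" "0 \<le> i + j - n"
    by (auto simp: tet_def regionU_def)
    then show ?thesis
      by (simp add: oct_solution_def oct_value_0)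
  qed
  then show "\<forall>(i, j)\<in>regionU n. oct_solution n k (n - j, n - i, 0, i + j - n) = k (i, j)"
    by blast
  have "oct_solution n k (i, j, n - i - j, 0) = k (i, j)" if "(i, j) \<in> regionU' n" for i j
  proof -
    from that have "(i, j, n - i - j, 0) \<in> tet n" "0 \<le> i" "0 \<le> n - i - j"
    by (auto simp: tet_def regionU'_def)
    then show ?thesis
      by (simp add: oct_solution_def)
  qed
  then show "\<forall>(i, j)\<in>regionU' n. oct_solution n k (i, j, n - i - j, 0) = k (i, j)"
    by blast
  show "\<forall>x y z w. 0 \<le> x \<and> 0 \<le> y \<and> 0 \<le> z \<and> 0 \<le> w \<and> x + y + z + w = n - 2 \<longrightarrow>
       oct_solution n k (x, y, z + 1, w + 1) =
       max (oct_solution n k (x + 1, y, z + 1, w) + oct_solution n k (x, y + 1, z, w + 1))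
        (oct_solution n k (x + 1, y, z, w + 1) + oct_solution n k (x, y + 1, z + 1, w)) -
       oct_solution n k (x + 1, y + 1, z, w)"
  proof (intro allI impI)
    fix x y z w :: int
    assume *: "0 \<le> x \<and> 0 \<le> y \<and> 0 \<le> z \<and> 0 \<le> w \<and> x + y + z + w = n - 2"
    then have "nat (z + 1) = Suc (nat z)" "nat (w + 1) = Suc (nat w)" "nat (x + 1) = Suc (nat x)"
      by auto
    then show "oct_solution n k (x, y, z + 1, w + 1) =
         max (oct_solution n k (x + 1, y, z + 1, w) + oct_solution n k (x, y + 1, z, w + 1))
          (oct_solution n k (x + 1, y, z, w + 1) + oct_solution n k (x, y + 1, z + 1, w)) -
         oct_solution n k (x + 1, y + 1, z, w)"
      using * by (simp add: oct_solution_def tet_def)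
  qed
qed

lemma octahedron_eq: "octahedron n \<gamma> g1 g2 = oct_solution n (ktilde n \<gamma> g1 g2)"
  unfolding octahedron_def
proof (rule the_equality)
  let ?k = "ktilde n \<gamma> g1 g2"
  show "oct_solution n ?k \<in> extensional (tet n) \<and> satisfies_octahedron n ?k (oct_solution n ?k)"
    using satisfies_oct_solution by (auto simp: oct_solution_def)
  fix f assume f: "f \<in> extensional (tet n) \<and> satisfies_octahedron n ?k f"
  show "f = oct_solution n ?k"
  proof (rule extensionalityI)
    show "f \<in> extensional (tet n)" "oct_solution n ?k \<in> extensional (tet n)"
      using f by (auto simp: oct_solution_def)
    fix p assume p: "p \<in> tet n"
    obtain x y z w where xyzw: "p = (x, y, z, w)"
      by (cases p) auto
    have "f (int (nat x), int (nat y), int (nat z), int (nat w)) = oct_value n ?k (nat z) (nat w) (nat x)"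
      using f p by (intro satisfies_octahedron_unique) (auto simp: xyzw tet_def)
    then show "f p = oct_solution n ?k p"
      using p by (auto simp: xyzw tet_def oct_solution_def)
  qed
qed

lemma oct_hive_value:
  assumes "(h, g) = oct n \<gamma> g1 g2" "(i, j) \<in> triangleT n"
  shows "h (i, j) = oct_value n (ktilde n \<gamma> g1 g2) (nat (n - j)) (nat i) 0"
  using assms by (auto simp: oct_def octahedron_eq oct_solution_def tet_def triangleT_def)

section \<open>Tilings as perfect matchings of unit triangles\<close>

text \<open>Both halves of the hexagon are described by the same coordinates: a side, a level \<open>w\<close> counted away from
the equator, and a position \<open>x\<close> along the line. The side \<open>True\<close> is the half in \<open>U\<close>. \<open>Base s w x\<close> is the
triangle with its antidiagonal edge on level \<open>w\<close> and its apex on level \<open>w + 1\<close>, and \<open>Tip s w x\<close> is the one with the edge on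
level \<open>w + 1\<close> that follows it in the strip. \<open>Forward\<close> and \<open>Backward\<close> join a tip to the base before and
after it, and \<open>Cross s w x\<close> is a lozenge of form (iii) across the edge \<open>x\<close> of level \<open>w\<close>.\<close>

datatype cell = Base bool nat nat | Tip bool nat nat
datatype piece = Forward bool nat nat | Backward bool nat nat | Cross bool nat nat | Border bool nat

fun cells_of :: "piece \<Rightarrow> cell set" where
  "cells_of (Forward s w x) = {Base s w x, Tip s w x}"
| "cells_of (Backward s w x) = {Tip s w x, Base s w (Suc x)}"
| "cells_of (Cross s w x) = {Tip s (w - 1) x, Base s w x}"
| "cells_of (Border s x) = {Base s 0 x}"

definition line_point :: "int \<Rightarrow> bool \<Rightarrow> nat \<Rightarrow> nat \<Rightarrow> point" where
  "line_point n s w x = (if s then (int x + int w, n - int x) else (int x, n - int w - int x))"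

definition line_piece :: "bool \<Rightarrow> nat \<Rightarrow> nat \<Rightarrow> piece" where
  "line_piece s w x = (if w = 0 then Border s x else Cross s w x)"

text \<open>Along the path \<open>Base 0, Tip 0, Base 1, Tip 1, \<dots>\<close> of a strip, let \<open>f x\<close> and \<open>g x\<close> say that tip \<open>x\<close> is matched to the base
before and after it, and let \<open>\<sigma>\<close> and \<open>\<sigma>'\<close> say which bases and tips are matched across the two lines. The difference of
the prefix counts of \<open>\<sigma>\<close> and \<open>\<sigma>'\<close> is then the indicator of \<open>g\<close>.\<close>

lemma strip_matching_interlace:
  fixes n :: nat
  assumes base: "\<And>x. x < n \<Longrightarrow> of_bool (\<sigma> x) + of_bool (f x) + of_bool (0 < x \<and> g (x - 1)) = (1 :: int)"
    and tip: "\<And>x. Suc x < n \<Longrightarrow> of_bool (f x) + of_bool (g x) + of_bool (\<sigma>' x) = (1 :: int)"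
    and last: "\<not> f (n - 1)" and n: "0 < n"
  shows "interlace n \<sigma> \<sigma>'"
proof -
  have q: "count_below \<sigma> m - count_below \<sigma>' m = of_bool (0 < m \<and> g (m - 1))" if "m < n" for m
    using that
  proof (induction m)
    case (Suc m)
    then show ?case
      using base[of m] tip[of m] by (cases "f m"; cases "g m") auto
  qed simp
  show ?thesis
    unfolding interlace_def
  proof (intro conjI allI impI)
    fix m assume "m < n"
    then show "count_below \<sigma>' m \<le> count_below \<sigma> m" "count_below \<sigma> (Suc m) \<le> count_below \<sigma>' m + 1"
      using q[of m] base[of m] by (auto simp: of_bool_def split: if_splits)
  next
    have "count_below \<sigma> (Suc (n - 1)) = count_below \<sigma>' (n - 1) + 1"
      unfolding count_below_Suc using q[of "n - 1"] base[of "n - 1"] last n by simp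
    then show "count_below \<sigma> n = count_below \<sigma>' (n - 1) + 1"
      using n by simp
  qed
qed

text \<open>Conversely, the prefix counts determine how each triangle of the strip is matched.\<close>

definition forward_at :: "(nat \<Rightarrow> bool) \<Rightarrow> (nat \<Rightarrow> bool) \<Rightarrow> nat \<Rightarrow> bool" where
  "forward_at \<sigma> \<sigma>' x \<longleftrightarrow> count_below \<sigma> (Suc x) = count_below \<sigma>' x"

definition backward_at :: "(nat \<Rightarrow> bool) \<Rightarrow> (nat \<Rightarrow> bool) \<Rightarrow> nat \<Rightarrow> bool" where
  "backward_at \<sigma> \<sigma>' x \<longleftrightarrow> count_below \<sigma> (Suc x) = count_below \<sigma>' (Suc x) + 1"

lemma interlace_strip_matching:
  assumes "interlace n \<sigma> \<sigma>'"
  shows "x < n \<Longrightarrow> of_bool (\<sigma> x) + of_bool (forward_at \<sigma> \<sigma>' x) +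
      of_bool (0 < x \<and> backward_at \<sigma> \<sigma>' (x - 1)) = (1 :: int)"
    and "Suc x < n \<Longrightarrow> of_bool (forward_at \<sigma> \<sigma>' x) + of_bool (backward_at \<sigma> \<sigma>' x) + of_bool (\<sigma>' x) = (1 :: int)"
    and "0 < n \<Longrightarrow> \<not> forward_at \<sigma> \<sigma>' (n - 1)"
proof -
  have b: "count_below \<sigma>' m \<le> count_below \<sigma> m" "count_below \<sigma> (Suc m) \<le> count_below \<sigma>' m + 1" if "m < n" for m
    using assms that by (auto simp: interlace_def)
  show "of_bool (\<sigma> x) + of_bool (forward_at \<sigma> \<sigma>' x) +
      of_bool (0 < x \<and> backward_at \<sigma> \<sigma>' (x - 1)) = (1 :: int)" if "x < n"
  proof (cases x)
    case 0
    then show ?thesis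
      using b[OF that] by (cases "\<sigma> 0") (auto simp: forward_at_def)
  next
    case (Suc y)
    have 1: "count_below \<sigma>' x \<le> count_below \<sigma> x" "count_below \<sigma> x + of_bool (\<sigma> x) \<le> count_below \<sigma>' x + 1"
      using b[OF that] by auto
    have f: "forward_at \<sigma> \<sigma>' x \<longleftrightarrow> count_below \<sigma> x + of_bool (\<sigma> x) = count_below \<sigma>' x"
      by (simp add: forward_at_def)
    have g: "0 < x \<and> backward_at \<sigma> \<sigma>' (x - 1) \<longleftrightarrow> count_below \<sigma> x = count_below \<sigma>' x + 1"
      unfolding Suc backward_at_def by simp
    show ?thesis
      unfolding f g using 1 by (cases "\<sigma> x") auto
  qed
  show "of_bool (forward_at \<sigma> \<sigma>' x) + of_bool (backward_at \<sigma> \<sigma>' x) + of_bool (\<sigma>' x) = (1 :: int)" if "Suc x < n"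
    using b[of x] b[of "Suc x"] that unfolding forward_at_def backward_at_def
    by (cases "\<sigma>' x"; cases "\<sigma> x") auto
  show "\<not> forward_at \<sigma> \<sigma>' (n - 1)" if "0 < n"
    using assms that by (simp add: interlace_def forward_at_def)
qed

lemma ex1_three_iff:
  assumes "a \<noteq> b" "a \<noteq> c" "b \<noteq> c"
  shows "(\<exists>!p. p \<in> X \<and> (p = a \<or> p = b \<or> B \<and> p = c)) \<longleftrightarrow>
    of_bool (a \<in> X) + of_bool (b \<in> X) + of_bool (B \<and> c \<in> X) = (1 :: int)"
  using assms by (cases "a \<in> X"; cases "b \<in> X"; cases "B \<and> c \<in> X") (simp; blast)+

text \<open>The hexagon of the vertex \<open>(W, n - Z)\<close>: its equator has \<open>N\<close> edges, and its halves in \<open>U\<close> and \<open>U'\<close> consist of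
\<open>W\<close> and \<open>Z\<close> strips.\<close>

locale excavation =
  fixes n :: int and W Z :: nat
  assumes W_pos: "0 < W" and Z_pos: "0 < Z" and fits: "int W + int Z \<le> n"
begin

abbreviation N :: nat where "N \<equiv> W + Z"

definition height :: "bool \<Rightarrow> nat" where
  "height s = (if s then W else Z)"

lemma height_pos: "0 < height s" and height_less: "height s < N"
  using W_pos Z_pos by (auto simp: height_def)

fun valid_cell :: "cell \<Rightarrow> bool" where
  "valid_cell (Base s w x) \<longleftrightarrow> w < height s \<and> w + x < N"
| "valid_cell (Tip s w x) \<longleftrightarrow> w < height s \<and> Suc (w + x) < N"

fun valid_piece :: "piece \<Rightarrow> bool" where
  "valid_piece (Forward s w x) \<longleftrightarrow> w < height s \<and> Suc (w + x) < N"
| "valid_piece (Backward s w x) \<longleftrightarrow> w < height s \<and> Suc (w + x) < N"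
| "valid_piece (Cross s w x) \<longleftrightarrow> 0 < w \<and> w < height s \<and> w + x < N"
| "valid_piece (Border s x) \<longleftrightarrow> x < N"

lemma valid_piece_iff: "valid_piece c \<longleftrightarrow> (\<forall>T\<in>cells_of c. valid_cell T) \<and> (\<forall>s x. c \<noteq> Cross s 0 x)"
  using height_pos by (cases c) (auto simp: less_imp_diff_less)

lemma cells_of_inj:
  assumes "valid_piece c" "valid_piece d" "cells_of c = cells_of d"
  shows "c = d"
  using assms by (cases c; cases d) (auto simp: doubleton_eq_iff)

definition perfect :: "piece set \<Rightarrow> bool" where
  "perfect X \<longleftrightarrow> (\<forall>c\<in>X. valid_piece c) \<and> (\<forall>T. valid_cell T \<longrightarrow> (\<exists>!c. c \<in> X \<and> T \<in> cells_of c)) \<and>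
     (\<forall>x<N. Border True x \<in> X \<longleftrightarrow> Border False x \<notin> X)"

lemma Base_in_cells_of:
  assumes "valid_piece c"
  shows "Base s w x \<in> cells_of c \<longleftrightarrow> c = line_piece s w x \<or> c = Forward s w x \<or> 0 < x \<and> c = Backward s w (x - 1)"
  using assms by (cases c) (auto simp: line_piece_def)

lemma Tip_in_cells_of:
  assumes "valid_piece c"
  shows "Tip s w x \<in> cells_of c \<longleftrightarrow> c = Forward s w x \<or> c = Backward s w x \<or> True \<and> c = line_piece s (Suc w) x"
  using assms by (cases c) (auto simp: line_piece_def)

lemma perfect_iff:
  assumes "\<forall>c\<in>X. valid_piece c"
  shows "perfect X \<longleftrightarrow>
    (\<forall>s w x. w < height s \<and> w + x < N \<longrightarrow> of_bool (line_piece s w x \<in> X) + of_bool (Forward s w x \<in> X)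
       + of_bool (0 < x \<and> Backward s w (x - 1) \<in> X) = (1 :: int)) \<and>
    (\<forall>s w x. w < height s \<and> Suc (w + x) < N \<longrightarrow> of_bool (Forward s w x \<in> X) + of_bool (Backward s w x \<in> X)
       + of_bool (line_piece s (Suc w) x \<in> X) = (1 :: int)) \<and>
    (\<forall>x<N. Border True x \<in> X \<longleftrightarrow> Border False x \<notin> X)"
proof -
  have base: "(\<exists>!c. c \<in> X \<and> Base s w x \<in> cells_of c) \<longleftrightarrow> of_bool (line_piece s w x \<in> X) + of_bool (Forward s w x \<in> X)
       + of_bool (0 < x \<and> Backward s w (x - 1) \<in> X) = (1 :: int)" for s w x
  proof -
    have "c \<in> X \<and> Base s w x \<in> cells_of c \<longleftrightarrow>
      c \<in> X \<and> (c = line_piece s w x \<or> c = Forward s w x \<or> 0 < x \<and> c = Backward s w (x - 1))" for c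
      using assms Base_in_cells_of by blast
    then show ?thesis
      by (simp only:) (rule ex1_three_iff; simp add: line_piece_def)
  qed
  have tip: "(\<exists>!c. c \<in> X \<and> Tip s w x \<in> cells_of c) \<longleftrightarrow> of_bool (Forward s w x \<in> X)
       + of_bool (Backward s w x \<in> X) + of_bool (line_piece s (Suc w) x \<in> X) = (1 :: int)" for s w x
  proof -
    have "c \<in> X \<and> Tip s w x \<in> cells_of c \<longleftrightarrow>
      c \<in> X \<and> (c = Forward s w x \<or> c = Backward s w x \<or> True \<and> c = line_piece s (Suc w) x)" for c
      using assms Tip_in_cells_of by blast
    then have "(\<exists>!c. c \<in> X \<and> Tip s w x \<in> cells_of c) \<longleftrightarrow> of_bool (Forward s w x \<in> X)
       + of_bool (Backward s w x \<in> X) + of_bool (True \<and> line_piece s (Suc w) x \<in> X) = (1 :: int)"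
      by (simp only:) (rule ex1_three_iff; simp add: line_piece_def)
    then show ?thesis by simp
  qed
  have cells: "(\<forall>T. Q T) \<longleftrightarrow> (\<forall>s w x. Q (Base s w x)) \<and> (\<forall>s w x. Q (Tip s w x))" for Q
    by (metis cell.exhaust)
  show ?thesis
    unfolding perfect_def cells valid_cell.simps base tip using assms by simp
qed

definition line_bits :: "piece set \<Rightarrow> bool \<Rightarrow> nat \<Rightarrow> nat \<Rightarrow> bool" where
  "line_bits X s w x \<longleftrightarrow> line_piece s w x \<in> X"

lemma perfect_valid: "perfect X \<Longrightarrow> c \<in> X \<Longrightarrow> valid_piece c"
  by (simp add: perfect_def)

lemma perfect_interlace:
  assumes "perfect X" "w < height s"
  shows "interlace (N - w) (line_bits X s w) (line_bits X s (Suc w))"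
proof (rule strip_matching_interlace[where f = "\<lambda>x. Forward s w x \<in> X" and g = "\<lambda>x. Backward s w x \<in> X"])
  have p: "\<forall>c\<in>X. valid_piece c"
    using assms(1) perfect_valid by blast
  note * = assms(1)[unfolded perfect_iff[OF p]]
  show "of_bool (line_bits X s w x) + of_bool (Forward s w x \<in> X) + of_bool (0 < x \<and> Backward s w (x - 1) \<in> X) = (1 :: int)"
    if "x < N - w" for x
    using * assms(2) that by (simp add: line_bits_def less_diff_conv add.commute)
  show "of_bool (Forward s w x \<in> X) + of_bool (Backward s w x \<in> X) + of_bool (line_bits X s (Suc w) x) = (1 :: int)"
    if "Suc x < N - w" for x
    using * assms(2) that by (simp add: line_bits_def less_diff_conv add.commute)
  show "Forward s w (N - w - 1) \<notin> X"
    using p by fastforce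
  show "0 < N - w"
    using assms(2) height_less[of s] by simp
qed

lemma perfect_top: "perfect X \<Longrightarrow> \<not> line_bits X s (height s) x"
  using height_pos[of s] by (auto simp: line_bits_def line_piece_def dest: perfect_valid)

lemma perfect_equator: "perfect X \<Longrightarrow> x < N \<Longrightarrow> line_bits X True 0 x \<longleftrightarrow> \<not> line_bits X False 0 x"
  by (simp add: line_bits_def line_piece_def perfect_def)

fun selected :: "(bool \<Rightarrow> nat \<Rightarrow> nat \<Rightarrow> bool) \<Rightarrow> piece \<Rightarrow> bool" where
  "selected \<beta> (Forward s w x) \<longleftrightarrow> forward_at (\<beta> s w) (\<beta> s (Suc w)) x"
| "selected \<beta> (Backward s w x) \<longleftrightarrow> backward_at (\<beta> s w) (\<beta> s (Suc w)) x"
| "selected \<beta> (Cross s w x) \<longleftrightarrow> \<beta> s w x"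
| "selected \<beta> (Border s x) \<longleftrightarrow> \<beta> s 0 x"

text \<open>Every pair of interlacing arrays with complementary rows on the equator comes from a perfect matching, which is
assembled strip by strip.\<close>

lemma perfect_exists:
  assumes inter: "\<And>s w. w < height s \<Longrightarrow> interlace (N - w) (\<beta> s w) (\<beta> s (Suc w))"
    and top: "\<And>s x. x < N - height s \<Longrightarrow> \<not> \<beta> s (height s) x"
    and equator: "\<And>x. x < N \<Longrightarrow> \<beta> True 0 x \<longleftrightarrow> \<not> \<beta> False 0 x"
  obtains X where "perfect X" "\<And>s w x. w \<le> height s \<Longrightarrow> w + x < N \<Longrightarrow> line_bits X s w x \<longleftrightarrow> \<beta> s w x"
proof
  define X where "X = {c. valid_piece c \<and> selected \<beta> c}"
  have line: "line_piece s w x \<in> X \<longleftrightarrow> \<beta> s w x" if "w \<le> height s" "w + x < N" for s w x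
    using that top[of x s] height_pos[of s]
    by (cases "w = height s") (auto simp: X_def line_piece_def)
  then show "line_bits X s w x \<longleftrightarrow> \<beta> s w x" if "w \<le> height s" "w + x < N" for s w x
    using that by (simp add: line_bits_def)
  have "\<forall>c\<in>X. valid_piece c"
    by (simp add: X_def)
  then show "perfect X"
    unfolding perfect_iff[OF \<open>\<forall>c\<in>X. valid_piece c\<close>]
  proof (intro conjI allI impI)
    fix s w x assume *: "w < height s \<and> w + x < N"
    have "Forward s w x \<in> X \<longleftrightarrow> forward_at (\<beta> s w) (\<beta> s (Suc w)) x"
    proof (cases "Suc (w + x) < N")
      case False
      then have "x = N - w - 1" using * by linarith
      then show ?thesis
        using interlace_strip_matching(3)[OF inter, of w s] * False by (simp add: X_def)
    qed (use * in \<open>simp add: X_def\<close>)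
    moreover have "0 < x \<and> Backward s w (x - 1) \<in> X \<longleftrightarrow> 0 < x \<and> backward_at (\<beta> s w) (\<beta> s (Suc w)) (x - 1)"
      using * by (auto simp: X_def)
    ultimately have FB: "Forward s w x \<in> X \<longleftrightarrow> forward_at (\<beta> s w) (\<beta> s (Suc w)) x"
      "0 < x \<and> Backward s w (x - 1) \<in> X \<longleftrightarrow> 0 < x \<and> backward_at (\<beta> s w) (\<beta> s (Suc w)) (x - 1)"
      by blast+
    show "of_bool (line_piece s w x \<in> X) + of_bool (Forward s w x \<in> X) +
       of_bool (0 < x \<and> Backward s w (x - 1) \<in> X) = (1 :: int)"
    proof -
      have "x < N - w" using * by linarith
      with interlace_strip_matching(1)[OF inter this] * line[of w s x] FB show ?thesis by simp
    qed
  next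
    fix s w x assume *: "w < height s \<and> Suc (w + x) < N"
    then have FB: "Forward s w x \<in> X \<longleftrightarrow> forward_at (\<beta> s w) (\<beta> s (Suc w)) x"
      "Backward s w x \<in> X \<longleftrightarrow> backward_at (\<beta> s w) (\<beta> s (Suc w)) x"
      by (simp_all add: X_def)
    show "of_bool (Forward s w x \<in> X) + of_bool (Backward s w x \<in> X) +
       of_bool (line_piece s (Suc w) x \<in> X) = (1 :: int)"
    proof -
      have "Suc x < N - w" using * by linarith
      with interlace_strip_matching(2)[OF inter this] * line[of "Suc w" s x] FB show ?thesis by simp
    qed
  next
    fix x assume "x < N"
    then show "Border True x \<in> X \<longleftrightarrow> Border False x \<notin> X"
      using equator by (simp add: X_def)
  qed
qed

definition line_value :: "(point \<Rightarrow> real) \<Rightarrow> bool \<Rightarrow> nat \<Rightarrow> nat \<Rightarrow> real" where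
  "line_value k s w x = k (line_point n s w x)"

definition side_value :: "(point \<Rightarrow> real) \<Rightarrow> piece set \<Rightarrow> bool \<Rightarrow> real" where
  "side_value k X s = (\<Sum>w<height s. strip_weight (N - w) (line_value k s w) (line_value k s (Suc w))
     (line_bits X s w) (line_bits X s (Suc w)))"

lemma oct_value_line:
  "oct_value n k 0 = line_value k True" "(\<lambda>z. oct_value n k z 0) = line_value k False"
  by (auto simp: line_value_def line_point_def oct_value_0 fun_eq_iff)

lemma octahedral_step_oct_value: "octahedral_step (\<lambda>z. oct_value n k z w) (\<lambda>z. oct_value n k z (Suc w))"
  by (simp add: octahedral_step_def)

lemma perfect_chain:
  assumes "perfect X"
  shows "chain (height s) N (line_value k s) (line_bits X s 0) (side_value k X s)"
  unfolding chain_iff side_value_def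
  using perfect_interlace[OF assms] perfect_top[OF assms] by (intro exI[of _ "line_bits X s"]) auto

lemma perfect_value_le:
  assumes "perfect X"
  shows "side_value k X True + side_value k X False \<le> oct_value n k Z W 0 - (\<Sum>x\<le>N. line_value k True 0 x)"
proof -
  have "chain W N (oct_value n k 0) (line_bits X True 0) (side_value k X True)"
    using perfect_chain[OF assms, of True k] by (simp add: oct_value_line height_def)
  moreover have "chain Z N (\<lambda>z. oct_value n k z 0) (\<lambda>x. \<not> line_bits X True 0 x) (side_value k X False)"
    using perfect_chain[OF assms, of False k] perfect_equator[OF assms]
    by (subst chain_cong[of _ _ "line_bits X False 0"]) (auto simp: oct_value_line height_def)
  ultimately have "side_value k X True + side_value k X False \<le> oct_value n k Z W 0 - (\<Sum>x\<le>N. oct_value n k 0 0 x)"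
    using chain_pair_le[of "oct_value n k" W Z] octahedral_step_oct_value by blast
  then show ?thesis by (simp add: oct_value_line)
qed

text \<open>An optimal pair of chains is turned back into a set of pieces.\<close>

lemma perfect_value_attained:
  obtains X where "perfect X"
    "side_value k X True + side_value k X False = oct_value n k Z W 0 - (\<Sum>x\<le>N. line_value k True 0 x)"
proof -
  obtain \<sigma> v v' where c: "chain W N (oct_value n k 0) \<sigma> v"
      "chain Z N (\<lambda>z. oct_value n k z 0) (\<lambda>x. \<not> \<sigma> x) v'"
    and v: "v + v' = oct_value n k Z W 0 - (\<Sum>x\<le>N. oct_value n k 0 0 x)"
    using chain_pair_attained[of "oct_value n k" W Z] octahedral_step_oct_value by blast
  obtain \<tau> where \<tau>: "\<tau> 0 = \<sigma>" "\<forall>w<W. interlace (N - w) (\<tau> w) (\<tau> (Suc w))" "\<forall>x<N - W. \<not> \<tau> W x"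
      "v = (\<Sum>w<W. strip_weight (N - w) (line_value k True w) (line_value k True (Suc w)) (\<tau> w) (\<tau> (Suc w)))"
    using c(1) unfolding oct_value_line chain_iff by blast
  obtain \<tau>' where \<tau>': "\<tau>' 0 = (\<lambda>x. \<not> \<sigma> x)" "\<forall>w<Z. interlace (N - w) (\<tau>' w) (\<tau>' (Suc w))" "\<forall>x<N - Z. \<not> \<tau>' Z x"
      "v' = (\<Sum>w<Z. strip_weight (N - w) (line_value k False w) (line_value k False (Suc w)) (\<tau>' w) (\<tau>' (Suc w)))"
    using c(2) unfolding oct_value_line chain_iff by blast
  define \<beta> where "\<beta> s = (if s then \<tau> else \<tau>')" for s
  obtain X where X: "perfect X" "\<And>s w x. w \<le> height s \<Longrightarrow> w + x < N \<Longrightarrow> line_bits X s w x \<longleftrightarrow> \<beta> s w x"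
  proof (rule perfect_exists[of \<beta>])
    show "interlace (N - w) (\<beta> s w) (\<beta> s (Suc w))" if "w < height s" for s w
      using that \<tau>(2) \<tau>'(2) by (auto simp: \<beta>_def height_def split: if_splits)
    show "\<not> \<beta> s (height s) x" if "x < N - height s" for s x
      using that \<tau>(3) \<tau>'(3) by (auto simp: \<beta>_def height_def split: if_splits)
    show "\<beta> True 0 x \<longleftrightarrow> \<not> \<beta> False 0 x" for x
      by (simp add: \<beta>_def \<tau>(1) \<tau>'(1))
  qed blast
  have "side_value k X s = (\<Sum>w<height s. strip_weight (N - w) (line_value k s w) (line_value k s (Suc w)) (\<beta> s w) (\<beta> s (Suc w)))" for s
    unfolding side_value_def by (intro sum.cong refl strip_weight_cong X(2)) auto
  then have "side_value k X True = v" "side_value k X False = v'"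
    by (simp_all add: \<beta>_def height_def \<tau>(4) \<tau>'(4))
  then show ?thesis
    using that[OF X(1)] v by (simp add: oct_value_line)
qed

end

section \<open>The weight of a perfect matching\<close>

context excavation
begin

abbreviation P :: "bool \<Rightarrow> nat \<Rightarrow> nat \<Rightarrow> point" where "P \<equiv> line_point n"

text \<open>Reflection in the equator maps the pieces of one side to those of the other. It interchanges the forms (i) and
(ii) of lozenges, and in all three forms it interchanges the vertices \<open>A\<close> and \<open>C\<close>; hence the case distinction.\<close>

fun tile_of :: "piece \<Rightarrow> tile" where
  "tile_of (Forward s w x) =
     (if s then Lozenge (P s w x) (P s w (Suc x)) (P s (Suc w) (Suc x)) (P s (Suc w) x)
      else Lozenge (P s (Suc w) (Suc x)) (P s w (Suc x)) (P s w x) (P s (Suc w) x))"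
| "tile_of (Backward s w x) =
     (if s then Lozenge (P s w (Suc (Suc x))) (P s (Suc w) (Suc x)) (P s (Suc w) x) (P s w (Suc x))
      else Lozenge (P s (Suc w) x) (P s (Suc w) (Suc x)) (P s w (Suc (Suc x))) (P s w (Suc x)))"
| "tile_of (Cross s w x) =
     (if s then Lozenge (P s (w - 1) (Suc x)) (P s w (Suc x)) (P s (Suc w) x) (P s w x)
      else Lozenge (P s (Suc w) x) (P s w (Suc x)) (P s (w - 1) (Suc x)) (P s w x))"
| "tile_of (Border s x) = Border_Triangle (P s 0 x) (P s 1 x) (P s 0 (Suc x))"

fun cell_weight :: "(point \<Rightarrow> real) \<Rightarrow> cell \<Rightarrow> real" where
  "cell_weight k (Base s w x) =
     (line_value k s w x + line_value k s w (Suc x) - 2 * line_value k s (Suc w) x) / 3"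
| "cell_weight k (Tip s w x) =
     (line_value k s (Suc w) x + line_value k s (Suc w) (Suc x) - 2 * line_value k s w (Suc x)) / 3"

text \<open>The weight of a border triangle involves only one end of its edge, so what it has in excess of its triangle and of
the strip weight is an asymmetric mean of the two ends, the same for both sides.\<close>

definition equator_share :: "(point \<Rightarrow> real) \<Rightarrow> nat \<Rightarrow> real" where
  "equator_share k x = (line_value k True 0 x + 2 * line_value k True 0 (Suc x)) / 3"

text \<open>The difference between the weight of a piece and the weights of its cells.\<close>

fun excess :: "(point \<Rightarrow> real) \<Rightarrow> piece \<Rightarrow> real" where
  "excess k (Cross s w x) = line_value k s (Suc w) x + line_value k s (w - 1) (Suc x)
     - line_value k s w x - line_value k s w (Suc x)"
| "excess k (Border s x) = line_value k s 1 x - line_value k s 0 x - line_value k s 0 (Suc x) + equator_share k x"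
| "excess k _ = 0"

lemma line_value_equator: "line_value k s 0 x = line_value k True 0 x"
  by (simp add: line_value_def line_point_def)

lemma tile_weight_eq:
  assumes "valid_piece c"
  shows "tile_weight k (tile_of c) = (\<Sum>T\<in>cells_of c. cell_weight k T) + excess k c"
proof (cases c)
  case (Forward s w x)
  then show ?thesis by (cases s) (auto simp: line_value_def field_simps)
next
  case (Backward s w x)
  then show ?thesis by (cases s) (auto simp: line_value_def field_simps)
next
  case (Cross s w x)
  then have "w = Suc (w - 1)"
    using assms by auto
  then obtain w' where "w = Suc w'" by blast
  then show ?thesis using Cross by (cases s) (auto simp: line_value_def field_simps)
next
  case (Border s x)
  then show ?thesis
    by (simp add: equator_share_def line_value_equator[symmetric, of _ _ s]) (simp add: line_value_def field_simps)
qed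

definition cell_index :: "(bool \<times> nat \<times> nat) set" where
  "cell_index = (SIGMA s:UNIV. SIGMA w:{..<height s}. {..<N - w})"

definition tip_index :: "(bool \<times> nat \<times> nat) set" where
  "tip_index = (SIGMA s:UNIV. SIGMA w:{..<height s}. {..<N - w - 1})"

lemma finite_index: "finite cell_index" "finite tip_index"
  by (auto simp: cell_index_def tip_index_def intro!: finite_SigmaI)

lemma mem_index:
  "(s, w, x) \<in> cell_index \<longleftrightarrow> w < height s \<and> w + x < N"
  "(s, w, x) \<in> tip_index \<longleftrightarrow> w < height s \<and> Suc (w + x) < N"
  by (auto simp: cell_index_def tip_index_def)

lemma valid_cells: "{T. valid_cell T} = (\<lambda>(s, w, x). Base s w x) ` cell_index \<union> (\<lambda>(s, w, x). Tip s w x) ` tip_index"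
proof (intro equalityI subsetI)
  fix T assume T: "T \<in> {T. valid_cell T}"
  show "T \<in> (\<lambda>(s, w, x). Base s w x) ` cell_index \<union> (\<lambda>(s, w, x). Tip s w x) ` tip_index"
  proof (cases T)
    case (Base s w x)
    then have "T = (\<lambda>(s, w, x). Base s w x) (s, w, x)" "(s, w, x) \<in> cell_index"
      using T by (auto simp: mem_index)
    then show ?thesis by blast
  next
    case (Tip s w x)
    then have "T = (\<lambda>(s, w, x). Tip s w x) (s, w, x)" "(s, w, x) \<in> tip_index"
      using T by (auto simp: mem_index)
    then show ?thesis by blast
  qed
qed (auto simp: mem_index)

lemma valid_pieces: "{c. valid_piece c} = (\<lambda>(s, w, x). Forward s w x) ` tip_index \<union>
    (\<lambda>(s, w, x). Backward s w x) ` tip_index \<union> (\<lambda>(s, w, x). line_piece s w x) ` cell_index"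
proof (intro equalityI subsetI)
  fix c assume c: "c \<in> {c. valid_piece c}"
  show "c \<in> (\<lambda>(s, w, x). Forward s w x) ` tip_index \<union>
    (\<lambda>(s, w, x). Backward s w x) ` tip_index \<union> (\<lambda>(s, w, x). line_piece s w x) ` cell_index"
  proof (cases c)
    case (Cross s w x)
    then have "c = (\<lambda>(s, w, x). line_piece s w x) (s, w, x)" "(s, w, x) \<in> cell_index"
      using c by (auto simp: mem_index line_piece_def)
    then show ?thesis by blast
  next
    case (Border s x)
    then have "c = (\<lambda>(s, w, x). line_piece s w x) (s, 0, x)" "(s, 0, x) \<in> cell_index"
      using c height_pos by (auto simp: mem_index line_piece_def)
    then show ?thesis by blast
  next
    case (Forward s w x)
    then have "c = (\<lambda>(s, w, x). Forward s w x) (s, w, x)" "(s, w, x) \<in> tip_index"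
      using c by (auto simp: mem_index)
    then show ?thesis by blast
  next
    case (Backward s w x)
    then have "c = (\<lambda>(s, w, x). Backward s w x) (s, w, x)" "(s, w, x) \<in> tip_index"
      using c by (auto simp: mem_index)
    then show ?thesis by blast
  qed
qed (auto simp: mem_index line_piece_def split: if_splits)

lemma finite_valid: "finite {T. valid_cell T}" "finite {c. valid_piece c}"
  unfolding valid_cells valid_pieces using finite_index by auto

lemma sum_cell_index: "(\<Sum>(s, w, x)\<in>cell_index. f s w x) = (\<Sum>s\<in>UNIV. \<Sum>w<height s. \<Sum>x<N - w. f s w x)"
  unfolding cell_index_def by (simp add: sum.Sigma)

lemma sum_tip_index: "(\<Sum>(s, w, x)\<in>tip_index. f s w x) = (\<Sum>s\<in>UNIV. \<Sum>w<height s. \<Sum>x<N - w - 1. f s w x)"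
  unfolding tip_index_def by (simp add: sum.Sigma)

definition line_ends :: "(point \<Rightarrow> real) \<Rightarrow> bool \<Rightarrow> nat \<Rightarrow> real" where
  "line_ends k s w = line_value k s w 0 + line_value k s w (N - w)"

text \<open>In a strip the inner points cancel: what is left are the two ends of the longer line minus those of the shorter
one, and these differences telescope over the levels.\<close>

lemma sum_cell_weight:
  "(\<Sum>T | valid_cell T. cell_weight k T) = (\<Sum>s\<in>UNIV. line_ends k s 0 - line_ends k s (height s)) / 3"
proof -
  have strip: "(\<Sum>x<m. (l x + l (Suc x) - 2 * l' x) / 3) + (\<Sum>x<m - 1. (l' x + l' (Suc x) - 2 * l (Suc x)) / 3)
      = (l 0 + l m - (l' 0 + l' (m - 1))) / 3" if "0 < m" for m and l l' :: "nat \<Rightarrow> real"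
    using that
  proof (induction m rule: nat_induct_non_zero)
    case (Suc m)
    then obtain m' where "m = Suc m'" by (cases m) auto
    then show ?case using Suc by (simp add: field_simps)
  qed (simp add: field_simps)
  have "(\<Sum>T | valid_cell T. cell_weight k T) =
    (\<Sum>T\<in>(\<lambda>(s, w, x). Base s w x) ` cell_index. cell_weight k T) + (\<Sum>T\<in>(\<lambda>(s, w, x). Tip s w x) ` tip_index. cell_weight k T)"
    unfolding valid_cells using finite_index by (intro sum.union_disjoint) auto
  also have "\<dots> = (\<Sum>(s, w, x)\<in>cell_index. cell_weight k (Base s w x)) + (\<Sum>(s, w, x)\<in>tip_index. cell_weight k (Tip s w x))"
    by (subst (1 2) sum.reindex) (auto simp: inj_on_def split_def)
  also have "\<dots> = (\<Sum>s\<in>UNIV. \<Sum>w<height s. (line_ends k s w - line_ends k s (Suc w)) / 3)"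
    unfolding sum_cell_index sum_tip_index sum.distrib[symmetric]
  proof (intro sum.cong refl)
    fix s w assume "w \<in> {..<height s}"
    then have "0 < N - w"
      using height_less[of s] by auto
    from strip[OF this, of "line_value k s w" "line_value k s (Suc w)"]
    show "(\<Sum>x<N - w. cell_weight k (Base s w x)) + (\<Sum>x<N - w - 1. cell_weight k (Tip s w x)) =
        (line_ends k s w - line_ends k s (Suc w)) / 3"
      by (simp add: line_ends_def)
  qed
  also have "\<dots> = (\<Sum>s\<in>UNIV. line_ends k s 0 - line_ends k s (height s)) / 3"
    by (simp add: sum_divide_distrib[symmetric] sum_lessThan_telescope')
  finally show ?thesis .
qed

lemma sum_perfect_cells:
  fixes f :: "cell \<Rightarrow> real"
  assumes "perfect X"
  shows "(\<Sum>c\<in>X. \<Sum>T\<in>cells_of c. f T) = (\<Sum>T | valid_cell T. f T)"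
proof -
  have fin: "finite X"
    using finite_subset[of X "{c. valid_piece c}"] finite_valid(2) perfect_valid[OF assms] by auto
  have fc: "finite (cells_of c)" for c
    by (cases c) auto
  have ex1: "\<exists>!c. c \<in> X \<and> T \<in> cells_of c" if "valid_cell T" for T
    using assms that by (simp add: perfect_def)
  have v: "valid_cell T" if "c \<in> X" "T \<in> cells_of c" for c T
    using that perfect_valid[OF assms] valid_piece_iff by blast
  have "{T. valid_cell T} = (\<Union>c\<in>X. cells_of c)"
    using v ex1 by blast
  moreover have "(\<Sum>T\<in>(\<Union>c\<in>X. cells_of c). f T) = (\<Sum>c\<in>X. \<Sum>T\<in>cells_of c. f T)"
    using fin fc v ex1 by (intro sum.UNION_disjoint) blast+
  ultimately show ?thesis by simp
qed

lemma sum_excess: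
  assumes "perfect X"
  shows "(\<Sum>c\<in>X. excess k c) = side_value k X True + side_value k X False + (\<Sum>x<N. equator_share k x)"
proof -
  have X: "X \<subseteq> {c. valid_piece c}"
    using perfect_valid[OF assms] by auto
  have inj: "inj_on (\<lambda>(s, w, x). line_piece s w x) cell_index"
    by (auto simp: inj_on_def line_piece_def split: if_splits)
  have "(\<Sum>c\<in>X. excess k c) = (\<Sum>c | valid_piece c. of_bool (c \<in> X) * excess k c)"
    using X finite_valid(2) by (intro sum.mono_neutral_cong_left) auto
  also have "\<dots> = (\<Sum>c\<in>(\<lambda>(s, w, x). line_piece s w x) ` cell_index. of_bool (c \<in> X) * excess k c)"
    using finite_valid(2) by (intro sum.mono_neutral_right) (auto simp: valid_pieces)
  also have "\<dots> = (\<Sum>s\<in>UNIV. \<Sum>w<height s. \<Sum>x<N - w. of_bool (line_bits X s w x) * excess k (line_piece s w x))"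
    unfolding sum_cell_index[symmetric] by (subst sum.reindex[OF inj]) (simp add: split_def line_bits_def comp_def)
  also have "\<dots> = (\<Sum>s\<in>UNIV. side_value k X s + (\<Sum>x<N. of_bool (line_bits X s 0 x) * equator_share k x))"
  proof (rule sum.cong[OF refl])
    fix s
    have "side_value k X s =
      (\<Sum>x<N. of_bool (line_bits X s 0 x) * (line_value k s 1 x - line_value k s 0 x - line_value k s 0 (Suc x))) +
      (\<Sum>w\<in>{1..<height s}. \<Sum>x<N - w. of_bool (line_bits X s w x) * excess k (line_piece s w x))"
      unfolding side_value_def using height_pos height_less[of s] perfect_top[OF assms]
      by (subst strip_weights_by_line) (auto simp: line_piece_def)
    moreover have "(\<Sum>w<height s. \<Sum>x<N - w. of_bool (line_bits X s w x) * excess k (line_piece s w x)) =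
      (\<Sum>x<N. of_bool (line_bits X s 0 x) * excess k (line_piece s 0 x)) +
      (\<Sum>w\<in>{1..<height s}. \<Sum>x<N - w. of_bool (line_bits X s w x) * excess k (line_piece s w x))"
      using height_pos[of s] by (simp add: lessThan_atLeast0 sum.atLeast_Suc_lessThan del: mult_eq_0_iff)
    moreover have "(\<Sum>x<N. of_bool (line_bits X s 0 x) * excess k (line_piece s 0 x)) =
      (\<Sum>x<N. of_bool (line_bits X s 0 x) * (line_value k s 1 x - line_value k s 0 x - line_value k s 0 (Suc x))) +
      (\<Sum>x<N. of_bool (line_bits X s 0 x) * equator_share k x)"
      unfolding sum.distrib[symmetric] by (intro sum.cong) (auto simp: line_piece_def)
    ultimately show "(\<Sum>w<height s. \<Sum>x<N - w. of_bool (line_bits X s w x) * excess k (line_piece s w x)) =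
       side_value k X s + (\<Sum>x<N. of_bool (line_bits X s 0 x) * equator_share k x)"
      by linarith
  qed
  also have "\<dots> = side_value k X True + side_value k X False +
      ((\<Sum>x<N. of_bool (line_bits X True 0 x) * equator_share k x) + (\<Sum>x<N. of_bool (line_bits X False 0 x) * equator_share k x))"
    by (simp add: UNIV_bool)
  also have "(\<Sum>x<N. of_bool (line_bits X True 0 x) * equator_share k x) + (\<Sum>x<N. of_bool (line_bits X False 0 x) * equator_share k x)
      = (\<Sum>x<N. equator_share k x)"
    unfolding sum.distrib[symmetric] using perfect_equator[OF assms] by (intro sum.cong) auto
  finally show ?thesis .
qed

text \<open>The ends of the lines on the far sides are the corners \<open>B\<close>, \<open>C\<close>, \<open>E\<close>, \<open>F\<close> of the hexagon, and the weight of the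
hexagon removes them. The remaining ends \<open>A\<close>, \<open>D\<close> complete the sum of the shares to the full sum along the equator.\<close>

lemma perfect_weight:
  assumes "perfect X"
  shows "(\<Sum>c\<in>X. tile_weight k (tile_of c)) + hexagon_weight k n (int W, n - int Z) =
    (\<Sum>x\<le>N. line_value k True 0 x) + side_value k X True + side_value k X False"
proof -
  have "(\<Sum>c\<in>X. tile_weight k (tile_of c)) = (\<Sum>c\<in>X. (\<Sum>T\<in>cells_of c. cell_weight k T) + excess k c)"
    using perfect_valid[OF assms] by (intro sum.cong tile_weight_eq) auto
  also have "\<dots> = (\<Sum>s\<in>UNIV. line_ends k s 0 - line_ends k s (height s)) / 3 +
      (side_value k X True + side_value k X False + (\<Sum>x<N. equator_share k x))"
    by (simp only: sum.distrib sum_perfect_cells[OF assms] sum_cell_weight sum_excess[OF assms])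
  also have "(\<Sum>x<N. equator_share k x) =
      (\<Sum>x\<le>N. line_value k True 0 x) - (2 * line_value k True 0 0 + line_value k True 0 N) / 3"
  proof -
    have "(\<Sum>x<m. (l x + 2 * l (Suc x)) / 3) = (\<Sum>x\<le>m. l x) - (2 * l 0 + l m) / 3" for m and l :: "nat \<Rightarrow> real"
      by (induction m) (auto simp: field_simps)
    then show ?thesis by (simp add: equator_share_def)
  qed
  also have "hexagon_weight k n (int W, n - int Z) = (line_ends k True (height True) + line_ends k False (height False)
      - line_value k True 0 N) / 3"
    by (simp add: hexagon_weight_def hexagon_def line_ends_def height_def line_value_def line_point_def algebra_simps)
  moreover have "(\<Sum>s\<in>UNIV. line_ends k s 0 - line_ends k s (height s)) =
     2 * line_value k True 0 0 + 2 * line_value k True 0 N - line_ends k True (height True) - line_ends k False (height False)"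
    by (simp add: UNIV_bool line_ends_def line_value_equator[of _ False])
  ultimately show ?thesis by (simp add: field_simps)
qed

end

section \<open>Solid triangles, solid tiles and the solid hexagon\<close>

lemma convex_affine_le: "convex {p :: real \<times> real. a * fst p + b * snd p \<le> c}"
  using convex_halfspace_le[of "(a, b)" c] by (simp add: inner_prod_def)

text \<open>A generic point lies on no lattice line, hence in at most one unit triangle. Centroids are generic, and so is some point
of every nonempty open set; therefore covering and disjointness of interiors can be tested triangle by triangle.\<close>

definition generic :: "real \<times> real \<Rightarrow> bool" where
  "generic p \<longleftrightarrow> fst p \<notin> \<int> \<and> snd p \<notin> \<int> \<and> fst p + snd p \<notin> \<int>"

lemma open_contains_generic:
  assumes "open S" "S \<noteq> {}"
  obtains p where "p \<in> S" "generic p"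
proof -
  obtain q where "q \<in> S" using assms(2) by blast
  \<comment> \<open>Along the diagonal through \<open>q\<close> only countably many points fail to be generic.\<close>
  define f where "f t = q + t *\<^sub>R (1, 1)" for t :: real
  have "isCont f 0"
    unfolding f_def by (intro continuous_intros)
  moreover have "f 0 \<in> S"
    using \<open>q \<in> S\<close> by (simp add: f_def zero_prod_def[symmetric])
  ultimately have "\<forall>\<^sub>F t in at 0. f t \<in> S"
    using assms(1) by (metis isCont_def topological_tendstoD)
  then obtain d where d: "d > 0" "\<And>t. t \<noteq> 0 \<Longrightarrow> dist t 0 < d \<Longrightarrow> f t \<in> S"
    unfolding eventually_at by blast
  let ?bad = "(\<lambda>i. i - fst q) ` \<int> \<union> (\<lambda>i. i - snd q) ` \<int> \<union> (\<lambda>i. (i - fst q - snd q) / 2) ` (\<int> :: real set)"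
  have "countable (\<int> :: real set)"
    by (simp add: Ints_def)
  then have "countable ?bad" by auto
  moreover have "uncountable {0<..<d}"
    using d(1) by (simp add: uncountable_open_interval)
  ultimately obtain t where t: "t \<in> {0<..<d}" "t \<notin> ?bad"
    by (meson countable_subset subsetI)
  have "generic (f t)"
    unfolding generic_def
  proof (intro conjI notI)
    assume "fst (f t) \<in> \<int>"
    moreover have "t = fst (f t) - fst q" by (simp add: f_def)
    ultimately show False using t(2) by blast
  next
    assume "snd (f t) \<in> \<int>"
    moreover have "t = snd (f t) - snd q" by (simp add: f_def)
    ultimately show False using t(2) by blast
  next
    assume "fst (f t) + snd (f t) \<in> \<int>"
    moreover have "t = (fst (f t) + snd (f t) - fst q - snd q) / 2" by (simp add: f_def)
    ultimately show False using t(2) by blast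
  qed
  then show ?thesis
    using that[of "f t"] d(2)[of t] t(1) by (simp add: dist_real_def)
qed

context excavation
begin

text \<open>In the coordinates level and position both halves of the hexagon become the trapezoid
\<open>0 \<le> level \<le> height, 0 \<le> position, level + position \<le> N\<close>, and the lattice lines are those on which
level, position or their sum is an integer.\<close>

definition level :: "bool \<Rightarrow> real \<times> real \<Rightarrow> real" where
  "level s p = (if s then fst p + snd p - real_of_int n else real_of_int n - fst p - snd p)"

definition position :: "bool \<Rightarrow> real \<times> real \<Rightarrow> real" where
  "position s p = (if s then real_of_int n - snd p else fst p)"

definition chart :: "bool \<Rightarrow> real \<Rightarrow> real \<Rightarrow> real \<times> real" where
  "chart s d \<xi> = (if s then (\<xi> + d, real_of_int n - \<xi>) else (\<xi>, real_of_int n - d - \<xi>))"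

lemma level_chart [simp]: "level s (chart s d \<xi>) = d"
  and position_chart [simp]: "position s (chart s d \<xi>) = \<xi>"
  by (auto simp: level_def position_def chart_def)

lemma chart_eqI: "level s p = d \<Longrightarrow> position s p = \<xi> \<Longrightarrow> p = chart s d \<xi>"
  by (cases p; cases s) (auto simp: level_def position_def chart_def)

lemma real_point_line_point: "real_point (P s w x) = chart s (real w) (real x)"
  by (simp add: real_point_def line_point_def chart_def)

lemma level_affine: "u + v = 1 \<Longrightarrow> level s (u *\<^sub>R p + v *\<^sub>R q) = u * level s p + v * level s q"
  and position_affine: "u + v = 1 \<Longrightarrow> position s (u *\<^sub>R p + v *\<^sub>R q) = u * position s p + v * position s q"
proof -
  assume "u + v = 1"
  then have "u = 1 - v" by simp
  then show "level s (u *\<^sub>R p + v *\<^sub>R q) = u * level s p + v * level s q"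
    "position s (u *\<^sub>R p + v *\<^sub>R q) = u * position s p + v * position s q"
    unfolding \<open>u = 1 - v\<close> by (auto simp: level_def position_def algebra_simps)
qed

lemma chart_affine: "u + v = 1 \<Longrightarrow> u *\<^sub>R chart s d \<xi> + v *\<^sub>R chart s d' \<xi>' = chart s (u * d + v * d') (u * \<xi> + v * \<xi>')"
  by (intro chart_eqI) (simp_all add: level_affine position_affine)

lemma chart_affine3:
  assumes "t + u + v = 1"
  shows "t *\<^sub>R chart s d \<xi> + u *\<^sub>R chart s d' \<xi>' + v *\<^sub>R chart s d'' \<xi>'' =
    chart s (t * d + u * d' + v * d'') (t * \<xi> + u * \<xi>' + v * \<xi>'')"
proof -
  have "t = 1 - u - v" using assms by simp
  show ?thesis unfolding \<open>t = 1 - u - v\<close> by (auto simp: chart_def algebra_simps)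
qed

lemma convex_level_le: "convex {p. a * level s p + b * position s p \<le> c}"
proof (cases s)
  case True
  have "{p. a * level s p + b * position s p \<le> c} = {p. a * fst p + (a - b) * snd p \<le> c + a * n - b * n}"
    by (auto simp: True level_def position_def algebra_simps)
  then show ?thesis by (simp only: convex_affine_le)
next
  case False
  have "{p. a * level s p + b * position s p \<le> c} = {p. (b - a) * fst p + (- a) * snd p \<le> c - a * n}"
    by (auto simp: False level_def position_def algebra_simps)
  then show ?thesis by (simp only: convex_affine_le)
qed

lemma convex_slab: "convex {p. a \<le> level s p \<and> level s p \<le> a' \<and> b \<le> position s p \<and> position s p \<le> b' \<and>
    c \<le> level s p + position s p \<and> level s p + position s p \<le> c'}"
proof -
  have "convex ({p. (-1) * level s p + 0 * position s p \<le> - a} \<inter> {p. 1 * level s p + 0 * position s p \<le> a'} \<inter>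
      {p. 0 * level s p + (-1) * position s p \<le> - b} \<inter> {p. 0 * level s p + 1 * position s p \<le> b'} \<inter>
      {p. (-1) * level s p + (-1) * position s p \<le> - c} \<inter> {p. 1 * level s p + 1 * position s p \<le> c'})"
    by (intro convex_Int convex_level_le)
  also have "\<dots> = {p. a \<le> level s p \<and> level s p \<le> a' \<and> b \<le> position s p \<and> position s p \<le> b' \<and>
    c \<le> level s p + position s p \<and> level s p + position s p \<le> c'}"
    by auto
  finally show ?thesis .
qed

fun cell_vertices :: "cell \<Rightarrow> point set" where
  "cell_vertices (Base s w x) = {P s w x, P s w (Suc x), P s (Suc w) x}"
| "cell_vertices (Tip s w x) = {P s w (Suc x), P s (Suc w) x, P s (Suc w) (Suc x)}"

lemma solid_Base: "p \<in> solid (cell_vertices (Base s w x)) \<longleftrightarrow>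
    real w \<le> level s p \<and> real x \<le> position s p \<and> level s p + position s p \<le> real w + real x + 1"
proof
  assume "p \<in> solid (cell_vertices (Base s w x))"
  then obtain t u v where tuv: "0 \<le> t" "0 \<le> u" "0 \<le> v" "t + u + v = 1"
    "p = t *\<^sub>R chart s w x + u *\<^sub>R chart s w (Suc x) + v *\<^sub>R chart s (Suc w) x"
    by (auto simp: solid_def convex_hull_3 real_point_line_point)
  then have t: "t = 1 - u - v" by simp
  have "p = chart s (w + v) (x + u)"
    unfolding tuv(5) chart_affine3[OF tuv(4)] by (simp add: t algebra_simps)
  then show "real w \<le> level s p \<and> real x \<le> position s p \<and> level s p + position s p \<le> real w + real x + 1"
    using tuv by simp
next
  assume *: "real w \<le> level s p \<and> real x \<le> position s p \<and> level s p + position s p \<le> real w + real x + 1"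
  define v u where "v = level s p - w" and "u = position s p - x"
  have "p = chart s (w + v) (x + u)"
    by (intro chart_eqI) (auto simp: u_def v_def)
  also have "\<dots> = (1 - u - v) *\<^sub>R chart s w x + u *\<^sub>R chart s w (Suc x) + v *\<^sub>R chart s (Suc w) x"
    by (subst chart_affine3) (auto simp: algebra_simps)
  finally show "p \<in> solid (cell_vertices (Base s w x))"
    using * unfolding solid_def cell_vertices.simps image_insert image_empty real_point_line_point convex_hull_3
    by (intro CollectI exI[of _ "1 - u - v"] exI[of _ u] exI[of _ v]) (auto simp: u_def v_def)
qed

lemma solid_Tip: "p \<in> solid (cell_vertices (Tip s w x)) \<longleftrightarrow>
    level s p \<le> real w + 1 \<and> position s p \<le> real x + 1 \<and> real w + real x + 1 \<le> level s p + position s p"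
proof
  assume "p \<in> solid (cell_vertices (Tip s w x))"
  then obtain t u v where tuv: "0 \<le> t" "0 \<le> u" "0 \<le> v" "t + u + v = 1"
    "p = t *\<^sub>R chart s w (Suc x) + u *\<^sub>R chart s (Suc w) x + v *\<^sub>R chart s (Suc w) (Suc x)"
    by (auto simp: solid_def convex_hull_3 real_point_line_point)
  then have v: "v = 1 - t - u" by simp
  have "p = chart s (w + 1 - t) (x + 1 - u)"
    unfolding tuv(5) chart_affine3[OF tuv(4)] by (simp add: v algebra_simps)
  then show "level s p \<le> real w + 1 \<and> position s p \<le> real x + 1 \<and> real w + real x + 1 \<le> level s p + position s p"
    using tuv by simp
next
  assume *: "level s p \<le> real w + 1 \<and> position s p \<le> real x + 1 \<and> real w + real x + 1 \<le> level s p + position s p"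
  define t u where "t = w + 1 - level s p" and "u = x + 1 - position s p"
  have "p = chart s (w + 1 - t) (x + 1 - u)"
    by (intro chart_eqI) (auto simp: t_def u_def)
  also have "\<dots> = t *\<^sub>R chart s w (Suc x) + u *\<^sub>R chart s (Suc w) x + (1 - t - u) *\<^sub>R chart s (Suc w) (Suc x)"
    by (subst chart_affine3) (auto simp: algebra_simps)
  finally show "p \<in> solid (cell_vertices (Tip s w x))"
    using * unfolding solid_def cell_vertices.simps image_insert image_empty real_point_line_point convex_hull_3
    by (intro CollectI exI[of _ t] exI[of _ u] exI[of _ "1 - t - u"]) (auto simp: t_def u_def)
qed

lemma level_not_Int: "generic p \<Longrightarrow> level s p \<noteq> real w"
  and position_not_Int: "generic p \<Longrightarrow> position s p \<noteq> real w"
  and sum_not_Int: "generic p \<Longrightarrow> level s p + position s p \<noteq> real w"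
proof -
  assume g: "generic p"
  have *: "fst p \<noteq> of_int k" "snd p \<noteq> of_int k" "fst p + snd p \<noteq> of_int k" for k
    using g unfolding generic_def by (metis Ints_of_int)+
  show "level s p \<noteq> real w"
    using *(3)[of "n + int w"] *(3)[of "n - int w"] by (auto simp: level_def)
  show "position s p \<noteq> real w"
    using *(1)[of "int w"] *(2)[of "n - int w"] by (auto simp: position_def)
  show "level s p + position s p \<noteq> real w"
    using *(1)[of "int w"] *(2)[of "n - int w"] by (auto simp: position_def level_def)
qed

fun in_cell :: "bool \<Rightarrow> nat \<Rightarrow> nat \<Rightarrow> real \<times> real \<Rightarrow> bool" where
  "in_cell s w x p \<longleftrightarrow> real w < level s p \<and> level s p < real w + 1 \<and> real x < position s p \<and> position s p < real x + 1"

lemma generic_cell_unique: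
  assumes g: "generic p" and T: "p \<in> solid (cell_vertices T)" and T': "p \<in> solid (cell_vertices T')"
  shows "T = T'"
proof -
  have base: "in_cell s w x p \<and> level s p + position s p < real w + real x + 1"
    if "p \<in> solid (cell_vertices (Base s w x))" for s w x
    using that level_not_Int[OF g, of s w] position_not_Int[OF g, of s x] sum_not_Int[OF g, of s "w + x + 1"]
    unfolding solid_Base by auto
  have tip: "in_cell s w x p \<and> level s p + position s p > real w + real x + 1"
    if "p \<in> solid (cell_vertices (Tip s w x))" for s w x
    using that level_not_Int[OF g, of s "w + 1"] position_not_Int[OF g, of s "x + 1"] sum_not_Int[OF g, of s "w + x + 1"]
    unfolding solid_Tip by auto
  have uniq: "s = s' \<and> w = w' \<and> x = x'" if "in_cell s w x p" "in_cell s' w' x' p" for s w x s' w' x'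
  proof -
    have "s = s'"
      using that by (cases s; cases s') (auto simp: level_def)
    then have "real w < real w' + 1" "real w' < real w + 1" "real x < real x' + 1" "real x' < real x + 1"
      using that by auto
    with \<open>s = s'\<close> show ?thesis by linarith
  qed
  show ?thesis
  proof (cases T)
    case T1: (Base s w x)
    show ?thesis
    proof (cases T')
      case (Base s' w' x')
      then show ?thesis using base uniq T T' unfolding T1 by blast
    next
      case (Tip s' w' x')
      have "s = s' \<and> w = w' \<and> x = x'"
        using uniq base[OF T[unfolded T1]] tip[OF T'[unfolded Tip]] by blast
      then show ?thesis using base[OF T[unfolded T1]] tip[OF T'[unfolded Tip]] by simp
    qed
  next
    case T1: (Tip s w x)
    show ?thesis
    proof (cases T')
      case (Base s' w' x')
      have "s = s' \<and> w = w' \<and> x = x'"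
        using uniq tip[OF T[unfolded T1]] base[OF T'[unfolded Base]] by blast
      then show ?thesis using tip[OF T[unfolded T1]] base[OF T'[unfolded Base]] by simp
    next
      case (Tip s' w' x')
      then show ?thesis using tip uniq T T' unfolding T1 by blast
    qed
  qed
qed

fun centroid :: "cell \<Rightarrow> real \<times> real" where
  "centroid (Base s w x) = chart s (real w + 1/3) (real x + 1/3)"
| "centroid (Tip s w x) = chart s (real w + 2/3) (real x + 2/3)"

lemma third_not_Int: "real_of_int k + 1/3 \<notin> \<int>" "real_of_int k + 2/3 \<notin> \<int>"
proof -
  have "real_of_int k + 1/3 \<noteq> of_int m" "real_of_int k + 2/3 \<noteq> of_int m" for m
  proof -
    have "3 * k + 1 \<noteq> 3 * m" "3 * k + 2 \<noteq> 3 * m" by presburger+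
    then have "real_of_int (3 * k + 1) \<noteq> real_of_int (3 * m)" "real_of_int (3 * k + 2) \<noteq> real_of_int (3 * m)"
      by (simp_all only: of_int_eq_iff not_False_eq_True)
    then show "real_of_int k + 1/3 \<noteq> of_int m" "real_of_int k + 2/3 \<noteq> of_int m" by auto
  qed
  then show "real_of_int k + 1/3 \<notin> \<int>" "real_of_int k + 2/3 \<notin> \<int>"
    by (auto elim!: Ints_cases)
qed

lemma generic_centroid: "generic (centroid T)"
proof -
  have "real_of_int k + 1/3 = a \<Longrightarrow> a \<notin> \<int>" "real_of_int k + 2/3 = a \<Longrightarrow> a \<notin> \<int>" for k a
    using third_not_Int by auto
  note * = this
  show ?thesis
  proof (cases T)
    case (Base s w x)
    show ?thesis
      unfolding Base generic_def centroid.simps chart_def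
      by (cases s) (auto intro: *(2)[of "int x + int w"] *(2)[of "n - int x - 1"] *(1)[of "n + int w"]
        *(1)[of "int x"] *(1)[of "n - int w - int x - 1"] *(2)[of "n - int w - 1"])
  next
    case (Tip s w x)
    show ?thesis
      unfolding Tip generic_def centroid.simps chart_def
      by (cases s) (auto intro: *(1)[of "int x + int w + 1"] *(1)[of "n - int x - 1"] *(2)[of "n + int w"]
        *(2)[of "int x"] *(2)[of "n - int w - int x - 2"] *(1)[of "n - int w - 1"])
  qed
qed

lemma centroid_interior: "centroid T \<in> interior (solid (cell_vertices T))"
proof -
  have cont: "continuous_on UNIV (level s)" "continuous_on UNIV (position s)" for s
    unfolding level_def position_def by (cases s; auto intro!: continuous_intros)+
  show ?thesis
  proof (cases T)
    case (Base s w x)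
    have "open {p. real w < level s p \<and> real x < position s p \<and> level s p + position s p < real w + real x + 1}"
      by (intro open_Collect_conj open_Collect_less cont continuous_intros)
    then show ?thesis
      by (rule interiorI) (auto simp: Base solid_Base simp del: cell_vertices.simps)
  next
    case (Tip s w x)
    have "open {p. level s p < real w + 1 \<and> position s p < real x + 1 \<and> real w + real x + 1 < level s p + position s p}"
      by (intro open_Collect_conj open_Collect_less cont continuous_intros)
    then show ?thesis
      by (rule interiorI) (auto simp: Tip solid_Tip simp del: cell_vertices.simps)
  qed
qed

text \<open>One inclusion holds because each cell is spanned by vertices of the tile. For the other one, a lozenge is contained in a slab that
one inequality cuts into its two cells.\<close>

lemma solid_tile:
  assumes "valid_piece c"
  shows "solid (tile_vertices (tile_of c)) = (\<Union>T\<in>cells_of c. solid (cell_vertices T))"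
proof
  have "cell_vertices T \<subseteq> tile_vertices (tile_of c)" if "T \<in> cells_of c" for T
    using that assms by (cases c) (auto split: if_splits)
  then show "(\<Union>T\<in>cells_of c. solid (cell_vertices T)) \<subseteq> solid (tile_vertices (tile_of c))"
    unfolding solid_def by (intro UN_least hull_mono image_mono)
  show "solid (tile_vertices (tile_of c)) \<subseteq> (\<Union>T\<in>cells_of c. solid (cell_vertices T))"
  proof (cases c)
    case (Forward s w x)
    have "solid (tile_vertices (tile_of c)) \<subseteq> {p. real w \<le> level s p \<and> level s p \<le> real w + 1 \<and>
        real x \<le> position s p \<and> position s p \<le> real x + 1 \<and>
        real w + real x \<le> level s p + position s p \<and> level s p + position s p \<le> real w + real x + 2}"
      unfolding solid_def by (intro hull_minimal convex_slab) (auto simp: Forward real_point_line_point)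
    then show ?thesis
      by (auto simp: Forward solid_Base solid_Tip simp del: cell_vertices.simps)
  next
    case (Backward s w x)
    have "solid (tile_vertices (tile_of c)) \<subseteq> {p. real w \<le> level s p \<and> level s p \<le> real w + 1 \<and>
        real x \<le> position s p \<and> position s p \<le> real x + 2 \<and>
        real w + real x + 1 \<le> level s p + position s p \<and> level s p + position s p \<le> real w + real x + 2}"
      unfolding solid_def by (intro hull_minimal convex_slab) (auto simp: Backward real_point_line_point)
    then show ?thesis
      by (auto simp: Backward solid_Base solid_Tip simp del: cell_vertices.simps)
  next
    case (Cross s w x)
    then obtain v where w: "w = Suc v"
      using assms by (cases w) auto
    have "solid (tile_vertices (tile_of c)) \<subseteq> {p. real v \<le> level s p \<and> level s p \<le> real v + 2 \<and>
        real x \<le> position s p \<and> position s p \<le> real x + 1 \<and>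
        real v + real x + 1 \<le> level s p + position s p \<and> level s p + position s p \<le> real v + real x + 2}"
      unfolding solid_def by (intro hull_minimal convex_slab) (auto simp: Cross real_point_line_point w)
    then show ?thesis
      by (auto simp: Cross solid_Base solid_Tip w simp del: cell_vertices.simps)
  next
    case (Border s x)
    then show ?thesis by (simp add: insert_commute)
  qed
qed


text \<open>A description of the solid hexagon by inequalities; the hull of the six corners lies in this region, the region is
covered by the cells, and the cells lie in the hull.\<close>

definition hull_region :: "(real \<times> real) set" where
  "hull_region = {p. level True p \<le> real W \<and> level False p \<le> real Z \<and> 0 \<le> fst p \<and> fst p \<le> real N \<and>
     snd p \<le> real_of_int n \<and> real_of_int n - real N \<le> snd p}"

lemma solid_hexagon_eq_hull: "solid_hexagon n (int W, n - int Z) =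
    convex hull (real_point ` {P True 0 0, P False Z 0, P False Z W, P True 0 N, P True W Z, P True W 0})"
  by (simp add: solid_hexagon_def hexagon_def solid_def line_point_def algebra_simps)

lemma solid_hexagon_subset: "solid_hexagon n (int W, n - int Z) \<subseteq> hull_region"
proof -
  have "convex ({p. 1 * level True p + 0 * position True p \<le> W} \<inter> {p. 1 * level False p + 0 * position False p \<le> Z} \<inter>
     {p. (-1) * fst p + 0 * snd p \<le> 0} \<inter> {p. 1 * fst p + 0 * snd p \<le> N} \<inter>
     {p. 0 * fst p + 1 * snd p \<le> real_of_int n} \<inter> {p. 0 * fst p + (-1) * snd p \<le> N - real_of_int n})"
    by (intro convex_Int convex_level_le convex_affine_le)
  also have "\<dots> = hull_region"
    by (auto simp: hull_region_def)
  finally have "convex hull_region" .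
  then show ?thesis
    unfolding solid_hexagon_eq_hull
    by (intro hull_minimal) (auto simp: hull_region_def real_point_line_point, (auto simp: chart_def level_def)?)
qed

text \<open>A point on a line is a convex combination of the two ends of that line, which in turn lie on the sides of the hexagon.\<close>

lemma line_point_in_hexagon:
  assumes "w \<le> height s" "w + x \<le> N"
  shows "real_point (P s w x) \<in> solid_hexagon n (int W, n - int Z)"
proof -
  let ?H = "solid_hexagon n (int W, n - int Z)"
  have conv: "convex ?H"
    by (simp add: solid_hexagon_eq_hull)
  have corners: "real_point p \<in> ?H" if "p \<in> {P True 0 0, P False Z 0, P False Z W, P True 0 N, P True W Z, P True W 0}" for p
    unfolding solid_hexagon_eq_hull by (rule hull_inc) (use that in blast)
  have eq: "P s 0 y = P True 0 y" for y
    by (simp add: line_point_def)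
  let ?h = "real (height s)" and ?u = "real w / real (height s)"
  have h: "0 < ?h" "?h < real N"
    using height_pos[of s] height_less[of s] by linarith+
  have c: "chart s 0 0 \<in> ?H" "chart s 0 N \<in> ?H" "chart s ?h 0 \<in> ?H" "chart s ?h (real N - ?h) \<in> ?H"
  proof -
    have "height s \<le> N" using height_less[of s] by simp
    have "real_point (P s 0 0) \<in> ?H" "real_point (P s 0 N) \<in> ?H"
      using corners[of "P True 0 0"] corners[of "P True 0 N"] by (simp_all add: eq)
    moreover have "real_point (P s (height s) 0) \<in> ?H"
      using corners[of "P True W 0"] corners[of "P False Z 0"] by (cases s) (simp_all add: height_def)
    moreover have "real_point (P s (height s) (N - height s)) \<in> ?H"
      using corners[of "P True W Z"] corners[of "P False Z W"] by (cases s) (simp_all add: height_def)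
    ultimately have "real_point (P s 0 0) \<in> ?H" "real_point (P s 0 N) \<in> ?H" "real_point (P s (height s) 0) \<in> ?H"
      "real_point (P s (height s) (N - height s)) \<in> ?H"
      by blast+
    then show "chart s 0 0 \<in> ?H" "chart s 0 N \<in> ?H" "chart s ?h 0 \<in> ?H" "chart s ?h (real N - ?h) \<in> ?H"
      using \<open>height s \<le> N\<close> by (simp_all add: real_point_line_point of_nat_diff)
  qed
  have u: "0 \<le> ?u" "?u \<le> 1"
    using assms(1) h by auto
  have left: "chart s w 0 \<in> ?H"
    using convexD_alt[OF conv c(1,3) u] h by (simp add: chart_affine)
  have right: "chart s w (real N - w) \<in> ?H"
  proof -
    have "(1 - ?u) * real N + ?u * (real N - ?h) = real N - real w"
      using h by (simp add: field_simps)
    then show ?thesis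
      using convexD_alt[OF conv c(2,4) u] h by (simp add: chart_affine)
  qed
  have wN: "real w < real N"
    using assms(1) height_less[of s] by linarith
  let ?v = "real x / (real N - real w)"
  have v: "0 \<le> ?v" "?v \<le> 1"
    using assms(2) wN by auto
  have "(1 - ?v) * w + ?v * w = w"
    by (simp only: left_diff_distrib)
  moreover have "?v * (real N - real w) = x"
    using wN by simp
  ultimately show ?thesis
    using convexD_alt[OF conv left right v] by (simp add: chart_affine real_point_line_point)
qed

lemma half_hexagon_covered:
  assumes "0 \<le> level s p" "level s p \<le> height s" "0 \<le> position s p" "level s p + position s p \<le> N"
  obtains T where "valid_cell T" "p \<in> solid (cell_vertices T)"
proof -
  \<comment> \<open>Rounding down would leave the hexagon on the far side, so the level is capped at the last strip.\<close>
  define w where "w = min (nat \<lfloor>level s p\<rfloor>) (height s - 1)"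
  define x where "x = nat \<lfloor>position s p\<rfloor>"
  have x: "real x \<le> position s p" "position s p < real x + 1"
    using assms(3) by (simp_all add: x_def)
  have w: "w < height s" "real w \<le> level s p" "level s p \<le> real w + 1"
  proof -
    have fl: "real (nat \<lfloor>level s p\<rfloor>) \<le> level s p" "level s p < real (nat \<lfloor>level s p\<rfloor>) + 1"
      using assms(1) by simp_all
    show "w < height s" using height_pos[of s] by (auto simp: w_def)
    show "real w \<le> level s p" using fl by (simp add: w_def min_def)
    have "real (height s - 1) = real (height s) - 1"
      using height_pos[of s] by (simp add: of_nat_diff)
    then show "level s p \<le> real w + 1"
      using fl assms(2) by (auto simp: w_def min_def)
  qed
  show ?thesis
  proof (cases "w + x < N")
    case True
    show ?thesis
    proof (cases "level s p + position s p \<le> real w + real x + 1")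
      case le: True
      then show ?thesis
        using that[of "Base s w x"] True w x by (simp add: solid_Base del: cell_vertices.simps)
    next
      case False
      then have "Suc (w + x) < N" using assms(4) by linarith
      then show ?thesis
        using that[of "Tip s w x"] False w x by (simp add: solid_Tip del: cell_vertices.simps)
    qed
  next
    case False
    then have "real N \<le> real w + real x" by linarith
    then have eq: "level s p = real w" "position s p = real x" "real N = real w + real x"
      using w x assms(4) by linarith+
    \<comment> \<open>The remaining points are lattice points at the right end of a line; they are corners of the preceding cell.\<close>
    have "0 < x" using eq(3) w(1) height_less[of s] by linarith
    then obtain y where "x = Suc y" by (cases x) auto
    then show ?thesis
      using that[of "Base s w y"] eq w(1) by (simp add: solid_Base del: cell_vertices.simps)
  qed
qed

lemma solid_hexagon_cells: "solid_hexagon n (int W, n - int Z) = (\<Union>T\<in>{T. valid_cell T}. solid (cell_vertices T))"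
proof
  show "solid_hexagon n (int W, n - int Z) \<subseteq> (\<Union>T\<in>{T. valid_cell T}. solid (cell_vertices T))"
  proof
    fix p assume "p \<in> solid_hexagon n (int W, n - int Z)"
    then have p: "p \<in> hull_region" using solid_hexagon_subset by blast
    have "\<exists>s. 0 \<le> level s p \<and> level s p \<le> height s \<and> 0 \<le> position s p \<and> level s p + position s p \<le> N"
    proof (cases "0 \<le> level True p")
      case True
      with p show ?thesis
        by (intro exI[of _ True]) (simp add: hull_region_def height_def level_def position_def)
    next
      case False
      with p show ?thesis
        by (intro exI[of _ False]) (simp add: hull_region_def height_def level_def position_def)
    qed
    then obtain T where "valid_cell T" "p \<in> solid (cell_vertices T)"
      using half_hexagon_covered by blast
    then show "p \<in> (\<Union>T\<in>{T. valid_cell T}. solid (cell_vertices T))" by blast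
  qed
  have "solid (cell_vertices T) \<subseteq> solid_hexagon n (int W, n - int Z)" if "valid_cell T" for T
  proof -
    have "real_point ` cell_vertices T \<subseteq> solid_hexagon n (int W, n - int Z)"
      using that by (cases T) (auto intro!: line_point_in_hexagon)
    moreover have "convex (solid_hexagon n (int W, n - int Z))"
      by (simp add: solid_hexagon_eq_hull)
    ultimately show ?thesis
      unfolding solid_def by (rule hull_minimal)
  qed
  then show "(\<Union>T\<in>{T. valid_cell T}. solid (cell_vertices T)) \<subseteq> solid_hexagon n (int W, n - int Z)" by blast
qed

definition in_bounds :: "point \<Rightarrow> bool" where
  "in_bounds q \<longleftrightarrow> (case q of (a, b) \<Rightarrow> 0 \<le> a \<and> a \<le> int N \<and> n - int N \<le> b \<and> b \<le> n \<and> a + b - n \<le> int W \<and> n - a - b \<le> int Z)"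

lemma real_point_hull_region: "real_point q \<in> hull_region \<longleftrightarrow> in_bounds q"
proof -
  obtain a b where q: "q = (a, b)" by (cases q)
  have "real_of_int a + real_of_int b - real_of_int n \<le> real W \<longleftrightarrow> a + b - n \<le> int W"
    "real_of_int n - real_of_int a - real_of_int b \<le> real Z \<longleftrightarrow> n - a - b \<le> int Z"
    "real_of_int a \<le> real N \<longleftrightarrow> a \<le> int N" "real_of_int n - real N \<le> real_of_int b \<longleftrightarrow> n - int N \<le> b"
    by linarith+
  then show ?thesis
    by (auto simp: q hull_region_def in_bounds_def real_point_def level_def)
qed

lemma line_point_True: "x \<le> N \<Longrightarrow> w + x \<le> N \<Longrightarrow> P True w x \<in> regionU n"
  using fits by (auto simp: line_point_def regionU_def)

lemma line_point_False: "w + x \<le> N \<Longrightarrow> P False w x \<in> regionU' n"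
  using fits by (auto simp: line_point_def regionU'_def)

lemma lozengesI:
  assumes "A \<in> regionU n \<and> B \<in> regionU n \<and> C \<in> regionU n \<and> D \<in> regionU n \<or>
      A \<in> regionU' n \<and> B \<in> regionU' n \<and> C \<in> regionU' n \<and> D \<in> regionU' n"
    and "(A, B, C, D) = ((i, j), (i+1, j-1), (i+2, j-1), (i+1, j)) \<or>
        (A, B, C, D) = ((i, j), (i, j+1), (i-1, j+2), (i-1, j+1)) \<or>
        (A, B, C, D) = ((i, j), (i+1, j), (i+1, j+1), (i, j+1))"
  shows "Lozenge A B C D \<in> lozenges n"
  unfolding lozenges_def using assms by blast

lemma tile_of_in:
  assumes "valid_piece c"
  shows "tile_of c \<in> lozenges n \<union> border_triangles n"
proof (cases c)
  case (Forward s w x)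
  then have *: "Suc (w + x) < N" using assms by simp
  show ?thesis
  proof (cases s)
    case True
    show ?thesis
      unfolding Forward tile_of.simps if_P[OF True]
      by (rule UnI1, rule lozengesI[where i = "int x + int w" and j = "n - int x"])
         (use * True in \<open>auto intro!: line_point_True, auto simp: line_point_def\<close>)
  next
    case False
    show ?thesis
      unfolding Forward tile_of.simps if_not_P[OF False]
      by (rule UnI1, rule lozengesI[where i = "int x + 1" and j = "n - int w - int x - 2"])
         (use * False in \<open>auto intro!: line_point_False, auto simp: line_point_def\<close>)
  qed
next
  case (Backward s w x)
  then have *: "Suc (w + x) < N" using assms by simp
  show ?thesis
  proof (cases s)
    case True
    show ?thesis
      unfolding Backward tile_of.simps if_P[OF True]
      by (rule UnI1, rule lozengesI[where i = "int x + int w + 2" and j = "n - int x - 2"])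
         (use * True in \<open>auto intro!: line_point_True, auto simp: line_point_def\<close>)
  next
    case False
    show ?thesis
      unfolding Backward tile_of.simps if_not_P[OF False]
      by (rule UnI1, rule lozengesI[where i = "int x" and j = "n - int w - int x - 1"])
         (use * False in \<open>auto intro!: line_point_False, auto simp: line_point_def\<close>)
  qed
next
  case (Cross s w x)
  then obtain v where w: "w = Suc v" and *: "Suc (v + x) < N"
    using assms by (cases w) auto
  show ?thesis
  proof (cases s)
    case True
    show ?thesis
      unfolding Cross tile_of.simps if_P[OF True]
      by (rule UnI1, rule lozengesI[where i = "int x + int v + 1" and j = "n - int x - 1"])
         (use * True w in \<open>auto intro!: line_point_True, auto simp: line_point_def\<close>)
  next
    case False
    show ?thesis
      unfolding Cross tile_of.simps if_not_P[OF False]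
      by (rule UnI1, rule lozengesI[where i = "int x" and j = "n - int v - int x - 2"])
         (use * False w in \<open>auto intro!: line_point_False, auto simp: line_point_def\<close>)
  qed
next
  case (Border s x)
  then have "int x \<in> {0..<n}" using assms fits by auto
  moreover have "tile_of c \<in> border_triangles_at n (int x)"
    unfolding Border border_triangles_at_def by (cases s) (auto simp: line_point_def)
  ultimately show ?thesis unfolding border_triangles_def by blast
qed

text \<open>A lozenge of each of the three forms lies in \<open>U\<close> or in \<open>U'\<close>, which decides the side; level and position can then be
read off from the vertex \<open>(i, j)\<close>.\<close>

lemma lozenge_is_piece:
  assumes t: "t \<in> lozenges n" and bounds: "\<forall>q\<in>tile_vertices t. in_bounds q"
  obtains c where "valid_piece c" "t = tile_of c"
proof -
  have "\<exists>A B C D. t = Lozenge A B C D \<and> ({A, B, C, D} \<subseteq> regionU n \<or> {A, B, C, D} \<subseteq> regionU' n) \<and>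
     (\<exists>i j. (A, B, C, D) = ((i, j), (i+1, j-1), (i+2, j-1), (i+1, j)) \<or>
        (A, B, C, D) = ((i, j), (i, j+1), (i-1, j+2), (i-1, j+1)) \<or>
        (A, B, C, D) = ((i, j), (i+1, j), (i+1, j+1), (i, j+1)))"
    using t by (simp only: lozenges_def mem_Collect_eq)
  then obtain A B C D i j where ABCD: "t = Lozenge A B C D"
    and reg: "{A, B, C, D} \<subseteq> regionU n \<or> {A, B, C, D} \<subseteq> regionU' n"
    and form: "(A, B, C, D) = ((i, j), (i+1, j-1), (i+2, j-1), (i+1, j)) \<or>
        (A, B, C, D) = ((i, j), (i, j+1), (i-1, j+2), (i-1, j+1)) \<or>
        (A, B, C, D) = ((i, j), (i+1, j), (i+1, j+1), (i, j+1))"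
    by (elim exE conjE)
  have b: "in_bounds A" "in_bounds B" "in_bounds C" "in_bounds D"
    using bounds by (auto simp: ABCD)
  have "\<exists>c. valid_piece c \<and> t = tile_of c"
    using form
  proof (elim disjE)
    assume f: "(A, B, C, D) = ((i, j), (i+1, j-1), (i+2, j-1), (i+1, j))"
    from reg show ?thesis
    proof
      assume r: "{A, B, C, D} \<subseteq> regionU n"
      have "0 \<le> i + j - n" "0 \<le> n - j"
        using f b r by (auto simp: in_bounds_def regionU_def)
      then obtain w x where "i + j - n = int w" "n - j = int x"
        by (metis zero_le_imp_eq_int)
      then have ij: "i = int x + int w" "j = n - int x"
        by auto
      have "valid_piece (Forward True w x)"
        using f b unfolding ij by (auto simp: in_bounds_def height_def)
      moreover have "t = tile_of (Forward True w x)"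
        using f unfolding ij by (auto simp: ABCD line_point_def)
      ultimately show ?thesis by blast
    next
      assume r: "{A, B, C, D} \<subseteq> regionU' n"
      have "0 \<le> n - i - j - 1" "0 \<le> i"
        using f b r by (auto simp: in_bounds_def regionU'_def)
      then obtain w x where "n - i - j - 1 = int w" "i = int x"
        by (metis zero_le_imp_eq_int)
      then have ij: "i = int x" "j = n - int w - int x - 1"
        by auto
      have "valid_piece (Backward False w x)"
        using f b unfolding ij by (auto simp: in_bounds_def height_def)
      moreover have "t = tile_of (Backward False w x)"
        using f unfolding ij by (auto simp: ABCD line_point_def)
      ultimately show ?thesis by blast
    qed
  next
    assume f: "(A, B, C, D) = ((i, j), (i, j+1), (i-1, j+2), (i-1, j+1))"
    from reg show ?thesis
    proof
      assume r: "{A, B, C, D} \<subseteq> regionU n"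
      have "0 \<le> i + j - n" "0 \<le> n - j - 2"
        using f b r by (auto simp: in_bounds_def regionU_def)
      then obtain w x where "i + j - n = int w" "n - j - 2 = int x"
        by (metis zero_le_imp_eq_int)
      then have ij: "i = int x + int w + 2" "j = n - int x - 2"
        by auto
      have "valid_piece (Backward True w x)"
        using f b unfolding ij by (auto simp: in_bounds_def height_def)
      moreover have "t = tile_of (Backward True w x)"
        using f unfolding ij by (auto simp: ABCD line_point_def)
      ultimately show ?thesis by blast
    next
      assume r: "{A, B, C, D} \<subseteq> regionU' n"
      have "0 \<le> n - i - j - 1" "0 \<le> i - 1"
        using f b r by (auto simp: in_bounds_def regionU'_def)
      then obtain w x where "n - i - j - 1 = int w" "i - 1 = int x"
        by (metis zero_le_imp_eq_int)
      then have ij: "i = int x + 1" "j = n - int w - int x - 2"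
        by auto
      have "valid_piece (Forward False w x)"
        using f b unfolding ij by (auto simp: in_bounds_def height_def)
      moreover have "t = tile_of (Forward False w x)"
        using f unfolding ij by (auto simp: ABCD line_point_def)
      ultimately show ?thesis by blast
    qed
  next
    assume f: "(A, B, C, D) = ((i, j), (i+1, j), (i+1, j+1), (i, j+1))"
    from reg show ?thesis
    proof
      assume r: "{A, B, C, D} \<subseteq> regionU n"
      have "0 \<le> i + j - n" "0 \<le> n - j - 1"
        using f b r by (auto simp: in_bounds_def regionU_def)
      then obtain w x where "i + j - n = int w" "n - j - 1 = int x"
        by (metis zero_le_imp_eq_int)
      then have ij: "i = int x + int w + 1" "j = n - int x - 1"
        by auto
      have "valid_piece (Cross True (Suc w) x)"
        using f b unfolding ij by (auto simp: in_bounds_def height_def)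
      moreover have "t = tile_of (Cross True (Suc w) x)"
        using f unfolding ij by (auto simp: ABCD line_point_def)
      ultimately show ?thesis by blast
    next
      assume r: "{A, B, C, D} \<subseteq> regionU' n"
      have "0 \<le> n - i - j - 2" "0 \<le> i"
        using f b r by (auto simp: in_bounds_def regionU'_def)
      then obtain w x where "n - i - j - 2 = int w" "i = int x"
        by (metis zero_le_imp_eq_int)
      then have ij: "i = int x" "j = n - int w - int x - 2"
        by auto
      have "valid_piece (Cross False (Suc w) x)"
        using f b unfolding ij by (auto simp: in_bounds_def height_def)
      moreover have "t = tile_of (Cross False (Suc w) x)"
        using f unfolding ij by (auto simp: ABCD line_point_def)
      ultimately show ?thesis by blast
    qed
  qed
  then show ?thesis using that by blast
qed

lemma border_triangles_at_eq:
  "border_triangles_at n (int x) = {tile_of (Border True x), tile_of (Border False x)}"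
  by (auto simp: border_triangles_at_def line_point_def)

lemma border_is_piece:
  assumes "t \<in> border_triangles n" and bounds: "\<forall>q\<in>tile_vertices t. in_bounds q"
  obtains c where "valid_piece c" "t = tile_of c"
proof -
  obtain x where x: "t \<in> border_triangles_at n (int x)"
    using assms(1) unfolding border_triangles_def by (metis UN_E atLeastLessThan_iff zero_le_imp_eq_int)
  then obtain s where s: "t = tile_of (Border s x)"
    unfolding border_triangles_at_eq by blast
  have "in_bounds (P s 0 (Suc x))" using bounds by (simp add: s)
  then have "x < N" by (auto simp: in_bounds_def line_point_def split: if_splits)
  then show ?thesis using that[of "Border s x"] s by simp
qed

end

section \<open>Lozenge tilings are perfect matchings\<close>

context excavation
begin

lemma centroid_in_tile:
  assumes "valid_piece c"
  shows "centroid T \<in> solid (tile_vertices (tile_of c)) \<longleftrightarrow> T \<in> cells_of c"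
proof -
  have "centroid T \<in> solid (cell_vertices T') \<longleftrightarrow> T = T'" for T'
    using generic_cell_unique[OF generic_centroid] centroid_interior[of T] interior_subset by blast
  then show ?thesis
    unfolding solid_tile[OF assms] by (simp del: cell_vertices.simps)
qed

lemma inj_on_tile_of: "inj_on tile_of {c. valid_piece c}"
proof (rule inj_onI)
  fix c d assume "c \<in> {c. valid_piece c}" "d \<in> {c. valid_piece c}" "tile_of c = tile_of d"
  then have v: "valid_piece c" "valid_piece d" and eq: "tile_of c = tile_of d" by blast+
  have "T \<in> cells_of c \<longleftrightarrow> T \<in> cells_of d" for T
    unfolding centroid_in_tile[OF v(1), symmetric] centroid_in_tile[OF v(2), symmetric] eq ..
  then show "c = d"
    using cells_of_inj[OF v] by blast
qed

text \<open>The equator of the hexagon is the union of the first \<open>N\<close> border edges of the square.\<close>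

lemma border_edge_on_equator:
  assumes "i \<in> {0..<n}"
  shows "closed_segment (real_point (i, n - i)) (real_point (i + 1, n - i - 1)) \<subseteq> equator n (int W, n - int Z) \<longleftrightarrow> i < int N"
proof -
  let ?A = "real_point (0, n)" and ?D = "real_point (int N, n - int N)"
  have eq: "equator n (int W, n - int Z) = closed_segment ?A ?D"
    by (simp add: equator_def hexagon_def algebra_simps)
  have Npos: "0 < real N" using W_pos by simp
  have on: "real_point (k, n - k) \<in> closed_segment ?A ?D" if "0 \<le> k" "k \<le> int N" for k
  proof -
    define u where "u = real_of_int k / real N"
    have "real_of_int k \<le> real N" using that(2) by linarith
    then have u: "0 \<le> u" "u \<le> 1" "u * (real W + real Z) = real_of_int k"
      using that(1) Npos by (simp_all add: u_def)
    have "real_point (k, n - k) = (1 - u) *\<^sub>R ?A + u *\<^sub>R ?D"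
      using u(3) by (simp add: real_point_def algebra_simps)
    then show ?thesis
      unfolding in_segment using u by blast
  qed
  have "closed_segment ?A ?D \<subseteq> {p. 1 * fst p + 0 * snd p \<le> real N}"
    unfolding segment_convex_hull by (intro hull_minimal convex_affine_le) (auto simp: real_point_def)
  then have off: "k \<le> int N" if "real_point (k, m) \<in> closed_segment ?A ?D" for k m
    using that by (auto simp: real_point_def)
  show ?thesis
  proof
    assume "closed_segment (real_point (i, n - i)) (real_point (i + 1, n - i - 1)) \<subseteq> equator n (int W, n - int Z)"
    then show "i < int N"
      using off[of "i + 1" "n - i - 1"] ends_in_segment(2) unfolding eq by fastforce
  next
    assume "i < int N"
    then show "closed_segment (real_point (i, n - i)) (real_point (i + 1, n - i - 1)) \<subseteq> equator n (int W, n - int Z)"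
      unfolding eq using on[of i] on[of "i + 1"] assms
      by (intro closed_segment_subset) (auto simp: algebra_simps)
  qed
qed

text \<open>The tile that contains the centroid of a cell covers that cell. Two such tiles coincide, as the centroid is
interior to both of them.\<close>

lemma tiling_is_perfect:
  assumes "\<Xi> \<in> lozenge_tilings n (int W, n - int Z)"
  obtains X where "perfect X" "\<Xi> = tile_of ` X"
proof
  define X where "X = {c. valid_piece c \<and> tile_of c \<in> \<Xi>}"
  have sub: "\<Xi> \<subseteq> lozenges n \<union> border_triangles n"
    and cover: "(\<Union>t\<in>\<Xi>. solid (tile_vertices t)) = solid_hexagon n (int W, n - int Z)"
    and disj: "pairwise (\<lambda>s t. interior (solid (tile_vertices s)) \<inter> interior (solid (tile_vertices t)) = {}) \<Xi>"
    and border: "\<And>i. i \<in> {0..<n} \<Longrightarrow> i < int N \<Longrightarrow> \<exists>!t. t \<in> \<Xi> \<and> t \<in> border_triangles_at n i"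
    using assms border_edge_on_equator unfolding lozenge_tilings_def mem_Collect_eq by blast+
  have piece: "\<exists>c\<in>X. t = tile_of c" if t: "t \<in> \<Xi>" for t
  proof -
    have "in_bounds q" if "q \<in> tile_vertices t" for q
    proof -
      have "real_point q \<in> solid (tile_vertices t)"
        unfolding solid_def using that by (intro hull_inc) auto
      then show ?thesis
        using cover t solid_hexagon_subset real_point_hull_region by blast
    qed
    then obtain c where "valid_piece c" "t = tile_of c"
      using sub t lozenge_is_piece border_is_piece by blast
    then show ?thesis using t by (auto simp: X_def)
  qed
  then show "\<Xi> = tile_of ` X" by (auto simp: X_def)
  have inX: "c \<in> X \<longleftrightarrow> tile_of c \<in> \<Xi>" if "valid_piece c" for c
    using that by (simp add: X_def)
  show "perfect X"
    unfolding perfect_def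
  proof (intro conjI allI impI ballI)
    show "valid_piece c" if "c \<in> X" for c
      using that by (simp add: X_def)
  next
    fix T assume T: "valid_cell T"
    show "\<exists>!c. c \<in> X \<and> T \<in> cells_of c"
    proof (rule ex_ex1I)
      have "centroid T \<in> solid_hexagon n (int W, n - int Z)"
        unfolding solid_hexagon_cells using T centroid_interior interior_subset by blast
      then obtain t where t: "t \<in> \<Xi>" "centroid T \<in> solid (tile_vertices t)"
        using cover by blast
      obtain c where c: "c \<in> X" "t = tile_of c"
        using piece[OF t(1)] by blast
      have "T \<in> cells_of c"
        using t(2) centroid_in_tile[of c T] c by (simp add: X_def)
      then show "\<exists>c. c \<in> X \<and> T \<in> cells_of c"
        using c(1) by blast
    next
      fix c d assume cd: "c \<in> X \<and> T \<in> cells_of c" "d \<in> X \<and> T \<in> cells_of d"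
      have int: "centroid T \<in> interior (solid (tile_vertices (tile_of b)))" if "b \<in> X \<and> T \<in> cells_of b" for b
      proof -
        have "solid (cell_vertices T) \<subseteq> solid (tile_vertices (tile_of b))"
          using that solid_tile[of b] by (auto simp: X_def)
        then show ?thesis using centroid_interior interior_mono by blast
      qed
      have "tile_of c = tile_of d"
        using disj int[OF cd(1)] int[OF cd(2)] cd by (auto simp: pairwise_def X_def)
      then show "c = d"
        using inj_on_tile_of cd by (auto simp: X_def inj_on_def)
    qed
  next
    fix x assume x: "x < N"
    then have v: "valid_piece (Border s x)" for s by simp
    have ne: "tile_of (Border True x) \<noteq> tile_of (Border False x)"
      using inj_on_tile_of v unfolding inj_on_def by blast
    have "int x \<in> {0..<n}" "int x < int N" using x fits by auto
    from border[OF this] have "\<exists>!t. t \<in> \<Xi> \<and> t \<in> {tile_of (Border True x), tile_of (Border False x)}"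
      by (simp only: border_triangles_at_eq)
    then show "Border True x \<in> X \<longleftrightarrow> Border False x \<notin> X"
      unfolding inX[OF v] using ne by blast
  qed
qed

text \<open>If the interiors of two tiles met, a generic point of the intersection would lie in a common cell.\<close>

lemma perfect_is_tiling:
  assumes "perfect X"
  shows "tile_of ` X \<in> lozenge_tilings n (int W, n - int Z)"
  unfolding lozenge_tilings_def mem_Collect_eq
proof (intro conjI ballI impI)
  have v: "valid_piece c" if "c \<in> X" for c
    using perfect_valid[OF assms that] .
  have ex1: "\<exists>!c. c \<in> X \<and> T \<in> cells_of c" if "valid_cell T" for T
    using assms that by (simp add: perfect_def)
  show "tile_of ` X \<subseteq> lozenges n \<union> border_triangles n"
    using tile_of_in v by blast
  have "(\<Union>t\<in>tile_of ` X. solid (tile_vertices t)) = (\<Union>c\<in>X. \<Union>T\<in>cells_of c. solid (cell_vertices T))"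
    using solid_tile v by simp
  also have "\<dots> = (\<Union>T\<in>{T. valid_cell T}. solid (cell_vertices T))"
  proof -
    have "(\<Union>c\<in>X. cells_of c) = {T. valid_cell T}"
    proof (intro equalityI subsetI)
      fix T assume "T \<in> (\<Union>c\<in>X. cells_of c)"
      then obtain c where "c \<in> X" "T \<in> cells_of c" by (rule UN_E)
      then show "T \<in> {T. valid_cell T}"
        using v[of c] unfolding valid_piece_iff by simp
    next
      fix T assume "T \<in> {T. valid_cell T}"
      then obtain c where "c \<in> X" "T \<in> cells_of c" using ex1[of T] by auto
      then show "T \<in> (\<Union>c\<in>X. cells_of c)" by (rule UN_I)
    qed
    then show ?thesis
      by (simp only: UN_UN_flatten[symmetric])
  qed
  finally show "(\<Union>t\<in>tile_of ` X. solid (tile_vertices t)) = solid_hexagon n (int W, n - int Z)"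
    by (simp only: solid_hexagon_cells)
  show "pairwise (\<lambda>s t. interior (solid (tile_vertices s)) \<inter> interior (solid (tile_vertices t)) = {}) (tile_of ` X)"
  proof (rule pairwiseI, rule ccontr)
    fix s t
    assume st: "s \<in> tile_of ` X" "t \<in> tile_of ` X" "s \<noteq> t"
      and ne: "interior (solid (tile_vertices s)) \<inter> interior (solid (tile_vertices t)) \<noteq> {}"
    then obtain c d where c: "c \<in> X" "s = tile_of c" and d: "d \<in> X" "t = tile_of d" by blast
    obtain p where p: "p \<in> interior (solid (tile_vertices s)) \<inter> interior (solid (tile_vertices t))" "generic p"
      using open_contains_generic[OF _ ne] by blast
    then have "p \<in> solid (tile_vertices s)" "p \<in> solid (tile_vertices t)"
      using interior_subset by blast+
    then obtain T T' where T: "T \<in> cells_of c" "p \<in> solid (cell_vertices T)"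
      and T': "T' \<in> cells_of d" "p \<in> solid (cell_vertices T')"
      using solid_tile[OF v[OF c(1)]] solid_tile[OF v[OF d(1)]] c d by blast
    have "T = T'"
      using generic_cell_unique p(2) T(2) T'(2) .
    have "valid_cell T"
      using v[OF c(1)] T(1) unfolding valid_piece_iff by simp
    from ex1[OF this] have "c = d"
      using \<open>T = T'\<close> T(1) T'(1) c(1) d(1) by blast
    then show False using st c d by simp
  qed
  fix i assume i: "i \<in> {0..<n}"
    and "closed_segment (real_point (i, n - i)) (real_point (i + 1, n - i - 1)) \<subseteq> equator n (int W, n - int Z)"
  then have "i < int N" using border_edge_on_equator by blast
  then obtain x where x: "i = int x" "x < N"
    using i by (metis atLeastLessThan_iff of_nat_less_iff zero_le_imp_eq_int)
  have mem: "tile_of (Border s x) \<in> tile_of ` X \<longleftrightarrow> Border s x \<in> X" for s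
    using inj_on_image_mem_iff[OF inj_on_tile_of, of "Border s x" X] v x(2) by auto
  have "Border True x \<in> X \<longleftrightarrow> Border False x \<notin> X"
    using assms x(2) by (simp add: perfect_def)
  then obtain s where s: "Border s x \<in> X" "Border (\<not> s) x \<notin> X"
    by (cases "Border True x \<in> X") (auto intro: that)
  have "border_triangles_at n i = {tile_of (Border s x), tile_of (Border (\<not> s) x)}"
    unfolding x(1) border_triangles_at_eq by (cases s) auto
  moreover have "tile_of (Border s x) \<in> tile_of ` X" "tile_of (Border (\<not> s) x) \<notin> tile_of ` X"
    unfolding mem using s by blast+
  ultimately show "\<exists>!t. t \<in> tile_of ` X \<and> t \<in> border_triangles_at n i"
    by (intro ex1I[of _ "tile_of (Border s x)"]) (simp_all del: tile_of.simps, metis)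
qed

lemma lozenge_tilings_eq: "lozenge_tilings n (int W, n - int Z) = (`) tile_of ` {X. perfect X}"
proof (intro equalityI subsetI)
  fix \<Xi> assume "\<Xi> \<in> lozenge_tilings n (int W, n - int Z)"
  then obtain X where "perfect X" "\<Xi> = tile_of ` X" by (rule tiling_is_perfect)
  then show "\<Xi> \<in> (`) tile_of ` {X. perfect X}" by simp
next
  fix \<Xi> assume "\<Xi> \<in> (`) tile_of ` {X. perfect X}"
  then obtain X where "perfect X" "\<Xi> = tile_of ` X" by auto
  then show "\<Xi> \<in> lozenge_tilings n (int W, n - int Z)" by (simp only: perfect_is_tiling)
qed

definition total_weight :: "(point \<Rightarrow> real) \<Rightarrow> piece set \<Rightarrow> real" where
  "total_weight k X = (\<Sum>c\<in>X. tile_weight k (tile_of c)) + hexagon_weight k n (int W, n - int Z)"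

lemma tiling_weight_eq:
  assumes "perfect X"
  shows "tiling_weight n (int W, n - int Z) (tile_of ` X) \<gamma> g1 g2 = total_weight (ktilde n \<gamma> g1 g2) X"
proof -
  have "inj_on tile_of X"
    using inj_on_subset[OF inj_on_tile_of] perfect_valid[OF assms] by blast
  then show ?thesis
    by (simp add: tiling_weight_def total_weight_def sum.reindex)
qed

lemma total_weight_add: "total_weight (\<lambda>p. k p + k' p) X = total_weight k X + total_weight k' X"
proof -
  have "tile_weight (\<lambda>p. k p + k' p) t = tile_weight k t + tile_weight k' t" for t
    by (cases t) (auto simp: field_simps)
  then show ?thesis
    by (simp add: total_weight_def sum.distrib hexagon_weight_def hexagon_def field_simps)
qed

text \<open>If \<open>k\<close> depends only on the position, then all lozenges of form (iii) have weight zero, and each border triangle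
contributes the negative of the value at the right end of its edge, whichever side it lies on.\<close>

lemma total_weight_position_only:
  assumes X: "perfect X" and k: "\<And>s w x. w \<le> height s \<Longrightarrow> w + x \<le> N \<Longrightarrow> k (P s w x) = f x"
  shows "total_weight k X = f 0"
proof -
  define M where "M s w = (\<Sum>x<N - w. of_bool (line_bits X s w x) * f (Suc x))" for s w
  have "side_value k X s = - M s 0" for s
  proof -
    have "side_value k X s = (\<Sum>w<height s. M s (Suc w) - M s w)"
      unfolding side_value_def
    proof (rule sum.cong[OF refl])
      fix w assume "w \<in> {..<height s}"
      then have w: "w < height s" by simp
      have lv: "line_value k s v x = f x" if "v \<le> Suc w" "v + x \<le> N" for v x
        using k[of v s x] w that by (simp add: line_value_def)
      have "strip_weight (N - w) (line_value k s w) (line_value k s (Suc w)) (line_bits X s w) (line_bits X s (Suc w)) =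
        (\<Sum>x<N - w. of_bool (line_bits X s w x) * (- f (Suc x))) + (\<Sum>x<N - w - 1. of_bool (line_bits X s (Suc w) x) * f (Suc x))"
        unfolding strip_weight_def using lv by (intro arg_cong2[of _ _ _ _ "(+)"] sum.cong) (auto simp: less_diff_conv)
      then show "strip_weight (N - w) (line_value k s w) (line_value k s (Suc w)) (line_bits X s w) (line_bits X s (Suc w))
          = M s (Suc w) - M s w"
        by (simp add: M_def sum_negf)
    qed
    also have "\<dots> = M s (height s) - M s 0"
      by (rule sum_lessThan_telescope)
    also have "M s (height s) = 0"
      using perfect_top[OF X] by (simp add: M_def)
    finally show ?thesis by simp
  qed
  moreover have "M True 0 + M False 0 = (\<Sum>x<N. f (Suc x))"
    unfolding M_def sum.distrib[symmetric] using perfect_equator[OF X] by (intro sum.cong) auto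
  moreover have "(\<Sum>x\<le>N. line_value k True 0 x) = (\<Sum>x\<le>N. f x)"
    using k[of 0 True] by (intro sum.cong) (auto simp: line_value_def)
  moreover have "(\<Sum>x\<le>N. f x) = f 0 + (\<Sum>x<N. f (Suc x))"
    by (rule sum.atMost_shift)
  ultimately show ?thesis
    unfolding total_weight_def perfect_weight[OF X] by simp
qed

text \<open>The summand of \<open>ktilde\<close> that involves \<open>\<gamma>\<close> is the sum of \<open>\<gamma>\<close> over the last \<open>x\<close> indices, with a minus sign, where \<open>x\<close>
is the position on the line; it vanishes at the start of the equator.\<close>

lemma total_weight_ktilde:
  assumes X: "perfect X"
  shows "total_weight (ktilde n \<gamma> g1 g2) X = total_weight (ktilde n (\<lambda>_. 0) g1 g2) X"
proof -
  define k\<^sub>\<gamma> where "k\<^sub>\<gamma> = ktilde n \<gamma> (\<lambda>_. 0) (\<lambda>_. 0)"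
  have "ktilde n \<gamma> g1 g2 = (\<lambda>p. k\<^sub>\<gamma> p + ktilde n (\<lambda>_. 0) g1 g2 p)"
    by (auto simp: ktilde_def k\<^sub>\<gamma>_def fun_eq_iff)
  moreover have "total_weight k\<^sub>\<gamma> X = - (\<Sum>l=n - int 0 + 1..n. \<gamma> l)"
  proof (rule total_weight_position_only[OF X])
    fix s w x assume "w + x \<le> N"
    then have "(int x + int w, n - int x) \<in> regionU n" "(int x, n - int w - int x) \<in> regionU' n"
      using line_point_True[of x w] line_point_False[of w x] by (simp_all add: line_point_def)
    then show "k\<^sub>\<gamma> (P s w x) = - (\<Sum>l=n - int x + 1..n. \<gamma> l)"
      using ktilde_regionU'[of "int x" "n - int w - int x" n \<gamma> "\<lambda>_. 0" "\<lambda>_. 0"]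
      by (cases s) (simp_all add: k\<^sub>\<gamma>_def line_point_def, simp add: ktilde_def)
  qed
  ultimately show ?thesis
    by (simp add: total_weight_add)
qed

lemma total_weight_le: "perfect X \<Longrightarrow> total_weight k X \<le> oct_value n k Z W 0"
  using perfect_value_le[of X k] perfect_weight[of X k] by (simp add: total_weight_def)

lemma total_weight_attained: obtains X where "perfect X" "total_weight k X = oct_value n k Z W 0"
proof -
  obtain X where X: "perfect X"
    "side_value k X True + side_value k X False = oct_value n k Z W 0 - (\<Sum>x\<le>N. line_value k True 0 x)"
    by (rule perfect_value_attained)
  show ?thesis
    by (rule that[OF X(1)]) (use X perfect_weight[OF X(1), of k] in \<open>simp add: total_weight_def\<close>)
qed

end

section \<open>Linear functionals and independence of the gaps\<close>

text \<open>Linearity on all pairs of arrays is closed under the operations that build weights from entries, in a form that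
composes more easily than the restriction to patterns.\<close>

definition linear_form :: "int \<Rightarrow> (pattern \<Rightarrow> pattern \<Rightarrow> real) \<Rightarrow> bool" where
  "linear_form n f \<longleftrightarrow> (\<exists>a b. \<forall>g1 g2. f g1 g2 = (\<Sum>p\<in>pattern_idx n. a p * g1 p) + (\<Sum>p\<in>pattern_idx n. b p * g2 p))"

lemma finite_pattern_idx: "finite (pattern_idx n)"
  by (rule finite_subset[of _ "{1..n} \<times> {1..n}"]) (auto simp: pattern_idx_def)

lemma linear_form_add:
  assumes "linear_form n f" "linear_form n f'"
  shows "linear_form n (\<lambda>g1 g2. f g1 g2 + f' g1 g2)"
proof -
  obtain a b a' b' where "\<And>g1 g2. f g1 g2 = (\<Sum>p\<in>pattern_idx n. a p * g1 p) + (\<Sum>p\<in>pattern_idx n. b p * g2 p)"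
    "\<And>g1 g2. f' g1 g2 = (\<Sum>p\<in>pattern_idx n. a' p * g1 p) + (\<Sum>p\<in>pattern_idx n. b' p * g2 p)"
    using assms unfolding linear_form_def by blast
  then show ?thesis
    unfolding linear_form_def
    by (intro exI[of _ "\<lambda>p. a p + a' p"] exI[of _ "\<lambda>p. b p + b' p"]) (simp add: distrib_right sum.distrib)
qed

lemma linear_form_scale:
  assumes "linear_form n f"
  shows "linear_form n (\<lambda>g1 g2. r * f g1 g2)"
proof -
  obtain a b where "\<And>g1 g2. f g1 g2 = (\<Sum>p\<in>pattern_idx n. a p * g1 p) + (\<Sum>p\<in>pattern_idx n. b p * g2 p)"
    using assms unfolding linear_form_def by blast
  then show ?thesis
    unfolding linear_form_def
    by (intro exI[of _ "\<lambda>p. r * a p"] exI[of _ "\<lambda>p. r * b p"]) (simp add: distrib_left sum_distrib_left mult.assoc)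
qed

lemma linear_form_0: "linear_form n (\<lambda>g1 g2. 0)"
  unfolding linear_form_def by (intro exI[of _ "\<lambda>_. 0"]) simp

lemma linear_form_diff: "linear_form n f \<Longrightarrow> linear_form n f' \<Longrightarrow> linear_form n (\<lambda>g1 g2. f g1 g2 - f' g1 g2)"
  using linear_form_add[of n f "\<lambda>g1 g2. (-1) * f' g1 g2"] linear_form_scale[of n f' "-1"] by simp

lemma linear_form_divide: "linear_form n f \<Longrightarrow> linear_form n (\<lambda>g1 g2. f g1 g2 / r)"
  using linear_form_scale[of n f "1 / r"] by simp

lemma linear_form_sum: "(\<And>i. i \<in> I \<Longrightarrow> linear_form n (f i)) \<Longrightarrow> linear_form n (\<lambda>g1 g2. \<Sum>i\<in>I. f i g1 g2)"
  by (induction I rule: infinite_finite_induct) (auto intro: linear_form_0 linear_form_add)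

lemma linear_form_entry1: "p \<in> pattern_idx n \<Longrightarrow> linear_form n (\<lambda>g1 g2. g1 p)"
  unfolding linear_form_def
  by (intro exI[of _ "\<lambda>q. of_bool (q = p)"] exI[of _ "\<lambda>_. 0"]) (simp add: finite_pattern_idx of_bool_def if_distrib[of "\<lambda>x. x * _"] cong: if_cong)

lemma linear_form_entry2: "p \<in> pattern_idx n \<Longrightarrow> linear_form n (\<lambda>g1 g2. g2 p)"
  unfolding linear_form_def
  by (intro exI[of _ "\<lambda>_. 0"] exI[of _ "\<lambda>q. of_bool (q = p)"]) (simp add: finite_pattern_idx of_bool_def if_distrib[of "\<lambda>x. x * _"] cong: if_cong)

lemma linear_form_ktilde:
  assumes "q \<in> regionU n \<union> regionU' n"
  shows "linear_form n (\<lambda>g1 g2. ktilde n (\<lambda>_. 0) g1 g2 q)"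
proof -
  obtain i j where q: "q = (i, j)" by (cases q)
  show ?thesis
  proof (cases "q \<in> regionU n")
    case True
    then have "linear_form n (\<lambda>g1 g2. (\<Sum>l=1..j. g1 (l, j)) + (\<Sum>l=1..i+j-n. g2 (l, j)))"
      by (intro linear_form_add linear_form_sum linear_form_entry1 linear_form_entry2)
         (auto simp: q regionU_def pattern_idx_def)
    then show ?thesis using True by (simp add: ktilde_def q)
  next
    case False
    then have "q \<in> regionU' n" using assms by blast
    then have "linear_form n (\<lambda>g1 g2. \<Sum>l=1..j. g1 (l, n - i))"
      by (intro linear_form_sum linear_form_entry1) (auto simp: q regionU'_def pattern_idx_def)
    then show ?thesis using False by (simp add: ktilde_def q)
  qed
qed

lemma linear_form_tile_weight:
  assumes "t \<in> lozenges n \<union> border_triangles n"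
  shows "linear_form n (\<lambda>g1 g2. tile_weight (ktilde n (\<lambda>_. 0) g1 g2) t)"
proof -
  have "tile_vertices t \<subseteq> regionU n \<union> regionU' n"
    using assms
  proof
    assume "t \<in> border_triangles n"
    then show ?thesis
      by (auto simp: border_triangles_def border_triangles_at_def regionU_def regionU'_def)
  next
    assume "t \<in> lozenges n"
    then obtain A B C D where "t = Lozenge A B C D" "{A, B, C, D} \<subseteq> regionU n \<or> {A, B, C, D} \<subseteq> regionU' n"
      unfolding lozenges_def by fast
    then show ?thesis by auto
  qed
  then show ?thesis
    by (cases t) (auto intro!: linear_form_add linear_form_diff linear_form_divide linear_form_ktilde)
qed

lemma linear_form_tiling_weight:
  assumes "\<Xi> \<subseteq> lozenges n \<union> border_triangles n" "0 \<le> i" "i \<le> j" "j \<le> n"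
  shows "linear_form n (tiling_weight n (i, j) \<Xi> (\<lambda>_. 0))"
proof -
  have "linear_form n (\<lambda>g1 g2. hexagon_weight (ktilde n (\<lambda>_. 0) g1 g2) n (i, j))"
    unfolding hexagon_weight_def hexagon_def prod.case
    using assms(2-) by (intro linear_form_add linear_form_diff linear_form_divide linear_form_ktilde)
      (auto simp: regionU_def regionU'_def)
  moreover have "linear_form n (\<lambda>g1 g2. \<Sum>t\<in>\<Xi>. tile_weight (ktilde n (\<lambda>_. 0) g1 g2) t)"
    using assms(1) by (intro linear_form_sum linear_form_tile_weight) blast
  ultimately show ?thesis
    unfolding tiling_weight_def[abs_def] by (rule linear_form_add[rotated])
qed

lemma large_gaps_nonempty: "large_gaps n lam mu \<noteq> {}"
proof -
  define c where "c = \<bar>(lam (1, n) - lam (n, n)) + (mu (1, n) - mu (n, n))\<bar> + 1"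
  have "(\<lambda>i. - (real_of_int i * c)) \<in> large_gaps n lam mu"
    by (auto simp: large_gaps_def c_def algebra_simps)
  then show ?thesis by blast
qed

lemma gap_independent_eq:
  assumes "\<And>\<gamma>. F \<gamma> g1 g2 = F' g1 g2"
  shows "gap_independent n F (g1, g2) = F' g1 g2"
  using large_gaps_nonempty[of n g1 g2] by (auto simp: gap_independent_def assms)

lemma linear_functional_gap_independent:
  assumes "\<And>\<gamma> g1 g2. F \<gamma> g1 g2 = F (\<lambda>_. 0) g1 g2" "linear_form n (F (\<lambda>_. 0))"
  shows "linear_functional_on_GT n (gap_independent n F)"
proof -
  have "gap_independent n F (g1, g2) = F (\<lambda>_. 0) g1 g2" for g1 g2
    using assms(1) by (rule gap_independent_eq)
  moreover obtain a b where
    "\<And>g1 g2. F (\<lambda>_. 0) g1 g2 = (\<Sum>p\<in>pattern_idx n. a p * g1 p) + (\<Sum>p\<in>pattern_idx n. b p * g2 p)"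
    using assms(2) unfolding linear_form_def by blast
  ultimately show ?thesis
    unfolding linear_functional_on_GT_def by (intro exI[of _ a] exI[of _ b]) simp
qed

text \<open>In the interior the functionals are the total weights of the perfect matchings, whose maximum was computed above. On the
boundary of the square the hive value is one of the initial data, in which \<open>\<gamma>\<close> does not occur.\<close>

theorem theorem2:
  fixes n :: int and v :: point
  assumes "n \<ge> 2" and "v \<in> triangleT n"
  shows "finite (functionals n v) \<and> functionals n v \<noteq> {} \<and>
    (\<forall>w\<in>functionals n v. linear_functional_on_GT n w) \<and>
    (\<forall>g1\<in>GT_patterns n. \<forall>g2\<in>GT_patterns n. \<forall>\<gamma>\<in>large_gaps n g1 g2. \<forall>h g.
       (h, g) = oct n \<gamma> g1 g2 \<longrightarrow>
       h v = Max ((\<lambda>w. w (g1, g2)) ` functionals n v))"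
proof -
  obtain i j where v: "v = (i, j)" by (cases v)
  have ij: "0 \<le> i" "i \<le> j" "j \<le> n"
    using assms(2) by (auto simp: v triangleT_def)
  show ?thesis
  proof (cases "0 < i \<and> j < n")
    case True
    define W Z where "W = nat i" and "Z = nat (n - j)"
    have WZ: "v = (int W, n - int Z)"
      using True by (simp add: v W_def Z_def)
    interpret excavation n W Z
      by unfold_locales (use True ij in \<open>auto simp: W_def Z_def\<close>)
    define F where "F X = gap_independent n (tiling_weight n v (tile_of ` X))" for X
    have fun_eq: "functionals n v = F ` {X. perfect X}"
      using True ij unfolding functionals_def WZ[symmetric] lozenge_tilings_eq[folded WZ] F_def
      by (auto simp: v image_image)
    have indep: "tiling_weight n v (tile_of ` X) \<gamma> g1 g2 = tiling_weight n v (tile_of ` X) (\<lambda>_. 0) g1 g2"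
      if "perfect X" for X \<gamma> g1 g2
      using tiling_weight_eq[OF that] total_weight_ktilde[OF that] unfolding WZ by simp
    have F: "F X (g1, g2) = total_weight (ktilde n \<gamma> g1 g2) X" if "perfect X" for X \<gamma> g1 g2
    proof -
      have "F X (g1, g2) = tiling_weight n v (tile_of ` X) (\<lambda>_. 0) g1 g2"
        unfolding F_def by (rule gap_independent_eq) (rule indep[OF that])
      then show ?thesis
        using tiling_weight_eq[OF that, of "\<lambda>_. 0" g1 g2] total_weight_ktilde[OF that, of \<gamma> g1 g2] unfolding WZ by simp
    qed
    have "{X. perfect X} \<subseteq> Pow {c. valid_piece c}"
      using perfect_valid by blast
    then have fin: "finite (functionals n v)"
      unfolding fun_eq using finite_valid(2) finite_subset by blast
    have ne: "functionals n v \<noteq> {}"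
      unfolding fun_eq using total_weight_attained[of "\<lambda>_. 0"] by blast
    have lin: "linear_functional_on_GT n w" if "w \<in> functionals n v" for w
    proof -
      obtain X where X: "perfect X" "w = F X"
        using \<open>w \<in> functionals n v\<close> fun_eq by blast
      show ?thesis
        unfolding X(2) F_def
      proof (rule linear_functional_gap_independent)
        show "linear_form n (tiling_weight n v (tile_of ` X) (\<lambda>_. 0))"
          unfolding v using perfect_is_tiling[OF X(1)] ij
          by (intro linear_form_tiling_weight) (auto simp: lozenge_tilings_def)
      qed (rule indep[OF X(1)])
    qed
    have "h v = Max ((\<lambda>w. w (g1, g2)) ` functionals n v)" if "(h, g) = oct n \<gamma> g1 g2" for g1 g2 \<gamma> h g
    proof -
      let ?k = "ktilde n \<gamma> g1 g2"
      have h: "h v = oct_value n ?k Z W 0"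
        using oct_hive_value[OF that, of i j] assms(2) by (simp add: v W_def Z_def)
      obtain X where X: "perfect X" "total_weight ?k X = oct_value n ?k Z W 0"
        using total_weight_attained by blast
      show ?thesis
      proof (rule Max_eqI[symmetric])
        show "finite ((\<lambda>w. w (g1, g2)) ` functionals n v)"
          using fin by blast
        show "y \<le> h v" if "y \<in> (\<lambda>w. w (g1, g2)) ` functionals n v" for y
          using that total_weight_le F[of _ g1 g2 \<gamma>] unfolding h fun_eq by auto
        show "h v \<in> (\<lambda>w. w (g1, g2)) ` functionals n v"
          using X F[OF X(1), of g1 g2 \<gamma>] unfolding h fun_eq by (metis (mono_tags) image_eqI mem_Collect_eq)
      qed
    qed
    then show ?thesis using fin ne lin by blast
  next
    case False
    then have boundary: "i = 0 \<or> j = n" using ij by auto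
    define F where "F \<gamma> g1 g2 = ktilde n \<gamma> g1 g2 v" for \<gamma> g1 g2
    have F0: "F \<gamma> g1 g2 = F (\<lambda>_. 0) g1 g2" for \<gamma> g1 g2
      using boundary ij by (auto simp: F_def v ktilde_def regionU_def)
    have eq: "functionals n v = {gap_independent n F}"
      using False ij unfolding functionals_def F_def by (auto simp: v)
    have "v \<in> regionU n \<union> regionU' n"
      using boundary ij by (auto simp: v regionU_def regionU'_def)
    then have "linear_functional_on_GT n (gap_independent n F)"
      using F0 by (intro linear_functional_gap_independent) (auto simp: F_def[abs_def] linear_form_ktilde)
    moreover have "h v = gap_independent n F (g1, g2)" if "(h, g) = oct n \<gamma> g1 g2" for g1 g2 \<gamma> h g
    proof -
      have "gap_independent n F (g1, g2) = F \<gamma> g1 g2"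
        using gap_independent_eq[of F g1 g2 "F (\<lambda>_. 0)" n] F0 by metis
      also have "\<dots> = oct_value n (ktilde n \<gamma> g1 g2) (nat (n - j)) (nat i) 0"
        using boundary ij by (auto simp: F_def v oct_value_0)
      also have "\<dots> = h v"
        using oct_hive_value[OF that, of i j] assms(2) by (simp add: v)
      finally show ?thesis by simp
    qed
    ultimately show ?thesis by (simp add: eq)
  qed
qed


end
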